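(* Let $E\subset\mathbb{Z}^2$ be a subset with positive upper Banach density $d^*(E)>0$. Then for every $\epsilon>0$, the set $$\{n\in\mathbb{Z}\colon\ d^*\big(E\cap(E+(n,0))\cap(E+(0,n))\big)>d^*(E)^4-\epsilon\}$$ is syndetic.
   Context: The upper Banach density of a subset $E$ of $\mathbb{Z}^2$ is $$d^*(E)=\limsup_{\substack{N_1-M_1\to\infty\\ N_2-M_2\to\infty}}\frac{|E\cap[M_1,N_1)\times[M_2,N_2)|}{(N_1-M_1)\times(N_2-M_2)}.$$ A subset $F$ of $\mathbb{Z}$ is syndetic if there exists an integer $N>0$ such that $F\cap[M,M+N)\neq\emptyset$ for every $M\in\mathbb{Z}$. *)

theory Defs
  imports "HOL-Analysis.Analysis"
begin

(* The filter on tuples (M1, N1, M2, N2), standing for the box [M1, N1) x [M2, N2), along which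
   both N1 - M1 and N2 - M2 tend to infinity; the position of the box is unrestricted. *)
definition large_boxes :: "(int \<times> int \<times> int \<times> int) filter" where
  "large_boxes =
     filtercomap (\<lambda>(M1, N1, M2, N2). (N1 - M1, N2 - M2)) (at_top \<times>\<^sub>F at_top)"

definition box_density :: "(int \<times> int) set \<Rightarrow> int \<times> int \<times> int \<times> int \<Rightarrow> real" where
  "box_density E = (\<lambda>(M1, N1, M2, N2).
     real (card (E \<inter> ({M1..<N1} \<times> {M2..<N2})))
       / (real_of_int (N1 - M1) * real_of_int (N2 - M2)))"

(* Limsup needs a complete lattice, hence the detour through ereal; it loses nothing, because the
   limit superior lies in [0, 1] (see ereal_upper_Banach_density below). *)
definition upper_Banach_density :: "(int \<times> int) set \<Rightarrow> real" where
  "upper_Banach_density E = real_of_ereal (Limsup large_boxes (\<lambda>b. ereal (box_density E b)))"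

definition syndetic :: "int set \<Rightarrow> bool" where
  "syndetic F \<longleftrightarrow> (\<exists>N>0. \<forall>M. F \<inter> {M..<M + N} \<noteq> {})"

lemma eventually_large_boxes:
  "eventually P large_boxes \<longleftrightarrow>
     (\<exists>L. \<forall>M1 N1 M2 N2. N1 - M1 \<ge> L \<longrightarrow> N2 - M2 \<ge> L \<longrightarrow> P (M1, N1, M2, N2))"
proof
  assume "eventually P large_boxes"
  then obtain Q where Q: "eventually Q (at_top \<times>\<^sub>F at_top)"
    and QP: "\<And>b. Q (case b of (M1, N1, M2, N2) \<Rightarrow> (N1 - M1, N2 - M2)) \<Longrightarrow> P b"
    unfolding large_boxes_def eventually_filtercomap by blast
  from Q obtain A B where A: "eventually A (at_top :: int filter)"
    and B: "eventually B (at_top :: int filter)"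
    and AB: "\<And>x y. A x \<Longrightarrow> B y \<Longrightarrow> Q (x, y)"
    unfolding eventually_prod_filter by blast
  from A B obtain a b where "\<forall>x\<ge>a. A x" "\<forall>x\<ge>b. B x"
    unfolding eventually_at_top_linorder by blast
  then have "\<forall>M1 N1 M2 N2. N1 - M1 \<ge> max a b \<longrightarrow> N2 - M2 \<ge> max a b \<longrightarrow> P (M1, N1, M2, N2)"
    using AB QP by auto
  then show "\<exists>L. \<forall>M1 N1 M2 N2. N1 - M1 \<ge> L \<longrightarrow> N2 - M2 \<ge> L \<longrightarrow> P (M1, N1, M2, N2)" ..
next
  assume "\<exists>L. \<forall>M1 N1 M2 N2. N1 - M1 \<ge> L \<longrightarrow> N2 - M2 \<ge> L \<longrightarrow> P (M1, N1, M2, N2)"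
  then obtain L
    where L: "\<forall>M1 N1 M2 N2. N1 - M1 \<ge> L \<longrightarrow> N2 - M2 \<ge> L \<longrightarrow> P (M1, N1, M2, N2)" ..
  have "eventually (\<lambda>p :: int \<times> int. fst p \<ge> L \<and> snd p \<ge> L) (at_top \<times>\<^sub>F at_top)"
    unfolding eventually_prod_filter
    by (rule exI[of _ "\<lambda>x. x \<ge> L"], rule exI[of _ "\<lambda>x. x \<ge> L"])
      (simp add: eventually_ge_at_top)
  then show "eventually P large_boxes"
    unfolding large_boxes_def eventually_filtercomap
    by (intro exI[of _ "\<lambda>p. fst p \<ge> L \<and> snd p \<ge> L"] conjI) (use L in auto)
qed

lemma large_boxes_neq_bot: "large_boxes \<noteq> bot"
proof
  assume "large_boxes = bot"
  then have "eventually (\<lambda>_. False) large_boxes" by simp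
  then obtain L where "\<forall>M1 N1 M2 N2 :: int. N1 - M1 \<ge> L \<longrightarrow> N2 - M2 \<ge> L \<longrightarrow> False"
    unfolding eventually_large_boxes by blast
  then have "\<not> L - 0 \<ge> L" by blast
  then show False by simp
qed

lemma eventually_box_density_bounds:
  "eventually (\<lambda>b. 0 \<le> box_density E b \<and> box_density E b \<le> 1) large_boxes"
  unfolding eventually_large_boxes
proof (intro exI[of _ 1] allI impI)
  fix M1 N1 M2 N2 :: int
  assume len: "N1 - M1 \<ge> 1" "N2 - M2 \<ge> 1"
  have "card (E \<inter> ({M1..<N1} \<times> {M2..<N2})) \<le> card ({M1..<N1} \<times> {M2..<N2})"
    by (intro card_mono) auto
  also have "\<dots> = nat (N1 - M1) * nat (N2 - M2)"
    by (simp add: card_cartesian_product)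
  finally have "real (card (E \<inter> ({M1..<N1} \<times> {M2..<N2})))
      \<le> real (nat (N1 - M1)) * real (nat (N2 - M2))"
    by (metis of_nat_le_iff of_nat_mult)
  then have "real (card (E \<inter> ({M1..<N1} \<times> {M2..<N2})))
      \<le> real_of_int (N1 - M1) * real_of_int (N2 - M2)"
    using len by simp
  moreover have "real_of_int (N1 - M1) * real_of_int (N2 - M2) > 0"
    using len by (intro mult_pos_pos) auto
  ultimately show "0 \<le> box_density E (M1, N1, M2, N2) \<and> box_density E (M1, N1, M2, N2) \<le> 1"
    unfolding box_density_def by (simp add: divide_le_eq_1)
qed

lemma ereal_upper_Banach_density:
  "ereal (upper_Banach_density E) = Limsup large_boxes (\<lambda>b. ereal (box_density E b))"
  and upper_Banach_density_bounds: "upper_Banach_density E \<in> {0..1}"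
proof -
  let ?L = "Limsup large_boxes (\<lambda>b. ereal (box_density E b))"
  have "?L \<le> 1"
    by (rule Limsup_bounded, rule eventually_mono[OF eventually_box_density_bounds[of E]]) auto
  moreover have "0 \<le> ?L"
    by (rule order_trans[OF Liminf_bounded Liminf_le_Limsup[OF large_boxes_neq_bot]],
        rule eventually_mono[OF eventually_box_density_bounds[of E]]) auto
  ultimately show "ereal (upper_Banach_density E) = ?L" "upper_Banach_density E \<in> {0..1}"
    unfolding upper_Banach_density_def by (cases ?L; simp)+
qed

end

theory Submission
  imports Defs
begin

text \<open>
  Suppose the set is not syndetic. Then its complement contains all differences \<open>v - u\<close> with
  \<open>u \<in> S\<^sub>i\<close>, \<open>v \<in> S\<^sub>j\<close>, \<open>i < j\<close>, for any prescribed number of blocks \<open>S\<^sub>i\<close> of any prescribed length \<open>l\<close>.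
  Choose a huge square \<open>Q\<close> that nearly maximises, among all squares of side at least \<open>l\<close>, a large
  multiple of the density of \<open>E\<close> plus energies of labellings of the coordinates \<open>y\<close>, \<open>x\<close>, \<open>x + y\<close>.
  Then \<open>E\<close> has almost maximal density on \<open>Q\<close>, and energy is hardly gained by passing from \<open>Q\<close> to
  windows of side \<open>l\<close>, so the indicator of \<open>E\<close> differs from its averages over the cells of a fine
  labelling by functions that on most windows do not correlate with products of functions
  of two of the coordinates. Hence, in sums of corner counts over \<open>d = v - u\<close> with weights \<open>\<phi> u * \<psi> v\<close>,
  the indicator may be replaced at the three vertices by these averages, and then, at small
  \<open>L\<^sup>1\<close> cost, by averages \<open>g\<^sub>0\<close>, \<open>g\<^sub>1\<close>, \<open>g\<^sub>2\<close> over the cells of a coarse labelling. The resulting corner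
  sum is almost periodic in \<open>d\<close>: it is close to its value at \<open>0\<close> whenever \<open>u\<close> and \<open>v\<close> lie in the
  same one of a bounded number of classes, which by pigeonhole happens often for some pair of
  blocks. That value is the average of \<open>g\<^sub>0 g\<^sub>1 g\<^sub>2\<close> over \<open>Q\<close>, which is at least the fourth power of
  the density by AM-GM.
\<close>

subsection \<open>Cell averages\<close>

text \<open>Differences between the blocks are bounded while \<open>Q\<close> is huge, so uniformity
  must hold on windows of the block length, where a labelling of \<open>Q\<close> might be improved
  window by window. Near-maximality excludes this: windows compete with \<open>Q\<close> for the
  same functional, so their average energy cannot noticeably exceed that of \<open>Q\<close>.

  The order of choices shapes the constants. The blocks must be known before \<open>Q\<close>, since
  the density of the set of corners with difference d is under control only on squares whose side
  exceeds a threshold depending on d. The number of labels can be settled only once \<open>Q\<close>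
  is there. Hence the functional contains the energies for all numbers of labels 2^t with t \<le> T,
  where T depends on \<epsilon> alone, and the number of blocks serves all of them at once.

  Two labellings are needed because the error of the first replacement is multiplied by the square
  of the number of classes, which grows with the number of labels: the fine labelling makes the
  error small, the coarse one determines the classes.\<close>

definition mean :: "'a set \<Rightarrow> ('a \<Rightarrow> real) \<Rightarrow> real" where
  "mean W g = (\<Sum>p\<in>W. g p) / real (card W)"

text \<open>The conditional expectation of \<open>f\<close> given \<open>K\<close>, for the uniform
  measure on \<open>W\<close>. At a point whose cell is empty the value is 0.\<close>

definition cell_mean :: "('a \<Rightarrow> real) \<Rightarrow> 'a set \<Rightarrow> ('a \<Rightarrow> 'k) \<Rightarrow> 'a \<Rightarrow> real" where
  "cell_mean f W K p = mean {q\<in>W. K q = K p} f"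

lemma mean_nonneg: "(\<And>p. p \<in> W \<Longrightarrow> 0 \<le> g p) \<Longrightarrow> 0 \<le> mean W g"
  by (simp add: mean_def sum_nonneg)

lemma mean_le:
  assumes "\<And>p. p \<in> W \<Longrightarrow> g p \<le> C" "0 \<le> C"
  shows "mean W g \<le> C"
proof (cases "card W = 0")
  case False
  have "(\<Sum>p\<in>W. g p) \<le> (\<Sum>p\<in>W. C)" by (rule sum_mono) (use assms in auto)
  then show ?thesis using False by (simp add: mean_def divide_le_eq mult.commute)
qed (use assms in \<open>auto simp: mean_def card_eq_0_iff\<close>)

lemma mean_mono:
  assumes "\<And>p. p \<in> W \<Longrightarrow> g p \<le> h p"
  shows "mean W g \<le> mean W h"
  unfolding mean_def by (intro divide_right_mono sum_mono) (use assms in auto)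

lemma cell_mean_cong_key: "K p = K q \<Longrightarrow> cell_mean f W K p = cell_mean f W K q"
  by (simp add: cell_mean_def)

lemma cell_mean_nonneg: "(\<And>p. 0 \<le> f p) \<Longrightarrow> 0 \<le> cell_mean f W K p"
  unfolding cell_mean_def by (rule mean_nonneg)

lemma cell_mean_le_1: "(\<And>p. f p \<le> 1) \<Longrightarrow> cell_mean f W K p \<le> 1"
  unfolding cell_mean_def by (rule mean_le) auto

lemma cell_mean_pos:
  assumes "finite W" "p \<in> W" "\<And>q. 0 \<le> f q" "f p > 0"
  shows "cell_mean f W K p > 0"
proof -
  have "p \<in> {q\<in>W. K q = K p}" using assms by auto
  moreover have fin: "finite {q\<in>W. K q = K p}" using assms by auto
  ultimately have "card {q\<in>W. K q = K p} > 0" by (metis card_gt_0_iff empty_iff)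
  moreover have "(\<Sum>q\<in>{q\<in>W. K q = K p}. f q) > 0"
    using fin \<open>p \<in> {q\<in>W. K q = K p}\<close> assms by (meson sum_pos2)
  ultimately show ?thesis unfolding cell_mean_def mean_def by simp
qed

text \<open>On a fibre of \<open>K\<close> both \<open>G (K p)\<close> and the average are constant.
  In other words, \<open>f - cell_mean f W K\<close> is orthogonal on \<open>W\<close> to every
  function of \<open>K\<close>.\<close>

lemma sum_cell_mean_mult:
  assumes "finite W"
  shows "(\<Sum>p\<in>W. cell_mean f W K p * G (K p)) = (\<Sum>p\<in>W. f p * G (K p))"
proof -
  have *: "(\<Sum>p\<in>{p\<in>W. K p = v}. cell_mean f W K p * G (K p)) = (\<Sum>p\<in>{p\<in>W. K p = v}. f p * G (K p))" for v
  proof -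
    let ?C = "{p\<in>W. K p = v}"
    have "(\<Sum>p\<in>?C. cell_mean f W K p * G (K p)) = (\<Sum>p\<in>?C. mean ?C f * G v)"
      by (rule sum.cong) (auto simp: cell_mean_def)
    also have "\<dots> = (\<Sum>p\<in>?C. f p) * G v"
      using assms by (cases "card ?C = 0") (auto simp: mean_def simp del: Collect_empty_eq)
    also have "\<dots> = (\<Sum>p\<in>?C. f p * G (K p))"
      by (simp add: sum_distrib_right)
    finally show ?thesis .
  qed
  show ?thesis
    unfolding sum.image_gen[OF assms, where g=K, of "\<lambda>p. cell_mean f W K p * G (K p)"]
      sum.image_gen[OF assms, where g=K, of "\<lambda>p. f p * G (K p)"]
    by (rule sum.cong[OF refl *])
qed

lemma sum_cell_mean_sq:
  assumes "finite W"
  shows "(\<Sum>p\<in>W. f p * cell_mean f W K p) = (\<Sum>p\<in>W. (cell_mean f W K p)\<^sup>2)"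
proof -
  define G where "G v = mean {q\<in>W. K q = v} f" for v
  have "cell_mean f W K p = G (K p)" for p by (simp add: cell_mean_def G_def)
  then show ?thesis using sum_cell_mean_mult[OF assms, of f K G] by (simp add: power2_eq_square)
qed

text \<open>By orthogonality the left side is the sum of
  \<open>cell_mean\<^sup>2 - (cell_mean - G)\<^sup>2\<close>. The energy is thus the maximum of a
  functional that is a plain sum over points; such a sum can be split over windows, with the
  averages over a larger square in the role of \<open>G\<close>.\<close>

lemma sum_variational:
  assumes "finite W"
  shows "(\<Sum>p\<in>W. 2 * f p * G (K p) - (G (K p))\<^sup>2) \<le> (\<Sum>p\<in>W. (cell_mean f W K p)\<^sup>2)"
proof -
  have "(\<Sum>p\<in>W. 2 * f p * G (K p) - (G (K p))\<^sup>2)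
      = 2 * (\<Sum>p\<in>W. f p * G (K p)) - (\<Sum>p\<in>W. (G (K p))\<^sup>2)"
    by (simp add: sum_subtractf sum_distrib_left mult.assoc)
  also have "\<dots> = (\<Sum>p\<in>W. 2 * cell_mean f W K p * G (K p) - (G (K p))\<^sup>2)"
    using sum_cell_mean_mult[OF assms, of f K G] by (simp add: sum_subtractf sum_distrib_left[symmetric] mult.assoc)
  also have "\<dots> \<le> (\<Sum>p\<in>W. (cell_mean f W K p)\<^sup>2)"
    proof (rule sum_mono)
    fix p
    have "0 \<le> (cell_mean f W K p - G (K p))\<^sup>2" by simp
    then show "2 * cell_mean f W K p * G (K p) - (G (K p))\<^sup>2 \<le> (cell_mean f W K p)\<^sup>2"
      unfolding power2_diff by linarith
  qed
  finally show ?thesis .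
qed

text \<open>Pythagoras: the coarser average is the orthogonal projection of the finer one.\<close>

lemma sum_cell_mean_diff_sq:
  assumes "finite W" and ref: "\<And>p q. K' p = K' q \<Longrightarrow> K p = K q"
  shows "(\<Sum>p\<in>W. (cell_mean f W K' p - cell_mean f W K p)\<^sup>2)
    = (\<Sum>p\<in>W. (cell_mean f W K' p)\<^sup>2) - (\<Sum>p\<in>W. (cell_mean f W K p)\<^sup>2)"
proof -
  \<comment> \<open>Turns the coarser average into a function of the finer label; on labels that are
    not attained its value is arbitrary.\<close>
  define G where "G v = cell_mean f W K (SOME p. K' p = v)" for v
  have "K' (SOME q. K' q = K' p) = K' p" for p by (metis (mono_tags) someI)
  then have G: "cell_mean f W K p = G (K' p)" for p
    unfolding G_def by (intro cell_mean_cong_key) (metis ref)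
  have "(\<Sum>p\<in>W. cell_mean f W K' p * cell_mean f W K p) = (\<Sum>p\<in>W. f p * cell_mean f W K p)"
    unfolding G by (rule sum_cell_mean_mult[OF assms(1)])
  also have "\<dots> = (\<Sum>p\<in>W. (cell_mean f W K p)\<^sup>2)" by (rule sum_cell_mean_sq[OF assms(1)])
  finally have "(\<Sum>p\<in>W. cell_mean f W K' p * cell_mean f W K p) = (\<Sum>p\<in>W. (cell_mean f W K p)\<^sup>2)" .
  moreover have "(\<Sum>p\<in>W. (cell_mean f W K' p - cell_mean f W K p)\<^sup>2) = (\<Sum>p\<in>W. (cell_mean f W K' p)\<^sup>2)
      + (\<Sum>p\<in>W. (cell_mean f W K p)\<^sup>2) - 2 * (\<Sum>p\<in>W. cell_mean f W K' p * cell_mean f W K p)"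
    unfolding power2_diff by (simp add: sum.distrib sum_subtractf sum_distrib_left mult.assoc)
  ultimately show ?thesis by simp
qed

lemma sum_cell_mean_sq_mono:
  assumes "finite W" and ref: "\<And>p q. K' p = K' q \<Longrightarrow> K p = K q"
  shows "(\<Sum>p\<in>W. (cell_mean f W K p)\<^sup>2) \<le> (\<Sum>p\<in>W. (cell_mean f W K' p)\<^sup>2)"
proof -
  have "0 \<le> (\<Sum>p\<in>W. (cell_mean f W K' p - cell_mean f W K p)\<^sup>2)" by (simp add: sum_nonneg)
  then show ?thesis using sum_cell_mean_diff_sq[of W K' K f, OF assms] by simp
qed

text \<open>A cell with nonzero average contributes exactly its size; a cell with average 0
  contributes 0 by the convention for division by zero, whence only an inequality.\<close>

lemma sum_div_ce:
  assumes "finite W"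
  shows "(\<Sum>p\<in>W. f p / cell_mean f W K p) \<le> real (card W)"
proof -
  define G where "G v = 1 / mean {q\<in>W. K q = v} f" for v
  have "(\<Sum>p\<in>W. f p / cell_mean f W K p) = (\<Sum>p\<in>W. f p * G (K p))"
    unfolding G_def cell_mean_def by simp
  also have "\<dots> = (\<Sum>p\<in>W. cell_mean f W K p * G (K p))" by (rule sum_cell_mean_mult[OF assms, symmetric])
  also have "\<dots> \<le> (\<Sum>p\<in>W. 1)" by (rule sum_mono) (auto simp: G_def cell_mean_def)
  finally show ?thesis by simp
qed

text \<open>Sum \<open>ln t \<le> t - 1\<close> over the four numbers, whose logarithms add up to
  0.\<close>

lemma four_am_gm:
  fixes p q r s :: real
  assumes "p > 0" "q > 0" "r > 0" "s > 0" "p * q * r * s = 1"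
  shows "4 \<le> p + q + r + s"
proof -
  have "ln (p * q * r * s) = ln p + ln q + ln r + ln s"
    using assms(1-4) by (simp add: ln_mult_pos)
  then have "ln p + ln q + ln r + ln s = 0" using assms by simp
  then show ?thesis
    using ln_le_minus_one[of p] ln_le_minus_one[of q] ln_le_minus_one[of r] ln_le_minus_one[of s] assms
    by linarith
qed

text \<open>Apply AM-GM pointwise to \<open>g\<^sub>1 g\<^sub>2 g\<^sub>3 / \<mu>\<^sup>3\<close> and the three \<open>\<mu> / g\<^sub>i\<close>, then average against \<open>f\<close>.\<close>
lemma mean_power4_le:
  assumes "finite W" and f: "\<And>p. 0 \<le> f p"
  shows "mean W f ^ 4 \<le> mean W (\<lambda>p. f p * cell_mean f W K1 p * cell_mean f W K2 p * cell_mean f W K3 p)"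
proof (cases "mean W f > 0")
  case False
  then have "mean W f = 0" using mean_nonneg[of W f] f by force
  then show ?thesis using f by (auto intro!: mean_nonneg mult_nonneg_nonneg cell_mean_nonneg)
next
  case True
  define \<mu> where "\<mu> = mean W f"
  have \<mu>: "\<mu> > 0" using True by (simp add: \<mu>_def)
  have W: "card W > 0" using True by (auto simp: mean_def intro: Nat.gr0I)
  have pt: "4 * f p \<le> f p * cell_mean f W K1 p * cell_mean f W K2 p * cell_mean f W K3 p / \<mu>^3
      + \<mu> * (f p / cell_mean f W K1 p) + \<mu> * (f p / cell_mean f W K2 p) + \<mu> * (f p / cell_mean f W K3 p)"
    if p: "p \<in> W" for p
  \<comment> \<open>Where \<open>f\<close> vanishes both sides are 0; elsewhere the three averages
    at \<open>p\<close> are positive, so the divisions are genuine.\<close>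
  proof (cases "f p > 0")
    case fp: True
    define a b c where "a = cell_mean f W K1 p" and "b = cell_mean f W K2 p" and "c = cell_mean f W K3 p"
    have pos: "a > 0" "b > 0" "c > 0"
      unfolding a_def b_def c_def using cell_mean_pos[of W p f, OF assms(1) p f fp] by auto
    have "4 \<le> a * b * c / \<mu>^3 + \<mu> / a + \<mu> / b + \<mu> / c"
      by (rule four_am_gm) (use pos \<mu> in \<open>auto simp: field_simps power3_eq_cube\<close>)
    then have "f p * 4 \<le> f p * (a * b * c / \<mu>^3 + \<mu> / a + \<mu> / b + \<mu> / c)"
      using fp by (intro mult_left_mono) auto
    then show ?thesis
      unfolding a_def[symmetric] b_def[symmetric] c_def[symmetric] by (simp add: algebra_simps)
  qed (use f[of p] in auto)
  define S where "S = (\<Sum>p\<in>W. f p * cell_mean f W K1 p * cell_mean f W K2 p * cell_mean f W K3 p)"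
  define n where "n = real (card W)"
  have n: "n > 0" using W by (simp add: n_def)
  have "4 * (\<Sum>p\<in>W. f p) \<le> S / \<mu>^3 + \<mu> * (\<Sum>p\<in>W. f p / cell_mean f W K1 p)
      + \<mu> * (\<Sum>p\<in>W. f p / cell_mean f W K2 p) + \<mu> * (\<Sum>p\<in>W. f p / cell_mean f W K3 p)"
    unfolding S_def sum_distrib_left sum_divide_distrib sum.distrib[symmetric]
    by (rule sum_mono) (rule pt)
  also have "\<dots> \<le> S / \<mu>^3 + \<mu> * n + \<mu> * n + \<mu> * n"
    unfolding n_def by (intro add_mono mult_left_mono sum_div_ce[OF assms(1)]) (use \<mu> in auto)
  finally have "4 * (\<mu> * n) \<le> S / \<mu>^3 + 3 * (\<mu> * n)"
    using n by (simp add: \<mu>_def mean_def n_def)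
  then have "\<mu> * n * \<mu>^3 \<le> S" using \<mu> by (simp add: field_simps)
  then have "\<mu>^4 \<le> S / n" using n by (simp add: field_simps power4_eq_xxxx power3_eq_cube)
  then show ?thesis by (simp add: \<mu>_def S_def n_def mean_def)
qed

subsection \<open>Square windows\<close>

definition square :: "int \<times> int \<Rightarrow> int \<Rightarrow> (int \<times> int) set" where
  "square P H = {fst P..<fst P + H} \<times> {snd P..<snd P + H}"

lemma finite_square [simp, intro]: "finite (square P H)" by (simp add: square_def)

lemma card_square: "0 \<le> H \<Longrightarrow> real (card (square P H)) = (real_of_int H)\<^sup>2"
  by (simp add: square_def card_cartesian_product power2_eq_square)

lemma mem_square: "p \<in> square P H \<longleftrightarrow> fst P \<le> fst p \<and> fst p < fst P + H \<and> snd P \<le> snd p \<and> snd p < snd P + H"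
  by (cases p) (auto simp: square_def)

lemma sum_square_shift: "(\<Sum>p\<in>square P l. g p) = (\<Sum>s\<in>square 0 l. g (P + s))"
  by (rule sum.reindex_bij_witness[where i="\<lambda>s. P + s" and j="\<lambda>p. p - P"]) (auto simp: mem_square)

text \<open>For each offset \<open>s\<close> in \<open>square 0 l\<close> the points
  \<open>P + s\<close> with \<open>P\<close> in \<open>V\<close> fill \<open>Q\<close> up to |Q| -
  |V| points, and there are \<open>l\<^sup>2\<close> offsets. Rectangles are allowed because the
  upper Banach density is defined by them.\<close>

lemma sum_windows:
  fixes g :: "int \<times> int \<Rightarrow> real" and x0 y0 A B l :: int and C :: real
  assumes l: "1 \<le> l" "l \<le> A" "l \<le> B" and bd: "\<And>p. \<bar>g p\<bar> \<le> C"
  defines "Q \<equiv> {x0..<x0 + A} \<times> {y0..<y0 + B}"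
  defines "V \<equiv> {x0..<x0 + (A - l + 1)} \<times> {y0..<y0 + (B - l + 1)}"
  shows "\<bar>(\<Sum>P\<in>V. \<Sum>p\<in>square P l. g p) - l\<^sup>2 * (\<Sum>p\<in>Q. g p)\<bar>
    \<le> l\<^sup>2 * (C * (A * B - (A - l + 1) * (B - l + 1)))"
proof -
  have one: "\<bar>(\<Sum>P\<in>V. g (P + s)) - (\<Sum>p\<in>Q. g p)\<bar> \<le> C * (A * B - (A - l + 1) * (B - l + 1))"
    if s: "s \<in> square 0 l" for s
  proof -
    have inj: "inj_on (\<lambda>P. P + s) V" by (auto simp: inj_on_def)
    have sub: "(\<lambda>P. P + s) ` V \<subseteq> Q" 
      using s by (cases s) (auto simp: V_def Q_def mem_square)
    have fin: "finite Q" by (simp add: Q_def)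
    have "(\<Sum>P\<in>V. g (P + s)) = (\<Sum>p\<in>(\<lambda>P. P + s) ` V. g p)"
      by (simp add: sum.reindex[OF inj] o_def)
    then have "(\<Sum>p\<in>Q. g p) - (\<Sum>P\<in>V. g (P + s)) = (\<Sum>p\<in>Q - (\<lambda>P. P + s) ` V. g p)"
      using sum_diff[OF fin sub, of g] by simp
    also have "\<bar>\<dots>\<bar> \<le> (\<Sum>p\<in>Q - (\<lambda>P. P + s) ` V. C)"
      by (rule order_trans[OF sum_abs sum_mono]) (rule bd)
    also have "\<dots> = real (card Q - card V) * C"
      using sub fin by (simp add: card_Diff_subset finite_subset card_image[OF inj])
    also have "real (card Q - card V) = real (card Q) - real (card V)"
      using card_mono[OF fin sub] by (simp add: card_image[OF inj] of_nat_diff)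
    also have "\<dots> = A * B - (A - l + 1) * (B - l + 1)"
      using l by (simp add: Q_def V_def card_cartesian_product)
    finally show ?thesis by (simp add: abs_minus_commute mult.commute)
  qed
  have "(\<Sum>P\<in>V. \<Sum>p\<in>square P l. g p) = (\<Sum>P\<in>V. \<Sum>s\<in>square 0 l. g (P + s))"
    by (rule sum.cong[OF refl sum_square_shift])
  also have "\<dots> = (\<Sum>s\<in>square 0 l. \<Sum>P\<in>V. g (P + s))"
    by (rule sum.swap)
  also have "\<dots> - l\<^sup>2 * (\<Sum>p\<in>Q. g p) = (\<Sum>s\<in>square 0 l. ((\<Sum>P\<in>V. g (P + s)) - (\<Sum>p\<in>Q. g p)))"
    using l card_square[of l 0] by (simp add: sum_subtractf)
  also have "\<bar>\<dots>\<bar> \<le> (\<Sum>s\<in>square 0 l. C * (A * B - (A - l + 1) * (B - l + 1)))"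
    by (rule order_trans[OF sum_abs sum_mono]) (rule one)
  also have "\<dots> = l\<^sup>2 * (C * (A * B - (A - l + 1) * (B - l + 1)))"
    using l card_square[of l 0] by simp
  finally show ?thesis .
qed

lemma sum_variational_le:
  assumes "finite W" and ref: "\<And>p q. K p = K q \<Longrightarrow> h p = h q"
  shows "(\<Sum>p\<in>W. 2 * f p * h p - (h p)\<^sup>2) \<le> (\<Sum>p\<in>W. (cell_mean f W K p)\<^sup>2)"
proof -
  define G where "G v = h (SOME p. K p = v)" for v
  have "K (SOME q. K q = K p) = K p" for p by (metis (mono_tags) someI)
  then have "h p = G (K p)" for p unfolding G_def by (metis ref)
  then show ?thesis using sum_variational[OF assms(1), of f G K] by simp
qed

subsection \<open>Labellings and their energy\<close>

text \<open>The three coordinates of \<open>(x, y)\<close> are \<open>y\<close>, \<open>x\<close> and \<open>x + y\<close>; the \<open>c\<close>-th vertex of a corner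
  is determined by the coordinates \<open>lft c\<close> and \<open>rgt c\<close>.\<close>
definition crd :: "nat \<Rightarrow> int \<times> int \<Rightarrow> int" where
  "crd i p = (if i = 0 then snd p else if i = 1 then fst p else fst p + snd p)"

definition lft :: "nat \<Rightarrow> nat" where "lft c = (if c = 2 then 1 else 0)"
definition rgt :: "nat \<Rightarrow> nat" where "rgt c = (if c = 0 then 1 else 2)"

definition key :: "(nat \<Rightarrow> int \<Rightarrow> nat) \<Rightarrow> nat \<Rightarrow> int \<times> int \<Rightarrow> nat \<times> nat" where
  "key \<Lambda> c p = (\<Lambda> (lft c) (crd (lft c) p), \<Lambda> (rgt c) (crd (rgt c) p))"

definition labelling :: "nat \<Rightarrow> (nat \<Rightarrow> int \<Rightarrow> nat) \<Rightarrow> bool" where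
  "labelling k \<Lambda> \<longleftrightarrow> (\<forall>i n. \<Lambda> i n < k)"

definition label_energy :: "(int \<times> int \<Rightarrow> real) \<Rightarrow> (int \<times> int) set \<Rightarrow> (nat \<Rightarrow> int \<Rightarrow> nat) \<Rightarrow> real" where
  "label_energy f W \<Lambda> = (\<Sum>c<3. mean W (\<lambda>p. (cell_mean f W (key \<Lambda> c) p)\<^sup>2))"

text \<open>The supremum is over all labellings with \<open>k\<close> labels per coordinate. Up to boundary terms it does not
  decrease on average when a square is replaced by smaller windows.\<close>
definition energy :: "(int \<times> int \<Rightarrow> real) \<Rightarrow> nat \<Rightarrow> (int \<times> int) set \<Rightarrow> real" where
  "energy f k W = Sup (label_energy f W ` Collect (labelling k))"

text \<open>The common refinement, coded in base \<open>k\<close>; the code can be read back as long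
  as the labels of \<open>\<Lambda>\<close> stay below \<open>k\<close>.\<close>

definition join :: "nat \<Rightarrow> (nat \<Rightarrow> int \<Rightarrow> nat) \<Rightarrow> (nat \<Rightarrow> int \<Rightarrow> nat) \<Rightarrow> nat \<Rightarrow> int \<Rightarrow> nat" where
  "join k \<Lambda> \<Lambda>' i n = \<Lambda> i n + k * \<Lambda>' i n"

lemma labelling_join:
  assumes "labelling k \<Lambda>" "labelling k' \<Lambda>'"
  shows "labelling (k * k') (join k \<Lambda> \<Lambda>')"
  unfolding labelling_def
proof (intro allI)
  fix i n
  have 1: "\<Lambda> i n < k" "\<Lambda>' i n < k'" using assms by (auto simp: labelling_def)
  have "\<Lambda> i n + k * \<Lambda>' i n < k + k * \<Lambda>' i n" using 1 by simp
  also have "\<dots> = k * Suc (\<Lambda>' i n)" by simp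
  also have "\<dots> \<le> k * k'" using 1 by (intro mult_le_mono2) simp
  finally show "join k \<Lambda> \<Lambda>' i n < k * k'" by (simp add: join_def)
qed

lemma join_eqD:
  assumes "labelling k \<Lambda>" "join k \<Lambda> \<Lambda>' i n = join k \<Lambda> \<Lambda>' i m"
  shows "\<Lambda> i n = \<Lambda> i m" "\<Lambda>' i n = \<Lambda>' i m"
proof -
  have lt: "\<Lambda> i n < k" "\<Lambda> i m < k" using assms by (auto simp: labelling_def)
  then have "\<Lambda> i n = join k \<Lambda> \<Lambda>' i n mod k" "\<Lambda> i m = join k \<Lambda> \<Lambda>' i m mod k"
    by (auto simp: join_def)
  then show *: "\<Lambda> i n = \<Lambda> i m" using assms(2) by simp
  show "\<Lambda>' i n = \<Lambda>' i m" using assms(2) * lt by (auto simp: join_def)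
qed

lemma key_join_eqD:
  assumes "labelling k \<Lambda>" "key (join k \<Lambda> \<Lambda>') c p = key (join k \<Lambda> \<Lambda>') c q"
  shows "key \<Lambda> c p = key \<Lambda> c q" "key \<Lambda>' c p = key \<Lambda>' c q"
  using assms(2) unfolding key_def prod.inject by (metis join_eqD[OF assms(1)])+

lemma labelling_0: "1 \<le> k \<Longrightarrow> labelling k (\<lambda>_ _. 0)"
  by (simp add: labelling_def)

lemma labelling_mono: "labelling k \<Lambda> \<Longrightarrow> k \<le> k' \<Longrightarrow> labelling k' \<Lambda>"
  unfolding labelling_def by (meson less_le_trans)

lemma mean_add: "mean W (\<lambda>p. g p + h p) = mean W g + mean W h"
  by (simp add: mean_def sum.distrib add_divide_distrib)

lemma mean_cmult: "mean W (\<lambda>p. a * g p) = a * mean W g" for a :: real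
  by (simp add: mean_def sum_distrib_left)

lemma mean_sum: "mean W (\<lambda>p. \<Sum>c\<in>C. h c p) = (\<Sum>c\<in>C. mean W (h c))"
  unfolding mean_def by (subst sum.swap) (simp add: sum_divide_distrib)

context
  fixes f :: "int \<times> int \<Rightarrow> real"
  assumes f01: "\<And>p. 0 \<le> f p" "\<And>p. f p \<le> 1"
begin

lemma label_energy_nonneg: "0 \<le> label_energy f W \<Lambda>"
  unfolding label_energy_def by (intro sum_nonneg mean_nonneg) simp

lemma label_energy_le_3: "label_energy f W \<Lambda> \<le> 3"
proof -
  have "label_energy f W \<Lambda> \<le> (\<Sum>c<(3::nat). 1)"
    unfolding label_energy_def
    by (intro sum_mono mean_le) (use f01 in \<open>auto simp: abs_square_le_1 cell_mean_nonneg cell_mean_le_1\<close>)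
  then show ?thesis by simp
qed

lemma bdd_label_energy: "bdd_above (label_energy f W ` S)"
  by (rule bdd_aboveI[of _ 3]) (use label_energy_le_3 in auto)

lemma energy_ge: "labelling k \<Lambda> \<Longrightarrow> label_energy f W \<Lambda> \<le> energy f k W"
  unfolding energy_def by (rule cSup_upper) (use bdd_label_energy in auto)

lemma energy_nonneg: "1 \<le> k \<Longrightarrow> 0 \<le> energy f k W"
  using energy_ge[OF labelling_0] label_energy_nonneg order_trans by blast

lemma energy_le_3: "1 \<le> k \<Longrightarrow> energy f k W \<le> 3"
  unfolding energy_def by (rule cSup_least) (use label_energy_le_3 labelling_0 in auto)

lemma energy_mono: "1 \<le> k \<Longrightarrow> k \<le> k' \<Longrightarrow> energy f k W \<le> energy f k' W"
  unfolding energy_def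
proof (rule cSup_subset_mono)
  assume k: "1 \<le> k" "k \<le> k'"
  show "label_energy f W ` Collect (labelling k) \<noteq> {}" using labelling_0[OF k(1)] by blast
  show "label_energy f W ` Collect (labelling k) \<subseteq> label_energy f W ` Collect (labelling k')"
    using labelling_mono[OF _ k(2)] by (intro image_mono) auto
qed (rule bdd_label_energy)

lemma energy_approx:
  assumes "1 \<le> k" "0 < \<kappa>"
  obtains \<Lambda> where "labelling k \<Lambda>" "energy f k W - \<kappa> < label_energy f W \<Lambda>"
proof -
  have "label_energy f W ` Collect (labelling k) \<noteq> {}" using labelling_0[OF assms(1)] by blast
  moreover have "energy f k W - \<kappa> < Sup (label_energy f W ` Collect (labelling k))"
    unfolding energy_def using assms(2) by simp
  ultimately have "\<exists>x\<in>label_energy f W ` Collect (labelling k). energy f k W - \<kappa> < x"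
    by (rule less_cSupD)
  then show thesis using that unfolding Bex_def image_iff mem_Collect_eq by metis
qed

lemma label_energy_refine:
  assumes "finite W" "\<And>c p q. key \<Lambda>' c p = key \<Lambda>' c q \<Longrightarrow> key \<Lambda> c p = key \<Lambda> c q"
  shows "label_energy f W \<Lambda> \<le> label_energy f W \<Lambda>'"
  unfolding label_energy_def mean_def
  by (intro sum_mono divide_right_mono sum_cell_mean_sq_mono[OF assms(1)] assms(2)) auto

lemma energy_increment:
  fixes A B :: "int set"
  assumes W: "finite W" and \<Lambda>: "labelling k \<Lambda>" and c: "c < 3"
    and h: "\<And>c p q. key \<Lambda> c p = key \<Lambda> c q \<Longrightarrow> h c p = h c q"
  defines "s \<equiv> \<lambda>p. of_bool (crd (lft c) p \<in> A) * of_bool (crd (rgt c) p \<in> B) :: real"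
  defines "\<tau> \<equiv> mean W (\<lambda>p. (f p - h c p) * s p)"
  shows "mean W (\<lambda>p. \<Sum>c<3. 2 * f p * h c p - (h c p)\<^sup>2) + \<tau>\<^sup>2 \<le> energy f (2 * k) W"
proof -
  \<comment> \<open>Membership in \<open>A\<close> is recorded on coordinate \<open>lft c\<close>
    and membership in \<open>B\<close> on \<open>rgt c\<close>; these differ, so one bit per
    coordinate is enough.\<close>
  define \<Lambda>2 where "\<Lambda>2 i n = (if i = lft c then of_bool (n \<in> A) else
     if i = rgt c then of_bool (n \<in> B) else 0 :: nat)" for i n
  have \<Lambda>2: "labelling 2 \<Lambda>2" by (auto simp: labelling_def \<Lambda>2_def)
  define \<Lambda>' where "\<Lambda>' = join k \<Lambda> \<Lambda>2"
  have \<Lambda>': "labelling (2 * k) \<Lambda>'"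
    using labelling_join[OF \<Lambda> \<Lambda>2] by (simp add: \<Lambda>'_def mult.commute)
  have neq: "lft c \<noteq> rgt c" by (auto simp: lft_def rgt_def)
  have s: "s p = s q" if "key \<Lambda>2 c p = key \<Lambda>2 c q" for p q
    using that neq by (auto simp: key_def \<Lambda>2_def s_def of_bool_def split: if_splits)
  define h' where "h' c' p = h c' p + (if c' = c then \<tau> * s p else 0)" for c' p
  have h': "h' c' p = h' c' q" if "key \<Lambda>' c' p = key \<Lambda>' c' q" for c' p q
    using key_join_eqD[OF \<Lambda> that[unfolded \<Lambda>'_def]] h s unfolding h'_def by metis
  have gain: "mean W (\<lambda>p. 2 * f p * h c' p - (h c' p)\<^sup>2) + of_bool (c' = c) * \<tau>\<^sup>2
      \<le> mean W (\<lambda>p. (cell_mean f W (key \<Lambda>' c') p)\<^sup>2)" for c'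
  proof -
    have "mean W (\<lambda>p. 2 * f p * h c' p - (h c' p)\<^sup>2) + of_bool (c' = c) * \<tau>\<^sup>2
        \<le> mean W (\<lambda>p. 2 * f p * h' c' p - (h' c' p)\<^sup>2)"
    proof (cases "c' = c")
      case True
      have "2 * f p * h' c p - (h' c p)\<^sup>2 = (2 * f p * h c p - (h c p)\<^sup>2) +
          ((2 * \<tau>) * ((f p - h c p) * s p) + (- (\<tau>\<^sup>2)) * (s p)\<^sup>2)" for p
        by (simp add: h'_def power2_eq_square algebra_simps)
      then have "mean W (\<lambda>p. 2 * f p * h' c p - (h' c p)\<^sup>2) = mean W (\<lambda>p. 2 * f p * h c p - (h c p)\<^sup>2)
         + ((2 * \<tau>) * \<tau> + (- (\<tau>\<^sup>2)) * mean W (\<lambda>p. (s p)\<^sup>2))"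
        by (simp only: mean_add mean_cmult \<tau>_def)
      moreover have "mean W (\<lambda>p. (s p)\<^sup>2) \<le> 1" by (rule mean_le) (auto simp: s_def)
      then have "\<tau>\<^sup>2 * mean W (\<lambda>p. (s p)\<^sup>2) \<le> \<tau>\<^sup>2 * 1" by (intro mult_left_mono) auto
      ultimately show ?thesis using True by (simp add: power2_eq_square)
    qed (simp add: h'_def)
    also have "\<dots> \<le> mean W (\<lambda>p. (cell_mean f W (key \<Lambda>' c') p)\<^sup>2)"
      unfolding mean_def by (intro divide_right_mono sum_variational_le[OF W] h') auto
    finally show ?thesis .
  qed
  have "mean W (\<lambda>p. \<Sum>c<3. 2 * f p * h c p - (h c p)\<^sup>2) + \<tau>\<^sup>2
      = (\<Sum>c'<3. mean W (\<lambda>p. 2 * f p * h c' p - (h c' p)\<^sup>2) + of_bool (c' = c) * \<tau>\<^sup>2)"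
    unfolding mean_sum sum.distrib sum_distrib_right[symmetric]
    using c by (simp add: of_bool_def sum.delta del: sum.lessThan_Suc)
  also have "\<dots> \<le> label_energy f W \<Lambda>'" unfolding label_energy_def by (rule sum_mono) (rule gain)
  also have "\<dots> \<le> energy f (2 * k) W" by (rule energy_ge[OF \<Lambda>'])
  finally show ?thesis .
qed

end

subsection \<open>Uniformity on windows\<close>

text \<open>The sum is linear in each value \<open>a n\<close>, so it does not decrease when
  \<open>a n\<close> becomes 1 where the fibre sum of \<open>g\<close> is positive and 0
  elsewhere.\<close>

lemma bilinear_one_sided:
  fixes g :: "'a \<Rightarrow> real"
  assumes "finite W" "\<And>n. 0 \<le> a n" "\<And>n. a n \<le> 1"
  shows "\<exists>A. (\<Sum>p\<in>W. g p * a (X p)) \<le> (\<Sum>p\<in>W. g p * of_bool (X p \<in> A))"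
proof -
  define S where "S n = (\<Sum>p\<in>{p\<in>W. X p = n}. g p)" for n
  have eq: "(\<Sum>p\<in>W. g p * b (X p)) = (\<Sum>n\<in>X ` W. S n * b n)" for b :: "_ \<Rightarrow> real"
    unfolding sum.image_gen[OF assms(1), where g = X, of "\<lambda>p. g p * b (X p)"] S_def sum_distrib_right
    by (intro sum.cong) auto
  have "(\<Sum>n\<in>X ` W. S n * a n) \<le> (\<Sum>n\<in>X ` W. S n * of_bool (n \<in> {n. S n > 0}))"
    by (rule sum_mono) (use assms in \<open>auto simp: mult_left_le mult_nonpos_nonneg not_less\<close>)
  then show ?thesis
    unfolding eq[of a, symmetric] eq[of "\<lambda>n. of_bool (n \<in> {n. S n > 0})", symmetric] by blast
qed

lemma bilinear_sets:
  fixes g :: "'a \<Rightarrow> real"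
  assumes "finite W" "\<And>n. 0 \<le> a n" "\<And>n. a n \<le> 1" "\<And>n. 0 \<le> b n" "\<And>n. b n \<le> 1"
  shows "\<exists>A B. \<bar>\<Sum>p\<in>W. g p * (a (X p) * b (Y p))\<bar>
    \<le> \<bar>\<Sum>p\<in>W. g p * (of_bool (X p \<in> A) * of_bool (Y p \<in> B))\<bar>"
proof -
  have *: "\<exists>A B. (\<Sum>p\<in>W. g p * (a (X p) * b (Y p)))
    \<le> (\<Sum>p\<in>W. g p * (of_bool (X p \<in> A) * of_bool (Y p \<in> B)))" for g :: "'a \<Rightarrow> real"
  proof -
    obtain A where "(\<Sum>p\<in>W. (g p * b (Y p)) * a (X p)) \<le> (\<Sum>p\<in>W. (g p * b (Y p)) * of_bool (X p \<in> A))"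
      using bilinear_one_sided[where W = W and a = a, OF assms(1-3), where X = X and g = "\<lambda>p. g p * b (Y p)"] by blast
    moreover obtain B where "(\<Sum>p\<in>W. (g p * of_bool (X p \<in> A)) * b (Y p))
        \<le> (\<Sum>p\<in>W. (g p * of_bool (X p \<in> A)) * of_bool (Y p \<in> B))"
      using bilinear_one_sided[where W = W and a = b, OF assms(1,4,5), where X = Y and g = "\<lambda>p. g p * of_bool (X p \<in> A)"] by blast
    ultimately show ?thesis
      by (intro exI[of _ A] exI[of _ B]) (simp add: mult_ac)
  qed
  show ?thesis
  proof (cases "0 \<le> (\<Sum>p\<in>W. g p * (a (X p) * b (Y p)))")
    case True
    obtain A B where "(\<Sum>p\<in>W. g p * (a (X p) * b (Y p)))
      \<le> (\<Sum>p\<in>W. g p * (of_bool (X p \<in> A) * of_bool (Y p \<in> B)))" using *[of g] by blast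
    then show ?thesis using True
      by (intro exI[of _ A] exI[of _ B]) linarith
  next
    case False
    obtain A B where "(\<Sum>p\<in>W. - g p * (a (X p) * b (Y p)))
      \<le> (\<Sum>p\<in>W. - g p * (of_bool (X p \<in> A) * of_bool (Y p \<in> B)))"
      using *[of "\<lambda>p. - g p"] by blast
    then have "- (\<Sum>p\<in>W. g p * (a (X p) * b (Y p)))
      \<le> - (\<Sum>p\<in>W. g p * (of_bool (X p \<in> A) * of_bool (Y p \<in> B)))"
      unfolding sum_negf[symmetric] by simp
    then show ?thesis using False
      by (intro exI[of _ A] exI[of _ B]) linarith
  qed
qed

lemma sum_mean_windows:
  fixes \<phi> :: "int \<times> int \<Rightarrow> real" and H l :: int
  assumes l: "1 \<le> l" "l \<le> H" and bd: "\<And>p. \<bar>\<phi> p\<bar> \<le> C"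
  shows "\<bar>(\<Sum>P\<in>square P0 (H - l + 1). mean (square P l) \<phi>) - (\<Sum>p\<in>square P0 H. \<phi> p)\<bar>
    \<le> C * (H\<^sup>2 - (H - l + 1)\<^sup>2)"
proof -
  have l2: "(real_of_int l)\<^sup>2 > 0" using l by simp
  have *: "\<bar>(\<Sum>P\<in>square P0 (H - l + 1). \<Sum>p\<in>square P l. \<phi> p) - l\<^sup>2 * (\<Sum>p\<in>square P0 H. \<phi> p)\<bar>
    \<le> l\<^sup>2 * (C * (H\<^sup>2 - (H - l + 1)\<^sup>2))"
    using sum_windows[OF l(1) l(2) l(2), of \<phi> C "fst P0" "snd P0"] bd
    by (simp add: square_def power2_eq_square)
  have "(\<Sum>P\<in>square P0 (H - l + 1). \<Sum>p\<in>square P l. \<phi> p) = l\<^sup>2 * (\<Sum>P\<in>square P0 (H - l + 1). mean (square P l) \<phi>)"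
    using l by (simp add: mean_def card_square sum_divide_distrib[symmetric])
  then have "l\<^sup>2 * \<bar>(\<Sum>P\<in>square P0 (H - l + 1). mean (square P l) \<phi>) - (\<Sum>p\<in>square P0 H. \<phi> p)\<bar>
    \<le> l\<^sup>2 * (C * (H\<^sup>2 - (H - l + 1)\<^sup>2))"
    using * by (simp add: right_diff_distrib[symmetric] abs_mult del: of_int_power of_int_diff of_int_add)
  then show ?thesis using l2 by (simp add: mult_le_cancel_left)
qed

text \<open>With the averages over the large square inserted, the functional of
  \<open>sum_variational\<close> attains the energy of that square, and being a sum over points it
  is recovered from windows. Each of its three summands is a difference of two numbers in [0, 1],
  whence the constant 3.\<close>

lemma label_energy_le_windows:
  fixes H l :: int
  assumes f01: "\<And>p. 0 \<le> f p" "\<And>p. f p \<le> 1" and l: "1 \<le> l" "l \<le> H"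
  shows "(H - l + 1)\<^sup>2 * label_energy f (square P0 H) \<Lambda> \<le> (\<Sum>P\<in>square P0 (H - l + 1).
      mean (square P l) (\<lambda>p. \<Sum>c<3. 2 * f p * cell_mean f (square P0 H) (key \<Lambda> c) p - (cell_mean f (square P0 H) (key \<Lambda> c) p)\<^sup>2))
    + 3 * (H\<^sup>2 - (H - l + 1)\<^sup>2)"
proof -
  define n where "n = H - l + 1"
  define Q where "Q = square P0 H"
  define m where "m = real_of_int (n\<^sup>2)"
  have n: "1 \<le> n" using l by (simp add: n_def)
  define h where "h c p = cell_mean f Q (key \<Lambda> c) p" for c p
  define \<phi> where "\<phi> p = (\<Sum>c<3. 2 * f p * h c p - (h c p)\<^sup>2)" for p
  have h01: "0 \<le> h c p" "h c p \<le> 1" for c p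
    unfolding h_def using f01 by (auto intro: cell_mean_nonneg cell_mean_le_1)
  have bd: "\<bar>\<phi> p\<bar> \<le> 3" for p
  proof -
    have "\<bar>2 * f p * h c p - (h c p)\<^sup>2\<bar> \<le> 1" for c
    proof -
      have eq: "2 * f p * h c p - (h c p)\<^sup>2 = (f p)\<^sup>2 - (f p - h c p)\<^sup>2"
        by (simp add: power2_eq_square algebra_simps)
      have "(f p)\<^sup>2 \<le> 1" "(f p - h c p)\<^sup>2 \<le> 1"
        using f01[of p] h01[of c p] by (auto simp: abs_square_le_1)
      then show ?thesis unfolding eq abs_le_iff using zero_le_power2[of "f p"] zero_le_power2[of "f p - h c p"]
        by linarith
    qed
    then have "(\<Sum>c<(3::nat). \<bar>2 * f p * h c p - (h c p)\<^sup>2\<bar>) \<le> (\<Sum>c<(3::nat). 1)"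
      by (intro sum_mono)
    moreover have "\<bar>\<phi> p\<bar> \<le> (\<Sum>c<(3::nat). \<bar>2 * f p * h c p - (h c p)\<^sup>2\<bar>)"
      unfolding \<phi>_def by (rule sum_abs)
    ultimately show ?thesis by simp
  qed
  have label_energy_nn: "0 \<le> label_energy f Q \<Lambda>" unfolding label_energy_def by (intro sum_nonneg mean_nonneg) simp
  have "(\<Sum>p\<in>Q. \<phi> p) = (\<Sum>c<3. \<Sum>p\<in>Q. (h c p)\<^sup>2)"
  proof -
    have "(\<Sum>p\<in>Q. 2 * f p * h c p - (h c p)\<^sup>2) = (\<Sum>p\<in>Q. (h c p)\<^sup>2)" for c
      unfolding h_def using sum_cell_mean_sq[of Q f "key \<Lambda> c"]
      by (simp add: Q_def sum_subtractf mult.assoc sum_distrib_left[symmetric])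
    then show ?thesis unfolding \<phi>_def by (subst sum.swap) simp
  qed
  also have "\<dots> = real (card Q) * label_energy f Q \<Lambda>"
  proof -
    have "real (card Q) \<noteq> 0" using l card_square[of H P0] by (simp add: Q_def)
    then show ?thesis unfolding label_energy_def mean_def h_def sum_distrib_left by simp
  qed
  also have "real (card Q) = H\<^sup>2" using l card_square[of H P0] by (simp add: Q_def)
  finally have sum\<phi>: "(\<Sum>p\<in>Q. \<phi> p) = H\<^sup>2 * label_energy f Q \<Lambda>" .
  have "m \<le> H\<^sup>2"
    unfolding m_def of_int_le_iff using n l by (intro power_mono) (auto simp: n_def)
  then have "m * label_energy f Q \<Lambda> \<le> (\<Sum>p\<in>Q. \<phi> p)"
    unfolding sum\<phi> using label_energy_nn by (intro mult_right_mono) auto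
  then show ?thesis
    using sum_mean_windows[of l H \<phi> 3 P0, OF l bd]
    unfolding n_def[symmetric] Q_def[symmetric] m_def \<phi>_def[abs_def] h_def
    by (simp add: abs_le_iff)
qed

text \<open>On each window the weights may be replaced by indicators of sets, chosen for that window
  alone, and \<open>energy_increment\<close> turns a correlation \<tau> into an excess \<tau>^2 of
  the energy with \<open>2 * k\<close> labels over the functional. The hypothesis on
  \<open>E'\<close> bounds the sum of these excesses; Cauchy-Schwarz then bounds the sum of
  |\<tau>|, whence the square root.\<close>

lemma uniformity:
  fixes H l :: int and E' :: real and a b :: "int \<times> int \<Rightarrow> int \<Rightarrow> real"
  assumes f01: "\<And>p. 0 \<le> f p" "\<And>p. f p \<le> 1"
    and \<Lambda>: "labelling k \<Lambda>" and c: "c < 3" and l: "1 \<le> l" "l \<le> H"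
    and E': "(\<Sum>P\<in>square P0 (H - l + 1). energy f (2 * k) (square P l)) \<le> (H - l + 1)\<^sup>2 * E'"
    and ab: "\<And>P n. 0 \<le> a P n" "\<And>P n. a P n \<le> 1" "\<And>P n. 0 \<le> b P n" "\<And>P n. b P n \<le> 1"
  defines "g \<equiv> \<lambda>p. f p - cell_mean f (square P0 H) (key \<Lambda> c) p"
  shows "(\<Sum>P\<in>square P0 (H - l + 1).
      \<bar>mean (square P l) (\<lambda>p. g p * (a P (crd (lft c) p) * b P (crd (rgt c) p)))\<bar>)
    \<le> (H - l + 1)\<^sup>2 * sqrt (E' - label_energy f (square P0 H) \<Lambda> + 3 * ((H\<^sup>2 - (H - l + 1)\<^sup>2) / (H - l + 1)\<^sup>2))"
proof -
  define n where "n = H - l + 1"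
  define Q where "Q = square P0 H"
  define m where "m = real_of_int (n\<^sup>2)"
  define \<theta> where "\<theta> = (H\<^sup>2 - n\<^sup>2) / n\<^sup>2"
  have n: "1 \<le> n" using l by (simp add: n_def)
  then have m0: "m > 0" by (simp add: m_def)
  have cardV: "real (card (square P0 n)) = m" using card_square[of n P0] n by (simp add: m_def)
  define s where "s A B p = (of_bool (crd (lft c) p \<in> A) * of_bool (crd (rgt c) p \<in> B) :: real)" for A B p
  have "\<exists>A B. \<bar>mean (square P l) (\<lambda>p. g p * (a P (crd (lft c) p) * b P (crd (rgt c) p)))\<bar>
      \<le> \<bar>mean (square P l) (\<lambda>p. g p * s A B p)\<bar>" for P
  proof -
    obtain A B where "\<bar>\<Sum>p\<in>square P l. g p * (a P (crd (lft c) p) * b P (crd (rgt c) p))\<bar>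
      \<le> \<bar>\<Sum>p\<in>square P l. g p * s A B p\<bar>"
      using bilinear_sets[where W = "square P l" and a = "a P" and b = "b P" and g = g and X = "crd (lft c)"
          and Y = "crd (rgt c)", OF finite_square ab] unfolding s_def by blast
    then show ?thesis
      by (intro exI[of _ A] exI[of _ B]) (simp add: mean_def abs_divide divide_right_mono)
  qed
  then obtain A B where AB: "\<And>P. \<bar>mean (square P l) (\<lambda>p. g p * (a P (crd (lft c) p) * b P (crd (rgt c) p)))\<bar>
      \<le> \<bar>mean (square P l) (\<lambda>p. g p * s (A P) (B P) p)\<bar>" by metis
  define \<tau> where "\<tau> P = mean (square P l) (\<lambda>p. g p * s (A P) (B P) p)" for P
  define h where "h c p = cell_mean f Q (key \<Lambda> c) p" for c p
  define \<phi> where "\<phi> p = (\<Sum>c<3. 2 * f p * h c p - (h c p)\<^sup>2)" for p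
  have gain: "mean (square P l) \<phi> + (\<tau> P)\<^sup>2 \<le> energy f (2 * k) (square P l)" for P
    unfolding \<phi>_def \<tau>_def g_def s_def Q_def[symmetric] h_def[of c, symmetric]
    by (rule energy_increment[OF f01 finite_square \<Lambda> c]) (unfold h_def, erule cell_mean_cong_key)
  have low: "m * label_energy f Q \<Lambda> - 3 * (H\<^sup>2 - m) \<le> (\<Sum>P\<in>square P0 n. mean (square P l) \<phi>)"
    using label_energy_le_windows[of f l H P0 \<Lambda>, OF f01 l]
    by (simp add: \<phi>_def[abs_def] h_def Q_def n_def m_def)
  have "(\<Sum>P\<in>square P0 n. (\<tau> P)\<^sup>2) \<le> (\<Sum>P\<in>square P0 n. energy f (2 * k) (square P l) - mean (square P l) \<phi>)"
    by (rule sum_mono) (use gain in \<open>simp add: algebra_simps\<close>)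
  also have "\<dots> \<le> m * E' - (m * label_energy f Q \<Lambda> - 3 * (H\<^sup>2 - m))"
    unfolding sum_subtractf using E' low unfolding n_def[symmetric] m_def by (intro diff_mono) auto
  also have "\<dots> = m * (E' - label_energy f Q \<Lambda> + 3 * \<theta>)"
    using m0 by (simp add: \<theta>_def m_def field_simps)
  finally have sq_le: "(\<Sum>P\<in>square P0 n. (\<tau> P)\<^sup>2) \<le> m * (E' - label_energy f Q \<Lambda> + 3 * \<theta>)" .
  have "(\<Sum>P\<in>square P0 n. \<bar>\<tau> P\<bar>)\<^sup>2 \<le> (\<Sum>P\<in>square P0 n. \<bar>\<tau> P\<bar>\<^sup>2) * real (card (square P0 n))"
    by (rule sum_squared_le_sum_of_squares)
  also have "\<dots> \<le> m * (E' - label_energy f Q \<Lambda> + 3 * \<theta>) * m"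
    unfolding cardV power2_abs using sq_le m0 by (intro mult_right_mono) auto
  finally have "(\<Sum>P\<in>square P0 n. \<bar>\<tau> P\<bar>) \<le> sqrt (m\<^sup>2 * (E' - label_energy f Q \<Lambda> + 3 * \<theta>))"
    by (intro real_le_rsqrt) (simp add: power2_eq_square mult_ac)
  also have "\<dots> = m * sqrt (E' - label_energy f Q \<Lambda> + 3 * \<theta>)"
    using m0 by (simp add: real_sqrt_mult)
  finally have fin: "(\<Sum>P\<in>square P0 n. \<bar>\<tau> P\<bar>) \<le> m * sqrt (E' - label_energy f Q \<Lambda> + 3 * \<theta>)" .
  have "(\<Sum>P\<in>square P0 n. \<bar>mean (square P l) (\<lambda>p. g p * (a P (crd (lft c) p) * b P (crd (rgt c) p)))\<bar>)
    \<le> (\<Sum>P\<in>square P0 n. \<bar>\<tau> P\<bar>)"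
    by (rule sum_mono) (simp add: AB \<tau>_def)
  then show ?thesis using fin unfolding n_def[symmetric] m_def \<theta>_def Q_def by linarith
qed

text \<open>Extension by zero: corners with a vertex outside \<open>Q\<close> do not count, and
  corner sums can be re-based at another vertex without boundary terms.\<close>

definition cut :: "'a set \<Rightarrow> ('a \<Rightarrow> real) \<Rightarrow> 'a \<Rightarrow> real" where
  "cut Q g p = (if p \<in> Q then g p else 0)"

text \<open>The windows are now all those that meet the large square. Those that stick out are
  bounded trivially by \<open>l\<^sup>2\<close> each; their number is the last difference of
  squares.\<close>

lemma uniformity_cut:
  fixes H l :: int and E' :: real and a b :: "int \<times> int \<Rightarrow> int \<Rightarrow> real"
  assumes f01: "\<And>p. 0 \<le> f p" "\<And>p. f p \<le> 1"
    and \<Lambda>: "labelling k \<Lambda>" and c: "c < 3" and l: "1 \<le> l" "l \<le> H"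
    and E': "(\<Sum>P\<in>square P0 (H - l + 1). energy f (2 * k) (square P l)) \<le> (H - l + 1)\<^sup>2 * E'"
    and ab: "\<And>P n. 0 \<le> a P n" "\<And>P n. a P n \<le> 1" "\<And>P n. 0 \<le> b P n" "\<And>P n. b P n \<le> 1"
  defines "g \<equiv> \<lambda>p. f p - cell_mean f (square P0 H) (key \<Lambda> c) p"
  shows "(\<Sum>P\<in>square (P0 - (l - 1, l - 1)) (H + l - 1).
      \<bar>\<Sum>p\<in>square P l. cut (square P0 H) g p * (a P (crd (lft c) p) * b P (crd (rgt c) p))\<bar>)
    \<le> l\<^sup>2 * ((H - l + 1)\<^sup>2 * sqrt (E' - label_energy f (square P0 H) \<Lambda> + 3 * ((H\<^sup>2 - (H - l + 1)\<^sup>2) / (H - l + 1)\<^sup>2))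
      + ((H + l - 1)\<^sup>2 - (H - l + 1)\<^sup>2))"
proof -
  define V where "V = square P0 (H - l + 1)"
  define V' where "V' = square (P0 - (l - 1, l - 1)) (H + l - 1)"
  define t where "t P = \<bar>\<Sum>p\<in>square P l. cut (square P0 H) g p * (a P (crd (lft c) p) * b P (crd (rgt c) p))\<bar>" for P
  have sub: "V \<subseteq> V'" using l by (auto simp: V_def V'_def mem_square)
  have l2: "real (card (square P l)) = l\<^sup>2" for P using l card_square[of l P] by simp
  have g1: "\<bar>cut (square P0 H) g p\<bar> \<le> 1" for p
  proof -
    have "0 \<le> cell_mean f (square P0 H) (key \<Lambda> c) p" "cell_mean f (square P0 H) (key \<Lambda> c) p \<le> 1"
      using f01 by (auto intro: cell_mean_nonneg cell_mean_le_1)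
    then show ?thesis using f01[of p] by (simp add: cut_def g_def abs_le_iff)
  qed
  have in1: "t P = l\<^sup>2 * \<bar>mean (square P l) (\<lambda>p. g p * (a P (crd (lft c) p) * b P (crd (rgt c) p)))\<bar>" if "P \<in> V" for P
  proof -
    have "square P l \<subseteq> square P0 H" using that l by (auto simp: V_def mem_square)
    then have "t P = \<bar>\<Sum>p\<in>square P l. g p * (a P (crd (lft c) p) * b P (crd (rgt c) p))\<bar>"
      unfolding t_def by (intro arg_cong[where f = abs] sum.cong) (auto simp: cut_def)
    then show ?thesis using l l2[of P] by (simp add: mean_def abs_divide)
  qed
  have out: "t P \<le> l\<^sup>2" for P
  proof -
    have "t P \<le> (\<Sum>p\<in>square P l. 1)"
      unfolding t_def
    proof (rule order_trans[OF sum_abs sum_mono])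
      fix p
      have "\<bar>a P (crd (lft c) p) * b P (crd (rgt c) p)\<bar> \<le> 1"
        using ab by (simp add: abs_mult mult_le_one)
      then show "\<bar>cut (square P0 H) g p * (a P (crd (lft c) p) * b P (crd (rgt c) p))\<bar> \<le> 1"
        unfolding abs_mult[of "cut _ _ _"] using g1 by (intro mult_le_one) auto
    qed
    then show ?thesis using l2[of P] by simp
  qed
  have fin: "finite V'" by (simp add: V'_def)
  have "(\<Sum>P\<in>V'. t P) = (\<Sum>P\<in>V. t P) + (\<Sum>P\<in>V' - V. t P)"
    using sum.subset_diff[OF sub fin, of t] by simp
  also have "(\<Sum>P\<in>V. t P) \<le> l\<^sup>2 * ((H - l + 1)\<^sup>2 * sqrt (E' - label_energy f (square P0 H) \<Lambda> + 3 * ((H\<^sup>2 - (H - l + 1)\<^sup>2) / (H - l + 1)\<^sup>2)))"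
  proof -
    have "(\<Sum>P\<in>V. t P) = l\<^sup>2 * (\<Sum>P\<in>V. \<bar>mean (square P l) (\<lambda>p. g p * (a P (crd (lft c) p) * b P (crd (rgt c) p)))\<bar>)"
      unfolding sum_distrib_left by (rule sum.cong[OF refl in1])
    also have "\<dots> \<le> l\<^sup>2 * ((H - l + 1)\<^sup>2 * sqrt (E' - label_energy f (square P0 H) \<Lambda> + 3 * ((H\<^sup>2 - (H - l + 1)\<^sup>2) / (H - l + 1)\<^sup>2)))"
      unfolding V_def g_def
      by (intro mult_left_mono uniformity[where a = a and b = b, OF f01 \<Lambda> c l E' ab]) auto
    finally show ?thesis .
  qed
  also have "(\<Sum>P\<in>V' - V. t P) \<le> (\<Sum>P\<in>V' - V. real_of_int (l\<^sup>2))"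
    by (rule sum_mono) (rule out)
  also have "(\<Sum>P\<in>V' - V. real_of_int (l\<^sup>2)) = l\<^sup>2 * ((H + l - 1)\<^sup>2 - (H - l + 1)\<^sup>2)"
  proof -
    have "real (card (V' - V)) = real (card V') - real (card V)"
      using sub fin card_mono[OF fin sub] by (simp add: card_Diff_subset finite_subset of_nat_diff)
    also have "\<dots> = (H + l - 1)\<^sup>2 - (H - l + 1)\<^sup>2"
      using l card_square[of "H + l - 1" "P0 - (l - 1, l - 1)"] card_square[of "H - l + 1" P0] by (simp add: V_def V'_def)
    finally show ?thesis by simp
  qed
  finally show ?thesis unfolding t_def V'_def by (simp add: algebra_simps)
qed

lemma sum_Times: "(\<Sum>w\<in>A \<times> C. G w) = (\<Sum>x\<in>A. \<Sum>y\<in>C. G (x, y))"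
  by (simp add: sum.cartesian_product case_prod_unfold)

text \<open>Averaging over the shift \<open>s\<close> of the window replaces the weights \<open>K\<close> by products of functions
  of one coordinate each.\<close>
lemma control_by_windows:
  fixes H l s1 s2 :: int and K :: "int \<times> int \<Rightarrow> int \<Rightarrow> int \<Rightarrow> real"
  assumes l: "1 \<le> l"
    and g: "\<And>p. p \<notin> square P0 H \<Longrightarrow> g p = 0"
    and K: "\<And>P u v. u \<notin> {s1..<s1 + l} \<or> v \<notin> {s2..<s2 + l} \<Longrightarrow> K P u v = 0"
    and \<sigma>: "\<And>s. s \<in> square 0 l \<Longrightarrow> 0 \<le> \<sigma>1 s \<and> \<sigma>1 s < l \<and> - l < \<sigma>2 s \<and> \<sigma>2 s < 2 * l"
    and ab: "\<And>P u v n. 0 \<le> a P u v n" "\<And>P u v n. a P u v n \<le> 1"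
      "\<And>P u v n. 0 \<le> b P u v n" "\<And>P u v n. b P u v n \<le> 1"
    and K_ab: "\<And>P u v s. s \<in> square 0 l \<Longrightarrow> K (P + s) (u - \<sigma>1 s) (v - \<sigma>2 s)
      = a P u v (crd i (P + s)) * b P u v (crd j (P + s))"
    and Z: "\<And>a b :: int \<times> int \<Rightarrow> int \<Rightarrow> real. (\<And>P n. 0 \<le> a P n) \<Longrightarrow> (\<And>P n. a P n \<le> 1) \<Longrightarrow>
      (\<And>P n. 0 \<le> b P n) \<Longrightarrow> (\<And>P n. b P n \<le> 1) \<Longrightarrow>
      (\<Sum>P\<in>square (P0 - (l - 1, l - 1)) (H + l - 1).
        \<bar>\<Sum>p\<in>square P l. g p * (a P (crd i p) * b P (crd j p))\<bar>) \<le> Z"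
  shows "\<bar>\<Sum>u\<in>{s1..<s1 + l}. \<Sum>v\<in>{s2..<s2 + l}. \<Sum>P\<in>square P0 H. g P * K P u v\<bar> \<le> 8 * Z"
proof -
  define V' where "V' = square (P0 - (l - 1, l - 1)) (H + l - 1)"
  define D where "D = ({s1..<s1 + l} \<times> {s2..<s2 + l}) \<times> square P0 H"
  \<comment> \<open>Contains \<open>(u + \<sigma>1 s, v + \<sigma>2 s)\<close> for all
    \<open>u\<close>, \<open>v\<close> in the original ranges, so one index set serves every shift
    \<open>s\<close>. It has \<open>2 * l\<close> times \<open>4 * l\<close> points; division by the
    \<open>l\<^sup>2\<close> shifts leaves the factor 8.\<close>
  define B where "B = {s1..<s1 + 2 * l} \<times> {s2 - l..<s2 + 3 * l}"
  define F where "F = (\<lambda>((u, v), P). g P * K P u v)"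
  define \<rho> where "\<rho> s = (\<lambda>((u, v), P). ((u - \<sigma>1 s, v - \<sigma>2 s), P + s))" for s
  have shift: "(\<Sum>w\<in>D. F w) = (\<Sum>w\<in>B \<times> V'. F (\<rho> s w))" if s: "s \<in> square 0 l" for s
  proof -
    have inj: "inj_on (\<rho> s) (B \<times> V')" by (auto simp: inj_on_def \<rho>_def)
    have "D \<subseteq> \<rho> s ` (B \<times> V')"
    proof
      fix w assume w: "w \<in> D"
      obtain u v P where [simp]: "w = ((u, v), P)" by (metis surj_pair)
      have "w = \<rho> s ((u + \<sigma>1 s, v + \<sigma>2 s), P - s)" by (simp add: \<rho>_def)
      moreover have "((u + \<sigma>1 s, v + \<sigma>2 s), P - s) \<in> B \<times> V'"
        using w \<sigma>[OF s] s by (auto simp: D_def B_def V'_def mem_square)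
      ultimately show "w \<in> \<rho> s ` (B \<times> V')" by blast
    qed
    moreover have "F w = 0" if "w \<notin> D" for w
    proof -
      obtain u v P where w: "w = ((u, v), P)" by (metis surj_pair)
      show ?thesis using that g[of P] K[of u v P] by (auto simp: w D_def F_def)
    qed
    ultimately have "(\<Sum>w\<in>D. F w) = (\<Sum>w\<in>\<rho> s ` (B \<times> V'). F w)"
      by (intro sum.mono_neutral_left) (auto simp: B_def V'_def)
    then show ?thesis by (simp add: sum.reindex[OF inj])
  qed
  have l2: "real (card (square 0 l)) = l\<^sup>2" using l card_square[of l 0] by simp
  have "l\<^sup>2 * (\<Sum>w\<in>D. F w) = (\<Sum>s\<in>square 0 l. \<Sum>w\<in>D. F w)" using l2 by simp
  also have "\<dots> = (\<Sum>s\<in>square 0 l. \<Sum>w\<in>B \<times> V'. F (\<rho> s w))" by (rule sum.cong[OF refl shift])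
  also have "\<dots> = (\<Sum>w\<in>B \<times> V'. \<Sum>s\<in>square 0 l. F (\<rho> s w))" by (rule sum.swap)
  also have "\<dots> = (\<Sum>(u, v)\<in>B. \<Sum>P\<in>V'. \<Sum>s\<in>square 0 l. F (\<rho> s ((u, v), P)))"
    by (simp add: sum_Times[where A = B] case_prod_unfold)
  also have "\<dots> = (\<Sum>(u, v)\<in>B. \<Sum>P\<in>V'. \<Sum>p\<in>square P l. g p * (a P u v (crd i p) * b P u v (crd j p)))"
    unfolding sum_square_shift[where l = l and g = "\<lambda>p. g p * (a P u v (crd i p) * b P u v (crd j p))" for P u v]
    by (intro sum.cong refl) (auto simp: F_def \<rho>_def K_ab)
  finally have "\<bar>l\<^sup>2 * (\<Sum>w\<in>D. F w)\<bar>
    = \<bar>\<Sum>(u, v)\<in>B. \<Sum>P\<in>V'. \<Sum>p\<in>square P l. g p * (a P u v (crd i p) * b P u v (crd j p))\<bar>"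
    by simp
  also have "\<dots> \<le> (\<Sum>(u, v)\<in>B. \<Sum>P\<in>V'. \<bar>\<Sum>p\<in>square P l. g p * (a P u v (crd i p) * b P u v (crd j p))\<bar>)"
    unfolding case_prod_unfold by (intro order_trans[OF sum_abs] sum_mono sum_abs)
  also have "\<dots> \<le> (\<Sum>(u, v)\<in>B. Z)"
    unfolding case_prod_unfold V'_def by (intro sum_mono Z ab)
  also have "\<dots> = l\<^sup>2 * (8 * Z)"
    using l by (simp add: B_def case_prod_unfold card_cartesian_product power2_eq_square)
  finally have "l\<^sup>2 * \<bar>\<Sum>w\<in>D. F w\<bar> \<le> l\<^sup>2 * (8 * Z)"
    by (simp add: abs_mult)
  then have "\<bar>\<Sum>w\<in>D. F w\<bar> \<le> 8 * Z" using l by simp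
  then show ?thesis by (simp add: D_def F_def sum_Times)
qed

subsection \<open>Weighted corner sums\<close>

definition corner_sum :: "(int \<times> int) set \<Rightarrow> (int \<times> int \<Rightarrow> real) \<Rightarrow> (int \<times> int \<Rightarrow> real) \<Rightarrow>
    (int \<times> int \<Rightarrow> real) \<Rightarrow> int \<Rightarrow> real" where
  "corner_sum Q g0 g1 g2 d = (\<Sum>p\<in>Q. g0 p * g1 (p - (d, 0)) * g2 (p - (0, d)))"

lemma sum_shift_vanishing:
  fixes F :: "int \<times> int \<Rightarrow> real"
  assumes "finite Q" "\<And>p. p \<in> Q \<Longrightarrow> p - e \<notin> Q \<Longrightarrow> F p = 0" "\<And>p. p - e \<in> Q \<Longrightarrow> p \<notin> Q \<Longrightarrow> F p = 0"
  shows "(\<Sum>p\<in>Q. F p) = (\<Sum>P\<in>Q. F (P + e))"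
  by (rule sum.reindex_bij_witness_not_neutral[where i = "\<lambda>P. P + e" and j = "\<lambda>p. p - e"
        and S' = "{p\<in>Q. p - e \<notin> Q}" and T' = "{P\<in>Q. P + e \<notin> Q}"])
    (use assms in auto)

text \<open>Re-basing at the second vertex puts \<open>g1\<close> at the summation variable, as
  \<open>control_by_windows\<close> requires.\<close>

lemma corner_sum_base_1:
  assumes "finite Q" "\<And>p. p \<notin> Q \<Longrightarrow> g0 p = 0" "\<And>p. p \<notin> Q \<Longrightarrow> g1 p = 0"
  shows "corner_sum Q g0 g1 g2 d = (\<Sum>P\<in>Q. g1 P * (g0 (P + (d, 0)) * g2 (P + (d, - d))))"
  unfolding corner_sum_def
  by (subst sum_shift_vanishing[where e = "(d, 0)"]) (use assms in \<open>auto intro!: sum.cong simp: algebra_simps\<close>)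

lemma corner_sum_base_2:
  assumes "finite Q" "\<And>p. p \<notin> Q \<Longrightarrow> g0 p = 0" "\<And>p. p \<notin> Q \<Longrightarrow> g2 p = 0"
  shows "corner_sum Q g0 g1 g2 d = (\<Sum>P\<in>Q. g2 P * (g0 (P + (0, d)) * g1 (P + (- d, d))))"
  unfolding corner_sum_def
  by (subst sum_shift_vanishing[where e = "(0, d)"]) (use assms in \<open>auto intro!: sum.cong simp: algebra_simps\<close>)

text \<open>The weights may vary with the window. \<open>Z\<close> bounds an unnormalised sum, so it
  is to be compared with \<open>l\<^sup>2 * H\<^sup>2\<close>.\<close>

definition uniform :: "int \<times> int \<Rightarrow> int \<Rightarrow> int \<Rightarrow> nat \<Rightarrow> (int \<times> int \<Rightarrow> real) \<Rightarrow> real \<Rightarrow> bool" where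
  "uniform P0 H l c g Z \<longleftrightarrow> (\<forall>a b. (\<forall>P n. 0 \<le> a P n \<and> a P n \<le> 1 \<and> 0 \<le> b P n \<and> b P n \<le> 1) \<longrightarrow>
     (\<Sum>P\<in>square (P0 - (l - 1, l - 1)) (H + l - 1).
        \<bar>\<Sum>p\<in>square P l. g p * (a P (crd (lft c) p) * b P (crd (rgt c) p))\<bar>) \<le> Z)"

lemma crd_simps [simp]: "crd 0 (x, y) = y" "crd (Suc 0) (x, y) = x" "crd 1 (x, y) = x" "crd 2 (x, y) = x + y"
  by (auto simp: crd_def)

lemma lft_rgt_simps [simp]: "lft 0 = 0" "rgt 0 = 1" "lft 1 = 0" "rgt 1 = 2" "lft 2 = 1" "rgt 2 = 2"
    "lft (Suc 0) = 0" "rgt (Suc 0) = 2"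
  by (auto simp: lft_def rgt_def)

lemma unit_mult:
  fixes x y :: real
  assumes "0 \<le> x" "x \<le> 1" "0 \<le> y" "y \<le> 1"
  shows "0 \<le> x * y" "x * y \<le> 1"
  using assms by (auto intro: mult_le_one)

lemma corner_sum_telescope:
  "corner_sum Q f f f d - corner_sum Q h0 h1 h2 d
    = corner_sum Q (\<lambda>p. f p - h0 p) f f d + corner_sum Q h0 (\<lambda>p. f p - h1 p) f d
      + corner_sum Q h0 h1 (\<lambda>p. f p - h2 p) d"
  unfolding corner_sum_def sum_subtractf[symmetric] sum.distrib[symmetric]
  by (rule sum.cong) (simp_all add: algebra_simps)

context
  fixes P0 :: "int \<times> int" and H l s1 s2 :: int and Q and \<phi> \<psi> :: "int \<Rightarrow> real"
  assumes l: "1 \<le> l" and Q: "Q = square P0 H"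
    and \<phi>: "\<And>n. 0 \<le> \<phi> n" "\<And>n. \<phi> n \<le> 1" "\<And>n. n \<notin> {s1..<s1 + l} \<Longrightarrow> \<phi> n = 0"
    and \<psi>: "\<And>n. 0 \<le> \<psi> n" "\<And>n. \<psi> n \<le> 1" "\<And>n. n \<notin> {s2..<s2 + l} \<Longrightarrow> \<psi> n = 0"
begin

text \<open>With \<open>s = (t, t')\<close>, passing from \<open>(P, u, v)\<close> to
  \<open>(P + s, u - t', v + t)\<close> raises \<open>v - u\<close> by \<open>t + t'\<close>. Then
  the arguments of \<open>g1\<close> and \<open>\<phi>\<close> depend on \<open>s\<close> only
  through \<open>t'\<close>, those of \<open>g2\<close> and \<open>\<psi>\<close> only through
  \<open>t\<close>. A general weight in \<open>v - u\<close> would involve \<open>t + t'\<close>;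
  this is why the weights are products \<open>\<phi> u * \<psi> v\<close>.\<close>

lemma corner_control_0:
  assumes g0: "uniform P0 H l 0 g0 Z" "\<And>p. p \<notin> Q \<Longrightarrow> g0 p = 0"
    and g1: "\<And>p. 0 \<le> g1 p" "\<And>p. g1 p \<le> 1"
    and g2: "\<And>p. 0 \<le> g2 p" "\<And>p. g2 p \<le> 1"
  shows "\<bar>\<Sum>u\<in>{s1..<s1 + l}. \<Sum>v\<in>{s2..<s2 + l}. \<phi> u * \<psi> v * corner_sum Q g0 g1 g2 (v - u)\<bar> \<le> 8 * Z"
proof -
  define K where "K P u v = \<phi> u * \<psi> v * (g1 (P - (v - u, 0)) * g2 (P - (0, v - u)))" for P u v
  define a where "a P u v n = \<phi> (u + snd P - n) * g1 (fst P - v + u + snd P - n, n)" for P :: "int \<times> int" and u v n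
  define b where "b P u v n = \<psi> (v + n - fst P) * g2 (n, snd P - v + u + fst P - n)" for P :: "int \<times> int" and u v n
  have "\<bar>\<Sum>u\<in>{s1..<s1 + l}. \<Sum>v\<in>{s2..<s2 + l}. \<Sum>P\<in>square P0 H. g0 P * K P u v\<bar> \<le> 8 * Z"
  proof (rule control_by_windows[where i = "lft 0" and j = "rgt 0" and a = a and b = b
        and ?\<sigma>1.0 = snd and ?\<sigma>2.0 = "\<lambda>s. - fst s"])
    fix P :: "int \<times> int" and u v :: int and s assume "s \<in> square 0 l"
    obtain x y t t' where [simp]: "P = (x, y)" "s = (t, t')" by (metis surj_pair)
    show "K (P + s) (u - snd s) (v - - fst s) = a P u v (crd (lft 0) (P + s)) * b P u v (crd (rgt 0) (P + s))"
      by (simp add: K_def a_def b_def algebra_simps)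
  next
    fix a b :: "int \<times> int \<Rightarrow> int \<Rightarrow> real"
    assume "\<And>P n. 0 \<le> a P n" "\<And>P n. a P n \<le> 1" "\<And>P n. 0 \<le> b P n" "\<And>P n. b P n \<le> 1"
    then show "(\<Sum>P\<in>square (P0 - (l - 1, l - 1)) (H + l - 1).
        \<bar>\<Sum>p\<in>square P l. g0 p * (a P (crd (lft 0) p) * b P (crd (rgt 0) p))\<bar>) \<le> Z"
      using g0(1) unfolding uniform_def by blast
  qed (use l g0 Q \<phi> \<psi> in \<open>auto simp: K_def a_def b_def mem_square intro!: unit_mult g1 g2\<close>)
  then show ?thesis
    by (simp add: corner_sum_def K_def Q sum_distrib_left mult_ac)
qed

text \<open>Here the shift takes \<open>u\<close> to \<open>u - t'\<close> and \<open>v\<close> to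
  \<open>v - (t + t')\<close>, so \<open>v - u\<close> drops by \<open>t\<close>: the argument of
  \<open>g0\<close> moves with \<open>t'\<close> and that of \<open>g2\<close> with
  \<open>t + t'\<close>, matching the coordinates y and x + y of the second vertex.\<close>

lemma corner_control_1:
  assumes g1: "uniform P0 H l 1 g1 Z" "\<And>p. p \<notin> Q \<Longrightarrow> g1 p = 0"
    and g0: "\<And>p. 0 \<le> g0 p" "\<And>p. g0 p \<le> 1" "\<And>p. p \<notin> Q \<Longrightarrow> g0 p = 0"
    and g2: "\<And>p. 0 \<le> g2 p" "\<And>p. g2 p \<le> 1"
  shows "\<bar>\<Sum>u\<in>{s1..<s1 + l}. \<Sum>v\<in>{s2..<s2 + l}. \<phi> u * \<psi> v * corner_sum Q g0 g1 g2 (v - u)\<bar> \<le> 8 * Z"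
proof -
  define K where "K P u v = \<phi> u * \<psi> v * (g0 (P + (v - u, 0)) * g2 (P + (v - u, - (v - u))))" for P u v
  define a where "a P u v n = \<phi> (u + snd P - n) * g0 (fst P + v - u, n)" for P :: "int \<times> int" and u v n
  define b where "b P u v n = \<psi> (v + fst P + snd P - n) * g2 (fst P + v - u, n - (fst P + v - u))"
    for P :: "int \<times> int" and u v n
  have "\<bar>\<Sum>u\<in>{s1..<s1 + l}. \<Sum>v\<in>{s2..<s2 + l}. \<Sum>P\<in>square P0 H. g1 P * K P u v\<bar> \<le> 8 * Z"
  proof (rule control_by_windows[where i = "lft 1" and j = "rgt 1" and a = a and b = b
        and ?\<sigma>1.0 = snd and ?\<sigma>2.0 = "\<lambda>s. fst s + snd s"])
    fix P :: "int \<times> int" and u v :: int and s assume "s \<in> square 0 l"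
    obtain x y t t' where [simp]: "P = (x, y)" "s = (t, t')" by (metis surj_pair)
    show "K (P + s) (u - snd s) (v - (fst s + snd s)) = a P u v (crd (lft 1) (P + s)) * b P u v (crd (rgt 1) (P + s))"
      by (simp add: K_def a_def b_def algebra_simps)
  next
    fix a b :: "int \<times> int \<Rightarrow> int \<Rightarrow> real"
    assume "\<And>P n. 0 \<le> a P n" "\<And>P n. a P n \<le> 1" "\<And>P n. 0 \<le> b P n" "\<And>P n. b P n \<le> 1"
    then show "(\<Sum>P\<in>square (P0 - (l - 1, l - 1)) (H + l - 1).
        \<bar>\<Sum>p\<in>square P l. g1 p * (a P (crd (lft 1) p) * b P (crd (rgt 1) p))\<bar>) \<le> Z"
      using g1(1) unfolding uniform_def by blast
  qed (use l g1 Q \<phi> \<psi> in \<open>auto simp: K_def a_def b_def mem_square intro!: unit_mult g0 g2\<close>)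
  moreover have "corner_sum Q g0 g1 g2 d = (\<Sum>P\<in>Q. g1 P * (g0 (P + (d, 0)) * g2 (P + (d, - d))))" for d
    by (rule corner_sum_base_1) (use Q g0 g1 in auto)
  ultimately show ?thesis
    by (simp add: K_def Q sum_distrib_left mult_ac)
qed

text \<open>Here the shift takes \<open>u\<close> to \<open>u - t\<close> and \<open>v\<close> to
  \<open>v - (t + t')\<close>, so \<open>v - u\<close> drops by \<open>t'\<close>: the argument of
  \<open>g0\<close> moves with \<open>t\<close> and that of \<open>g1\<close> with
  \<open>t + t'\<close>, matching the coordinates x and x + y of the third vertex.\<close>

lemma corner_control_2:
  assumes g2: "uniform P0 H l 2 g2 Z" "\<And>p. p \<notin> Q \<Longrightarrow> g2 p = 0"
    and g0: "\<And>p. 0 \<le> g0 p" "\<And>p. g0 p \<le> 1" "\<And>p. p \<notin> Q \<Longrightarrow> g0 p = 0"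
    and g1: "\<And>p. 0 \<le> g1 p" "\<And>p. g1 p \<le> 1"
  shows "\<bar>\<Sum>u\<in>{s1..<s1 + l}. \<Sum>v\<in>{s2..<s2 + l}. \<phi> u * \<psi> v * corner_sum Q g0 g1 g2 (v - u)\<bar> \<le> 8 * Z"
proof -
  define K where "K P u v = \<phi> u * \<psi> v * (g0 (P + (0, v - u)) * g1 (P + (- (v - u), v - u)))" for P u v
  define a where "a P u v n = \<phi> (u + fst P - n) * g0 (n, snd P + v - u)" for P :: "int \<times> int" and u v n
  define b where "b P u v n = \<psi> (v + fst P + snd P - n) * g1 (n - (snd P + v - u), snd P + v - u)"
    for P :: "int \<times> int" and u v n
  have "\<bar>\<Sum>u\<in>{s1..<s1 + l}. \<Sum>v\<in>{s2..<s2 + l}. \<Sum>P\<in>square P0 H. g2 P * K P u v\<bar> \<le> 8 * Z"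
  proof (rule control_by_windows[where i = "lft 2" and j = "rgt 2" and a = a and b = b
        and ?\<sigma>1.0 = fst and ?\<sigma>2.0 = "\<lambda>s. fst s + snd s"])
    fix P :: "int \<times> int" and u v :: int and s assume "s \<in> square 0 l"
    obtain x y t t' where [simp]: "P = (x, y)" "s = (t, t')" by (metis surj_pair)
    show "K (P + s) (u - fst s) (v - (fst s + snd s)) = a P u v (crd (lft 2) (P + s)) * b P u v (crd (rgt 2) (P + s))"
      by (simp add: K_def a_def b_def algebra_simps)
  next
    fix a b :: "int \<times> int \<Rightarrow> int \<Rightarrow> real"
    assume "\<And>P n. 0 \<le> a P n" "\<And>P n. a P n \<le> 1" "\<And>P n. 0 \<le> b P n" "\<And>P n. b P n \<le> 1"
    then show "(\<Sum>P\<in>square (P0 - (l - 1, l - 1)) (H + l - 1).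
        \<bar>\<Sum>p\<in>square P l. g2 p * (a P (crd (lft 2) p) * b P (crd (rgt 2) p))\<bar>) \<le> Z"
      using g2(1) unfolding uniform_def by blast
  qed (use l g2 Q \<phi> \<psi> in \<open>auto simp: K_def a_def b_def mem_square intro!: unit_mult g0 g1\<close>)
  moreover have "corner_sum Q g0 g1 g2 d = (\<Sum>P\<in>Q. g2 P * (g0 (P + (0, d)) * g1 (P + (- d, d))))" for d
    by (rule corner_sum_base_2) (use Q g0 g2 in auto)
  ultimately show ?thesis
    by (simp add: K_def Q sum_distrib_left mult_ac)
qed

lemma corner_control:
  assumes f: "\<And>p. 0 \<le> f p" "\<And>p. f p \<le> 1" "\<And>p. p \<notin> Q \<Longrightarrow> f p = 0"
    and h: "\<And>c p. 0 \<le> h c p" "\<And>c p. h c p \<le> 1" "\<And>c p. p \<notin> Q \<Longrightarrow> h c p = 0"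
    and unif: "\<And>c. c < 3 \<Longrightarrow> uniform P0 H l c (\<lambda>p. f p - h c p) Z"
  shows "\<bar>(\<Sum>u\<in>{s1..<s1 + l}. \<Sum>v\<in>{s2..<s2 + l}. \<phi> u * \<psi> v * corner_sum Q f f f (v - u))
    - (\<Sum>u\<in>{s1..<s1 + l}. \<Sum>v\<in>{s2..<s2 + l}. \<phi> u * \<psi> v * corner_sum Q (h 0) (h 1) (h 2) (v - u))\<bar> \<le> 24 * Z"
proof -
  define \<Sigma> where "\<Sigma> F = (\<Sum>u\<in>{s1..<s1 + l}. \<Sum>v\<in>{s2..<s2 + l}. \<phi> u * \<psi> v * F (v - u))" for F :: "int \<Rightarrow> real"
  have add: "\<Sigma> (\<lambda>d. F d + G d) = \<Sigma> F + \<Sigma> G" for F G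
    by (simp add: \<Sigma>_def sum.distrib algebra_simps)
  have diff: "\<Sigma> F - \<Sigma> G = \<Sigma> (\<lambda>d. F d - G d)" for F G
    by (simp add: \<Sigma>_def sum_subtractf algebra_simps)
  have "\<bar>\<Sigma> (corner_sum Q (\<lambda>p. f p - h 0 p) f f)\<bar> \<le> 8 * Z"
    unfolding \<Sigma>_def by (rule corner_control_0[OF unif]) (use f h in auto)
  moreover have "\<bar>\<Sigma> (corner_sum Q (h 0) (\<lambda>p. f p - h 1 p) f)\<bar> \<le> 8 * Z"
    unfolding \<Sigma>_def by (rule corner_control_1[OF unif]) (use f h in auto)
  moreover have "\<bar>\<Sigma> (corner_sum Q (h 0) (h 1) (\<lambda>p. f p - h 2 p))\<bar> \<le> 8 * Z"
    unfolding \<Sigma>_def by (rule corner_control_2[OF unif]) (use f h in auto)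
  moreover have "\<Sigma> (corner_sum Q f f f) - \<Sigma> (corner_sum Q (h 0) (h 1) (h 2)) =
      \<Sigma> (corner_sum Q (\<lambda>p. f p - h 0 p) f f) + \<Sigma> (corner_sum Q (h 0) (\<lambda>p. f p - h 1 p) f)
      + \<Sigma> (corner_sum Q (h 0) (h 1) (\<lambda>p. f p - h 2 p))"
    unfolding diff add[symmetric] corner_sum_telescope ..
  ultimately show ?thesis unfolding \<Sigma>_def[symmetric] by linarith
qed

end

lemma sum_shift_le:
  fixes g :: "int \<times> int \<Rightarrow> real"
  assumes "finite Q" "\<And>p. 0 \<le> g p" "\<And>p. p \<notin> Q \<Longrightarrow> g p = 0"
  shows "(\<Sum>p\<in>Q. g (p - e)) \<le> (\<Sum>p\<in>Q. g p)"
proof -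
  have inj: "inj_on (\<lambda>p. p - e) Q" by (auto simp: inj_on_def)
  have "(\<Sum>p\<in>Q. g (p - e)) = (\<Sum>p\<in>(\<lambda>p. p - e) ` Q. g p)" by (simp add: sum.reindex[OF inj])
  also have "\<dots> \<le> (\<Sum>p\<in>(\<lambda>p. p - e) ` Q \<union> Q. g p)"
    using assms by (intro sum_mono2) auto
  also have "\<dots> = (\<Sum>p\<in>Q. g p)"
    using assms by (intro sum.mono_neutral_right) auto
  finally show ?thesis .
qed

text \<open>The factors are exchanged one at a time, the others being in [0, 1]. The errors at the
  translated vertices are shifted back into \<open>Q\<close> at no cost, since all functions vanish
  off \<open>Q\<close>.\<close>

lemma corner_sum_perturb:
  fixes h k :: "nat \<Rightarrow> int \<times> int \<Rightarrow> real"
  assumes Q: "finite Q"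
    and h: "\<And>c p. 0 \<le> h c p" "\<And>c p. h c p \<le> 1" "\<And>c p. p \<notin> Q \<Longrightarrow> h c p = 0"
    and k: "\<And>c p. 0 \<le> k c p" "\<And>c p. k c p \<le> 1" "\<And>c p. p \<notin> Q \<Longrightarrow> k c p = 0"
  shows "corner_sum Q (k 0) (k 1) (k 2) d - (\<Sum>c<3. \<Sum>p\<in>Q. \<bar>h c p - k c p\<bar>) \<le> corner_sum Q (h 0) (h 1) (h 2) d"
proof -
  have pt: "k0 * k1 * k2 \<le> h0 * h1 * h2 + \<bar>h0 - k0\<bar> + \<bar>h1 - k1\<bar> + \<bar>h2 - k2\<bar>"
    if "0 \<le> k0" "k0 \<le> 1" "0 \<le> k1" "k1 \<le> 1" "0 \<le> k2" "k2 \<le> 1" "0 \<le> h0" "h0 \<le> 1"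
      "0 \<le> h1" "h1 \<le> 1" "0 \<le> h2" "h2 \<le> 1" for k0 k1 k2 h0 h1 h2 :: real
  proof -
    have eq: "k0 * k1 * k2 - h0 * h1 * h2 = (k0 - h0) * (k1 * k2) + (k1 - h1) * (h0 * k2) + (k2 - h2) * (h0 * h1)"
      by (simp add: algebra_simps)
    have *: "(x - y) * z \<le> \<bar>y - x\<bar>" if "0 \<le> z" "z \<le> 1" for x y z :: real
    proof -
      have "(x - y) * z \<le> \<bar>y - x\<bar> * z" using that by (intro mult_right_mono) auto
      also have "\<dots> \<le> \<bar>y - x\<bar> * 1" using that by (intro mult_left_mono) auto
      finally show ?thesis by simp
    qed
    have "k0 * k1 * k2 - h0 * h1 * h2 \<le> \<bar>h0 - k0\<bar> + \<bar>h1 - k1\<bar> + \<bar>h2 - k2\<bar>"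
      unfolding eq by (intro add_mono * unit_mult that)
    then show ?thesis by simp
  qed
  have "corner_sum Q (k 0) (k 1) (k 2) d \<le> (\<Sum>p\<in>Q. h 0 p * h 1 (p - (d, 0)) * h 2 (p - (0, d))
      + \<bar>h 0 p - k 0 p\<bar> + \<bar>h 1 (p - (d, 0)) - k 1 (p - (d, 0))\<bar> + \<bar>h 2 (p - (0, d)) - k 2 (p - (0, d))\<bar>)"
    unfolding corner_sum_def by (intro sum_mono pt h k)
  also have "\<dots> = corner_sum Q (h 0) (h 1) (h 2) d + (\<Sum>p\<in>Q. \<bar>h 0 p - k 0 p\<bar>)
      + (\<Sum>p\<in>Q. \<bar>h 1 (p - (d, 0)) - k 1 (p - (d, 0))\<bar>) + (\<Sum>p\<in>Q. \<bar>h 2 (p - (0, d)) - k 2 (p - (0, d))\<bar>)"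
    unfolding corner_sum_def by (simp add: sum.distrib)
  also have "\<dots> \<le> corner_sum Q (h 0) (h 1) (h 2) d + (\<Sum>p\<in>Q. \<bar>h 0 p - k 0 p\<bar>)
      + (\<Sum>p\<in>Q. \<bar>h 1 p - k 1 p\<bar>) + (\<Sum>p\<in>Q. \<bar>h 2 p - k 2 p\<bar>)"
    by (intro add_mono order_refl sum_shift_le[where g = "\<lambda>p. \<bar>h 1 p - k 1 p\<bar>"]
        sum_shift_le[where g = "\<lambda>p. \<bar>h 2 p - k 2 p\<bar>"]) (use Q h k in auto)
  finally show ?thesis by (simp add: eval_nat_numeral)
qed

subsection \<open>Almost periodicity of structured corner sums\<close>

text \<open>A weak regularity (Frieze-Kannan) decomposition: \<open>A\<close> is close in cut norm
  to \<open>\<delta>\<close> times a sum of \<open>N\<close> products. The cut norm is expressed by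
  testing against products of functions with values in [-1, 1].\<close>

definition cut_approx :: "'a set \<Rightarrow> 'b set \<Rightarrow> real \<Rightarrow> nat \<Rightarrow> ('a \<Rightarrow> 'b \<Rightarrow> real) \<Rightarrow>
    (nat \<Rightarrow> 'a \<Rightarrow> real) \<Rightarrow> (nat \<Rightarrow> 'b \<Rightarrow> real) \<Rightarrow> bool" where
  "cut_approx X Z \<delta> N A p q \<longleftrightarrow> (\<forall>l x. \<bar>p l x\<bar> \<le> 1) \<and> (\<forall>l z. \<bar>q l z\<bar> \<le> 1) \<and>
    (\<forall>b c. (\<forall>x. \<bar>b x\<bar> \<le> 1) \<longrightarrow> (\<forall>z. \<bar>c z\<bar> \<le> 1) \<longrightarrow>
      \<bar>\<Sum>x\<in>X. \<Sum>z\<in>Z. (A x z - \<delta> * (\<Sum>l<N. p l x * q l z)) * (b x * c z)\<bar>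
        \<le> \<delta> * (real (card X) * real (card Z)))"

text \<open>As long as some product \<open>b \<otimes> c\<close> violates the bound, subtracting \<open>\<delta> b \<otimes> c\<close> lowers the squared
  norm of \<open>A\<close> by \<open>\<delta>\<^sup>2\<close> times the number of entries.\<close>
lemma cut_approximation:
  fixes A :: "'a \<Rightarrow> 'b \<Rightarrow> real"
  assumes "finite X" "finite Z" "\<delta> > 0"
    and "(\<Sum>x\<in>X. \<Sum>z\<in>Z. (A x z)\<^sup>2) \<le> real N * \<delta>\<^sup>2 * (real (card X) * real (card Z))"
  shows "\<exists>p q. cut_approx X Z \<delta> N A p q"
  using assms(4)
proof (induction N arbitrary: A)
  case 0
  have "(\<Sum>x\<in>X. \<Sum>z\<in>Z. (A x z)\<^sup>2) = 0"
    using 0 by (intro antisym sum_nonneg) auto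
  then have "A x z = 0" if "x \<in> X" "z \<in> Z" for x z
    using that assms by (simp add: sum_nonneg_eq_0_iff sum_nonneg)
  then have "(\<Sum>x\<in>X. \<Sum>z\<in>Z. A x z * (b x * c z)) = 0" for b c
    by (intro sum.neutral ballI) simp
  then show ?case using assms unfolding cut_approx_def by (intro exI[of _ "\<lambda>_ _. 0"]) simp
next
  case (Suc N)
  define m where "m = real (card X) * real (card Z)"
  define form where "form A b c = (\<Sum>x\<in>X. \<Sum>z\<in>Z. A x z * (b x * c z))" for A :: "'a \<Rightarrow> 'b \<Rightarrow> real" and b c
  show ?case
  proof (cases "\<forall>b c. (\<forall>x. \<bar>b x\<bar> \<le> 1) \<longrightarrow> (\<forall>z. \<bar>c z\<bar> \<le> 1) \<longrightarrow> \<bar>form A b c\<bar> \<le> \<delta> * m")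
    case True
    then show ?thesis unfolding form_def m_def cut_approx_def by (intro exI[of _ "\<lambda>_ _. 0"]) simp
  next
    case False
    then obtain b0 c where b0: "\<And>x. \<bar>b0 x\<bar> \<le> 1" and c: "\<And>z. \<bar>c z\<bar> \<le> 1"
      and big: "\<bar>form A b0 c\<bar> > \<delta> * m" by (metis not_le)
    \<comment> \<open>The sign is absorbed into \<open>b\<close>, so that the correlation is
      positive and subtracting the product lowers the norm.\<close>
    define b where "b x = sgn (form A b0 c) * b0 x" for x
    have b: "\<bar>b x\<bar> \<le> 1" for x using b0[of x] by (auto simp: b_def abs_mult sgn_if)
    have "form A (\<lambda>x. s * b0 x) c = s * form A b0 c" for s
      by (simp add: form_def sum_distrib_left mult_ac)
    then have "form A b c = sgn (form A b0 c) * form A b0 c"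
      unfolding b_def .
    then have fb: "form A b c > \<delta> * m" using big by (simp add: abs_sgn mult.commute)
    define A' where "A' x z = A x z - \<delta> * (b x * c z)" for x z
    have "(\<Sum>x\<in>X. \<Sum>z\<in>Z. (b x * c z)\<^sup>2) \<le> (\<Sum>x\<in>X. \<Sum>z\<in>Z. 1)"
    proof (intro sum_mono)
      fix x z
      have "\<bar>b x * c z\<bar> \<le> 1" unfolding abs_mult using b c by (intro mult_le_one) auto
      then show "(b x * c z)\<^sup>2 \<le> 1" by (simp add: abs_square_le_1)
    qed
    then have bc: "(\<Sum>x\<in>X. \<Sum>z\<in>Z. (b x * c z)\<^sup>2) \<le> m" by (simp add: m_def)
    have "(\<Sum>x\<in>X. \<Sum>z\<in>Z. (A' x z)\<^sup>2) = (\<Sum>x\<in>X. \<Sum>z\<in>Z. (A x z)\<^sup>2) - 2 * \<delta> * form A b c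
        + \<delta>\<^sup>2 * (\<Sum>x\<in>X. \<Sum>z\<in>Z. (b x * c z)\<^sup>2)"
      by (simp add: A'_def form_def power2_diff power_mult_distrib sum.distrib sum_subtractf
          sum_distrib_left mult_ac)
    also have "\<dots> \<le> real (Suc N) * \<delta>\<^sup>2 * m - 2 * \<delta> * (\<delta> * m) + \<delta>\<^sup>2 * m"
      using Suc.prems fb bc assms(3) unfolding m_def[symmetric]
      by (intro add_mono diff_mono mult_left_mono) auto
    also have "\<dots> = real N * \<delta>\<^sup>2 * m" by (simp add: algebra_simps power2_eq_square)
    finally have "(\<Sum>x\<in>X. \<Sum>z\<in>Z. (A' x z)\<^sup>2) \<le> real N * \<delta>\<^sup>2 * m" .
    from Suc.IH[OF this[unfolded m_def]] obtain p q where pq: "cut_approx X Z \<delta> N A' p q" by blast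
    define p' where "p' l = (if l < N then p l else b)" for l
    define q' where "q' l = (if l < N then q l else c)" for l
    have "A x z - \<delta> * (\<Sum>l<Suc N. p' l x * q' l z) = A' x z - \<delta> * (\<Sum>l<N. p l x * q l z)" for x z
      by (simp add: p'_def q'_def A'_def algebra_simps)
    then show ?thesis
      using pq b c unfolding cut_approx_def
      by (intro exI[of _ p'] exI[of _ q']) (simp add: p'_def q'_def)
  qed
qed

text \<open>Up to a cut-norm error \<open>\<delta>\<close> for each of \<open>b\<close> and
  \<open>b'\<close>, the form sees them only through their inner products with the \<open>N\<close>
  left factors; each discrepancy there costs \<open>\<delta> * \<delta>2\<close>.\<close>

lemma cut_approximation_diff:
  fixes A :: "int \<Rightarrow> int \<Rightarrow> real" and p q :: "nat \<Rightarrow> int \<Rightarrow> real"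
  assumes \<delta>: "\<delta> > 0" "\<delta>2 \<ge> 0" and pq: "cut_approx X Z \<delta> N A p q"
    and b: "\<And>x. \<bar>b x\<bar> \<le> 1" and b': "\<And>x. \<bar>b' x\<bar> \<le> 1" and c: "\<And>z. \<bar>c z\<bar> \<le> 1"
    and close: "\<And>l. l < N \<Longrightarrow> \<bar>(\<Sum>x\<in>X. p l x * b x) - (\<Sum>x\<in>X. p l x * b' x)\<bar> \<le> \<delta>2 * real (card X)"
  shows "\<bar>(\<Sum>x\<in>X. \<Sum>z\<in>Z. A x z * (b x * c z)) - (\<Sum>x\<in>X. \<Sum>z\<in>Z. A x z * (b' x * c z))\<bar>
    \<le> (2 * \<delta> + \<delta> * N * \<delta>2) * (real (card X) * real (card Z))"
proof -
  have q: "\<bar>q l z\<bar> \<le> 1" for l z using pq by (simp add: cut_approx_def)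
  have err: "\<bar>\<Sum>x\<in>X. \<Sum>z\<in>Z. (A x z - \<delta> * (\<Sum>l<N. p l x * q l z)) * (b x * c z)\<bar>
        \<le> \<delta> * (real (card X) * real (card Z))" if "\<And>x. \<bar>b x\<bar> \<le> 1" for b
    using pq that c by (simp add: cut_approx_def)
  define S where "S x z = \<delta> * (\<Sum>l<N. p l x * q l z)" for x z
  define D where "D l = (\<Sum>x\<in>X. p l x * b x) - (\<Sum>x\<in>X. p l x * b' x)" for l
  define m where "m = real (card X) * real (card Z)"
  have split: "(\<Sum>x\<in>X. \<Sum>z\<in>Z. A x z * (b x * c z))
    = (\<Sum>x\<in>X. \<Sum>z\<in>Z. (A x z - S x z) * (b x * c z)) + (\<Sum>x\<in>X. \<Sum>z\<in>Z. S x z * (b x * c z))" for b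
    by (simp add: sum.distrib[symmetric] algebra_simps)
  have S: "(\<Sum>x\<in>X. \<Sum>z\<in>Z. S x z * (b x * c z)) = (\<Sum>l<N. \<delta> * ((\<Sum>x\<in>X. p l x * b x) * (\<Sum>z\<in>Z. q l z * c z)))" for b
  proof -
    have "(\<Sum>x\<in>X. \<Sum>z\<in>Z. S x z * (b x * c z)) = (\<Sum>x\<in>X. \<Sum>z\<in>Z. \<Sum>l<N. \<delta> * ((p l x * b x) * (q l z * c z)))"
      by (simp add: S_def sum_distrib_left sum_distrib_right mult_ac)
    also have "\<dots> = (\<Sum>x\<in>X. \<Sum>l<N. \<Sum>z\<in>Z. \<delta> * ((p l x * b x) * (q l z * c z)))"
      by (intro sum.cong[OF refl]) (rule sum.swap)
    also have "\<dots> = (\<Sum>l<N. \<Sum>x\<in>X. \<Sum>z\<in>Z. \<delta> * ((p l x * b x) * (q l z * c z)))"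
      by (rule sum.swap)
    also have "\<dots> = (\<Sum>l<N. \<delta> * ((\<Sum>x\<in>X. p l x * b x) * (\<Sum>z\<in>Z. q l z * c z)))"
      unfolding sum_product by (simp only: sum_distrib_left)
    finally show ?thesis .
  qed
  have "(\<Sum>x\<in>X. \<Sum>z\<in>Z. S x z * (b x * c z)) - (\<Sum>x\<in>X. \<Sum>z\<in>Z. S x z * (b' x * c z))
    = (\<Sum>l<N. \<delta> * (D l * (\<Sum>z\<in>Z. q l z * c z)))"
    unfolding S sum_subtractf[symmetric]
    by (rule sum.cong) (simp_all add: D_def left_diff_distrib right_diff_distrib)
  also have "\<bar>\<dots>\<bar> \<le> (\<Sum>l<N. \<delta> * (\<delta>2 * m))"
  proof (rule order_trans[OF sum_abs sum_mono])
    fix l assume "l \<in> {..<N}"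
    then have "\<bar>D l\<bar> \<le> \<delta>2 * real (card X)" using close by (simp add: D_def)
    moreover have "\<bar>\<Sum>z\<in>Z. q l z * c z\<bar> \<le> real (card Z)"
    proof -
      have "\<bar>\<Sum>z\<in>Z. q l z * c z\<bar> \<le> (\<Sum>z\<in>Z. 1)"
        by (rule order_trans[OF sum_abs sum_mono]) (use q c in \<open>auto simp: abs_mult mult_le_one\<close>)
      then show ?thesis by simp
    qed
    ultimately have "\<bar>D l\<bar> * \<bar>\<Sum>z\<in>Z. q l z * c z\<bar> \<le> (\<delta>2 * real (card X)) * real (card Z)"
      using \<delta> by (intro mult_mono) auto
    then show "\<bar>\<delta> * (D l * (\<Sum>z\<in>Z. q l z * c z))\<bar> \<le> \<delta> * (\<delta>2 * m)"
      using \<delta> by (simp add: abs_mult m_def mult.assoc)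
  qed
  finally have "\<bar>(\<Sum>x\<in>X. \<Sum>z\<in>Z. S x z * (b x * c z)) - (\<Sum>x\<in>X. \<Sum>z\<in>Z. S x z * (b' x * c z))\<bar>
    \<le> \<delta> * N * \<delta>2 * m" by (simp add: mult_ac)
  moreover have "\<bar>\<Sum>x\<in>X. \<Sum>z\<in>Z. (A x z - S x z) * (b x * c z)\<bar> \<le> \<delta> * m"
    "\<bar>\<Sum>x\<in>X. \<Sum>z\<in>Z. (A x z - S x z) * (b' x * c z)\<bar> \<le> \<delta> * m"
    unfolding S_def m_def by (rule err, rule b) (rule err, rule b')
  ultimately have "\<bar>(\<Sum>x\<in>X. \<Sum>z\<in>Z. A x z * (b x * c z)) - (\<Sum>x\<in>X. \<Sum>z\<in>Z. A x z * (b' x * c z))\<bar>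
    \<le> \<delta> * N * \<delta>2 * m + \<delta> * m + \<delta> * m"
    unfolding split[of b] split[of b'] by linarith
  then show ?thesis unfolding m_def[symmetric] by (simp add: algebra_simps)
qed

text \<open>A matrix with entries in [0, 1] has normalised squared norm at most 1, so this many
  steps of \<open>cut_approximation\<close> suffice.\<close>

definition cell_rank :: "real \<Rightarrow> nat" where "cell_rank \<delta> = nat \<lceil>1 / \<delta>\<^sup>2\<rceil>"

text \<open>There are \<open>k * (k * cell_rank \<delta>)\<close> inner products, one for each pair
  of labels and each left factor, and each is rounded to an integer between
  \<open>- cell_rank \<delta>\<close> and \<open>cell_rank \<delta>\<close>.\<close>

definition cell_number :: "nat \<Rightarrow> real \<Rightarrow> nat" where
  "cell_number k \<delta> = (2 * cell_rank \<delta> + 1) ^ (k * (k * cell_rank \<delta>))"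

lemma floor_eq_abs_diff:
  fixes x y :: real
  shows "\<lfloor>x\<rfloor> = \<lfloor>y\<rfloor> \<Longrightarrow> \<bar>x - y\<bar> \<le> 1"
  by linarith

text \<open>The indicator of \<open>\<alpha> (z - x) = i\<close>, a matrix in \<open>x\<close> and \<open>z\<close>, is close in cut norm to one of
  bounded rank; the cell of \<open>u\<close> records the rounded inner products of its left factors with
  the translate by \<open>u\<close> of the indicator of \<open>\<beta> = j\<close>.\<close>
lemma return_cells:
  fixes P0 :: "int \<times> int" and H R :: int and \<alpha> \<beta> :: "int \<Rightarrow> nat" and C :: "nat \<Rightarrow> nat \<Rightarrow> int \<Rightarrow> real"
  assumes R: "0 \<le> R" "R \<le> H" "1 \<le> H" and \<delta>: "0 < \<delta>" "\<delta> \<le> 1"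
    and \<alpha>: "\<And>n. \<alpha> n < k" and \<beta>: "\<And>n. \<beta> n < k"
    and C: "\<And>i j n. 0 \<le> C i j n" "\<And>i j n. C i j n \<le> 1"
  defines "G \<equiv> \<lambda>d. \<Sum>p\<in>square P0 H. C (\<alpha> (snd p)) (\<beta> (fst p)) (fst p + snd p - d)"
  shows "\<exists>cell :: int \<Rightarrow> nat \<times> nat \<times> nat \<Rightarrow> int. card (cell ` {-R..R}) \<le> cell_number k \<delta> \<and>
    (\<forall>u\<in>{-R..R}. \<forall>v\<in>{-R..R}. cell u = cell v \<longrightarrow> \<bar>G (v - u) - G 0\<bar> \<le> 48 * (real k)\<^sup>2 * \<delta> * H\<^sup>2)"
proof -
  define x0 y0 where "x0 = fst P0" and "y0 = snd P0"
  \<comment> \<open>The margins \<open>R\<close> make room for translates by \<open>u\<close>. As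
    \<open>R \<le> H\<close>, the two sides are at most \<open>3 * H\<close> and
    \<open>4 * H\<close>, which gives the 12 below.\<close>
  define X where "X = {x0 - R..<x0 + H + R}"
  define Z where "Z = {x0 + y0 - R..<x0 + y0 + 2 * H + R}"
  define m where "m = real (card X) * real (card Z)"
  define N where "N = cell_rank \<delta>"
  define A where "A i x z = (of_bool (z - x \<in> {y0..<y0 + H} \<and> \<alpha> (z - x) = i) :: real)" for i x z
  define b where "b j x = (of_bool (x \<in> {x0..<x0 + H} \<and> \<beta> x = j) :: real)" for j x
  have finX: "finite X" "finite Z" by (auto simp: X_def Z_def)
  have cX: "real (card X) > 0" using R by (simp add: X_def)
  have cXH: "real (card X) \<le> 3 * H" "real (card Z) \<le> 4 * H" using R by (auto simp: X_def Z_def)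
  have m: "m \<le> 12 * H\<^sup>2"
  proof -
    have "m \<le> (3 * real_of_int H) * (4 * real_of_int H)" unfolding m_def by (intro mult_mono) (use R cXH in auto)
    then show ?thesis by (simp add: power2_eq_square)
  qed
  have inv: "1 / \<delta>\<^sup>2 \<ge> 1" using \<delta> by (simp add: power_le_one)
  have N: "1 / \<delta>\<^sup>2 \<le> real N" unfolding N_def cell_rank_def by linarith
  have N2: "real N \<le> 2 / \<delta>\<^sup>2"
  proof -
    have "real N \<le> 1 / \<delta>\<^sup>2 + 1" unfolding N_def cell_rank_def using inv by linarith
    then show ?thesis using inv by (simp add: field_simps)
  qed
  have m0: "m \<ge> 0" by (simp add: m_def)
  have "\<exists>p q. cut_approx X Z \<delta> N (A i) p q" for i
  proof (rule cut_approximation[OF finX \<delta>(1)])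
    have "(\<Sum>x\<in>X. \<Sum>z\<in>Z. (A i x z)\<^sup>2) \<le> (\<Sum>x\<in>X. \<Sum>z\<in>Z. 1)"
      by (intro sum_mono) (auto simp: A_def)
    also have "\<dots> = 1 * m" by (simp add: m_def)
    also have "\<dots> \<le> (real N * \<delta>\<^sup>2) * m"
      using N \<delta> m0 by (intro mult_right_mono) (auto simp: field_simps)
    finally show "(\<Sum>x\<in>X. \<Sum>z\<in>Z. (A i x z)\<^sup>2) \<le> real N * \<delta>\<^sup>2 * (real (card X) * real (card Z))"
      by (simp add: m_def)
  qed
  then obtain p q where pq: "\<And>i. cut_approx X Z \<delta> N (A i) (p i) (q i)" by metis
  then have p: "\<bar>p i l x\<bar> \<le> 1" for i l x by (simp add: cut_approx_def)
  define r where "r i j l u = (\<Sum>x\<in>X. p i l x * b j (x - u))" for i j l u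
  define D where "D = {..<k} \<times> {..<k} \<times> {..<N}"
  \<comment> \<open>Since \<open>N\<close> is at most \<open>2 / \<delta>\<^sup>2\<close>, rounding
    at the scale \<open>\<delta>\<^sup>2 * card X\<close> costs at most \<open>2 * \<delta>\<close>
    in \<open>cut_approximation_diff\<close>, no more than the two cut-norm errors.
    \<open>restrict\<close> puts the cells into a finite \<open>PiE\<close>, where they can be
    counted.\<close>
  define cell where "cell u = restrict (\<lambda>(i, j, l). \<lfloor>r i j l u / (\<delta>\<^sup>2 * real (card X))\<rfloor>) D" for u
  have b1: "\<bar>b j x\<bar> \<le> 1" for j x by (simp add: b_def)
  have r: "\<bar>r i j l u\<bar> \<le> real (card X)" for i j l u
  proof -
    have "\<bar>r i j l u\<bar> \<le> (\<Sum>x\<in>X. 1)"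
      unfolding r_def by (rule order_trans[OF sum_abs sum_mono]) (use p b1 in \<open>auto simp: abs_mult mult_le_one\<close>)
    then show ?thesis by simp
  qed
  have "cell ` {-R..R} \<subseteq> PiE D (\<lambda>_. {- int N..int N})"
  proof (clarsimp simp: cell_def split: prod.splits)
    fix u i j l
    have "\<bar>r i j l u / (\<delta>\<^sup>2 * real (card X))\<bar> \<le> 1 / \<delta>\<^sup>2"
      using r[of i j l u] \<delta> cX by (simp add: abs_divide abs_mult field_simps)
    then have "\<bar>r i j l u / (\<delta>\<^sup>2 * real (card X))\<bar> \<le> real N" using N by linarith
    then show "- int N \<le> \<lfloor>r i j l u / (\<delta>\<^sup>2 * real (card X))\<rfloor> \<and> \<lfloor>r i j l u / (\<delta>\<^sup>2 * real (card X))\<rfloor> \<le> int N"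
      by linarith
  qed
  then have "card (cell ` {-R..R}) \<le> card (PiE D (\<lambda>_. {- int N..int N}))"
    by (intro card_mono finite_PiE) (auto simp: D_def)
  also have "\<dots> = cell_number k \<delta>"
    by (simp add: card_PiE D_def cell_number_def N_def nat_add_distrib nat_mult_distrib)
  finally have card: "card (cell ` {-R..R}) \<le> cell_number k \<delta>" .
  \<comment> \<open>The substitution \<open>x = fst p + u\<close>,
    \<open>z = fst p + snd p + u\<close> separates the variables: \<open>\<alpha>\<close> is taken
    at \<open>z - x\<close>, \<open>\<beta>\<close> at \<open>x - u\<close>, and
    \<open>fst p + snd p - (v - u)\<close> is \<open>z - v\<close>. So \<open>u\<close> enters
    through \<open>b\<close> alone and \<open>v\<close> through \<open>C\<close> alone, and
    \<open>G 0\<close> is \<open>J v v\<close>.\<close>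
  define J where "J u v = (\<Sum>i<k. \<Sum>j<k. \<Sum>x\<in>X. \<Sum>z\<in>Z. A i x z * (b j (x - u) * C i j (z - v)))" for u v
  have GJ: "G (v - u) = J u v" if u: "u \<in> {-R..R}" for u v
  proof -
    have "J u v = (\<Sum>x\<in>X. \<Sum>z\<in>Z. \<Sum>i<k. \<Sum>j<k. A i x z * (b j (x - u) * C i j (z - v)))"
    proof -
      have "J u v = (\<Sum>i<k. \<Sum>x\<in>X. \<Sum>j<k. \<Sum>z\<in>Z. A i x z * (b j (x - u) * C i j (z - v)))"
        unfolding J_def by (intro sum.cong[OF refl]) (rule sum.swap)
      also have "\<dots> = (\<Sum>i<k. \<Sum>x\<in>X. \<Sum>z\<in>Z. \<Sum>j<k. A i x z * (b j (x - u) * C i j (z - v)))"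
        by (intro sum.cong[OF refl]) (rule sum.swap)
      also have "\<dots> = (\<Sum>x\<in>X. \<Sum>i<k. \<Sum>z\<in>Z. \<Sum>j<k. A i x z * (b j (x - u) * C i j (z - v)))"
        by (rule sum.swap)
      also have "\<dots> = (\<Sum>x\<in>X. \<Sum>z\<in>Z. \<Sum>i<k. \<Sum>j<k. A i x z * (b j (x - u) * C i j (z - v)))"
        by (intro sum.cong[OF refl]) (rule sum.swap)
      finally show ?thesis .
    qed
    also have "\<dots> = (\<Sum>x\<in>X. \<Sum>z\<in>Z. if z - x \<in> {y0..<y0 + H} \<and> x - u \<in> {x0..<x0 + H}
        then C (\<alpha> (z - x)) (\<beta> (x - u)) (z - v) else 0)"
    proof (intro sum.cong[OF refl])
      fix x z
      have "(\<Sum>i<k. \<Sum>j<k. A i x z * (b j (x - u) * C i j (z - v)))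
        = (\<Sum>i<k. \<Sum>j<k. if j = \<beta> (x - u) then if i = \<alpha> (z - x) then if z - x \<in> {y0..<y0 + H} \<and> x - u \<in> {x0..<x0 + H}
          then C i j (z - v) else 0 else 0 else 0)"
        by (intro sum.cong[OF refl]) (auto simp: A_def b_def)
      then show "(\<Sum>i<k. \<Sum>j<k. A i x z * (b j (x - u) * C i j (z - v))) = (if z - x \<in> {y0..<y0 + H} \<and> x - u \<in> {x0..<x0 + H}
        then C (\<alpha> (z - x)) (\<beta> (x - u)) (z - v) else 0)"
        using \<alpha> \<beta> by (simp add: sum.delta)
    qed
    also have "\<dots> = (\<Sum>w\<in>X \<times> Z. if snd w - fst w \<in> {y0..<y0 + H} \<and> fst w - u \<in> {x0..<x0 + H}
        then C (\<alpha> (snd w - fst w)) (\<beta> (fst w - u)) (snd w - v) else 0)"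
      by (simp add: sum_Times cong: if_cong)
    also have "\<dots> = (\<Sum>w\<in>{w\<in>X \<times> Z. snd w - fst w \<in> {y0..<y0 + H} \<and> fst w - u \<in> {x0..<x0 + H}}.
        C (\<alpha> (snd w - fst w)) (\<beta> (fst w - u)) (snd w - v))"
      using finX by (intro sum.inter_filter[symmetric]) auto
    also have "\<dots> = (\<Sum>p\<in>square P0 H. C (\<alpha> (snd p)) (\<beta> (fst p)) (fst p + snd p - (v - u)))"
      by (rule sum.reindex_bij_witness[where i = "\<lambda>p. (fst p + u, fst p + snd p + u)"
            and j = "\<lambda>w. (fst w - u, snd w - fst w)"])
        (use u in \<open>auto simp: mem_square X_def Z_def x0_def y0_def algebra_simps\<close>)
    finally show ?thesis by (simp add: G_def)
  qed
  have "\<bar>G (v - u) - G 0\<bar> \<le> 48 * (real k)\<^sup>2 * \<delta> * H\<^sup>2"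
    if u: "u \<in> {-R..R}" and v: "v \<in> {-R..R}" and eq: "cell u = cell v" for u v
  proof -
    have one: "\<bar>(\<Sum>x\<in>X. \<Sum>z\<in>Z. A i x z * (b j (x - u) * C i j (z - v)))
        - (\<Sum>x\<in>X. \<Sum>z\<in>Z. A i x z * (b j (x - v) * C i j (z - v)))\<bar> \<le> 48 * \<delta> * H\<^sup>2"
      if ij: "i < k" "j < k" for i j
    proof -
      have close: "\<bar>(\<Sum>x\<in>X. p i l x * b j (x - u)) - (\<Sum>x\<in>X. p i l x * b j (x - v))\<bar> \<le> \<delta>\<^sup>2 * real (card X)"
        if "l < N" for l
      proof -
        have "(i, j, l) \<in> D" using ij that by (simp add: D_def)
        then have "\<lfloor>r i j l u / (\<delta>\<^sup>2 * real (card X))\<rfloor> = \<lfloor>r i j l v / (\<delta>\<^sup>2 * real (card X))\<rfloor>"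
          using fun_cong[OF eq, of "(i, j, l)"] by (simp add: cell_def)
        then have "\<bar>r i j l u / (\<delta>\<^sup>2 * real (card X)) - r i j l v / (\<delta>\<^sup>2 * real (card X))\<bar> \<le> 1"
          by (rule floor_eq_abs_diff)
        then have "\<bar>r i j l u - r i j l v\<bar> / (\<delta>\<^sup>2 * real (card X)) \<le> 1"
          unfolding diff_divide_distrib[symmetric] abs_divide using cX \<delta> by simp
        then show ?thesis using cX \<delta> by (simp add: r_def field_simps)
      qed
      have "\<bar>(\<Sum>x\<in>X. \<Sum>z\<in>Z. A i x z * (b j (x - u) * C i j (z - v)))
        - (\<Sum>x\<in>X. \<Sum>z\<in>Z. A i x z * (b j (x - v) * C i j (z - v)))\<bar>
        \<le> (2 * \<delta> + \<delta> * N * \<delta>\<^sup>2) * (real (card X) * real (card Z))"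
        by (rule cut_approximation_diff[OF _ _ pq])
          (use \<delta> b1 C close in auto)
      also have "\<dots> \<le> (4 * \<delta>) * (12 * H\<^sup>2)"
      proof (rule mult_mono)
        have "\<delta> * (real N * \<delta>\<^sup>2) \<le> \<delta> * 2" using N2 \<delta> by (intro mult_left_mono) (auto simp: field_simps)
        then show "2 * \<delta> + \<delta> * N * \<delta>\<^sup>2 \<le> 4 * \<delta>" by (simp add: mult.assoc)
      qed (use m m0 \<delta> in \<open>auto simp: m_def\<close>)
      finally show ?thesis by simp
    qed
    have "G (v - u) - G 0 = J u v - J v v" using GJ[OF u, of v] GJ[OF v, of v] by simp
    also have "\<dots> = (\<Sum>i<k. \<Sum>j<k. (\<Sum>x\<in>X. \<Sum>z\<in>Z. A i x z * (b j (x - u) * C i j (z - v)))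
        - (\<Sum>x\<in>X. \<Sum>z\<in>Z. A i x z * (b j (x - v) * C i j (z - v))))"
      by (simp add: J_def sum_subtractf)
    also have "\<bar>\<dots>\<bar> \<le> (\<Sum>i<k. \<Sum>j<k. 48 * \<delta> * H\<^sup>2)"
      by (intro order_trans[OF sum_abs] sum_mono one) auto
    also have "\<dots> = 48 * (real k)\<^sup>2 * \<delta> * H\<^sup>2" by (simp add: power2_eq_square)
    finally show ?thesis .
  qed
  then show ?thesis using card by (intro exI[of _ cell]) auto
qed

subsection \<open>Selection lemmas\<close>

text \<open>\<open>W i j\<close> counts the pairs from two blocks that share a cell. By
  Cauchy-Schwarz all \<open>W i j\<close> together amount to at least
  \<open>(r * l)\<^sup>2 / M\<close>, while the diagonal gives at most \<open>r * l\<^sup>2\<close>.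
  If every other term were below \<open>l\<^sup>2 / (2 * M)\<close>, this would force
  \<open>r \<le> 2 * M\<close>.\<close>

lemma close_pairs:
  fixes cell :: "int \<Rightarrow> 'c" and s :: "nat \<Rightarrow> int" and l R :: int and r M :: nat
  defines "S \<equiv> \<lambda>i. {s i..<s i + l}"
  defines "W \<equiv> \<lambda>i j. \<Sum>m\<in>cell ` {-R..R}. \<Sum>u\<in>S i. \<Sum>v\<in>S j. of_bool (cell u = m) * of_bool (cell v = m) :: real"
  assumes l: "1 \<le> l" and M: "1 \<le> M" "4 * M \<le> r" "card (cell ` {-R..R}) \<le> M"
    and S: "\<And>i. i < r \<Longrightarrow> S i \<subseteq> {-R..R}"
  shows "\<exists>i j. i < j \<and> j < r \<and> l\<^sup>2 / (2 * M) \<le> W i j"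
proof (rule ccontr)
  assume neg: "\<not> ?thesis"
  define C where "C = cell ` {-R..R}"
  define n where "n i m = (\<Sum>u\<in>S i. of_bool (cell u = m) :: real)" for i m
  have W: "W i j = (\<Sum>m\<in>C. n i m * n j m)" for i j
    by (simp add: W_def C_def n_def sum_product)
  have sym: "W i j = W j i" for i j unfolding W by (simp add: mult.commute)
  have small: "W i j \<le> l\<^sup>2 / (2 * M)" if "i < r" "j < r" "i \<noteq> j" for i j
  proof (cases "i < j")
    case True
    then show ?thesis using neg that by (metis linear)
  next
    case False
    then have "j < i" using that by simp
    then show ?thesis using neg that sym[of i j] by (metis linear)
  qed
  have sum_n: "(\<Sum>m\<in>C. n i m) = l" if "i < r" for i
  proof -
    have "(\<Sum>m\<in>C. n i m) = (\<Sum>u\<in>S i. \<Sum>m\<in>C. of_bool (cell u = m))"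
      unfolding n_def by (rule sum.swap)
    also have "\<dots> = (\<Sum>u\<in>S i. 1)"
    proof (rule sum.cong[OF refl])
      fix u assume "u \<in> S i"
      then have "cell u \<in> C" "finite C" using S[OF that] by (auto simp: C_def)
      then show "(\<Sum>m\<in>C. of_bool (cell u = m)) = (1 :: real)" by (simp add: of_bool_def)
    qed
    also have "\<dots> = l" using l by (simp add: S_def)
    finally show ?thesis .
  qed
  have diag: "W i i \<le> l\<^sup>2" if "i < r" for i
  proof -
    have nn: "0 \<le> n i m" for m by (simp add: n_def sum_nonneg)
    have "n i m \<le> l" if "m \<in> C" for m
      using sum_n[OF \<open>i < r\<close>] member_le_sum[of m C "n i"] that nn by (auto simp: C_def)
    then have "W i i \<le> (\<Sum>m\<in>C. l * n i m)"
      unfolding W by (intro sum_mono mult_right_mono nn) auto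
    also have "\<dots> = l\<^sup>2" by (simp add: sum_distrib_left[symmetric] sum_n[OF that] power2_eq_square)
    finally show ?thesis .
  qed
  have r: "real r \<ge> 4 * real M" using M(2) by linarith
  have l2: "real_of_int (l\<^sup>2) > 0" using l by simp
  have "(r * l)\<^sup>2 = (\<Sum>m\<in>C. \<Sum>i<r. n i m)\<^sup>2"
    by (subst sum.swap) (simp add: sum_n)
  also have "\<dots> \<le> (\<Sum>m\<in>C. (\<Sum>i<r. n i m)\<^sup>2) * real (card C)"
    by (rule sum_squared_le_sum_of_squares)
  also have "\<dots> \<le> (\<Sum>m\<in>C. (\<Sum>i<r. n i m)\<^sup>2) * M"
    using M by (intro mult_left_mono sum_nonneg) (auto simp: C_def)
  also have "(\<Sum>m\<in>C. (\<Sum>i<r. n i m)\<^sup>2) = (\<Sum>i<r. \<Sum>j<r. W i j)"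
  proof -
    have "(\<Sum>m\<in>C. (\<Sum>i<r. n i m)\<^sup>2) = (\<Sum>m\<in>C. \<Sum>i<r. \<Sum>j<r. n i m * n j m)"
      by (simp add: power2_eq_square sum_product)
    also have "\<dots> = (\<Sum>i<r. \<Sum>m\<in>C. \<Sum>j<r. n i m * n j m)" by (rule sum.swap)
    also have "\<dots> = (\<Sum>i<r. \<Sum>j<r. W i j)"
      unfolding W by (intro sum.cong[OF refl]) (rule sum.swap)
    finally show ?thesis .
  qed
  also have "\<dots> \<le> (\<Sum>i<r. \<Sum>j<r. l\<^sup>2 / (2 * M) + (if j = i then real_of_int (l\<^sup>2) else 0))"
  proof (intro sum_mono)
    fix i j assume "i \<in> {..<r}" "j \<in> {..<r}"
    then have ij: "i < r" "j < r" by auto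
    have "0 \<le> real_of_int (l\<^sup>2) / (2 * real M)" by simp
    then show "W i j \<le> l\<^sup>2 / (2 * M) + (if j = i then real_of_int (l\<^sup>2) else 0)"
      using small[OF ij] diag[OF ij(1)] by (cases "i = j") (simp_all add: add_increasing)
  qed
  also have "\<dots> = r * r * (l\<^sup>2 / (2 * M)) + r * l\<^sup>2"
    by (simp add: sum.distrib algebra_simps)
  finally have "(r * l)\<^sup>2 \<le> (r * r * (l\<^sup>2 / (2 * M)) + r * l\<^sup>2) * M"
    using M by (simp add: mult_right_mono)
  also have "\<dots> = l\<^sup>2 * (real r * real r / 2 + real r * M)" using M by (simp add: field_simps)
  finally have "l\<^sup>2 * (real r * real r) \<le> l\<^sup>2 * (real r * real r / 2 + real r * M)"
    by (simp add: power2_eq_square mult_ac)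
  then have "real r * real r \<le> real r * real r / 2 + real r * M"
    using l2 by (simp only: mult_le_cancel_left_pos)
  then have "real r * (real r - 2 * M) \<le> 0" by (simp add: algebra_simps)
  moreover have "real r * (real r - 2 * M) > 0" using r M by (intro mult_pos_pos) auto
  ultimately show False by simp
qed

lemma small_increment:
  fixes a :: "nat \<Rightarrow> real" and c :: "nat \<Rightarrow> nat"
  assumes "\<And>n. 0 \<le> a n \<and> a n \<le> 3" "3 < real N * \<kappa>"
  shows "\<exists>n<N. a (c (Suc n)) - a (c n) \<le> \<kappa>"
proof (rule ccontr)
  assume "\<not> ?thesis"
  then have "(\<Sum>n<N. \<kappa>) \<le> (\<Sum>n<N. a (c (Suc n)) - a (c n))" by (intro sum_mono) force
  also have "\<dots> = a (c N) - a (c 0)" by (rule sum_lessThan_telescope)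
  also have "\<dots> \<le> 3" using assms(1)[of "c N"] assms(1)[of "c 0"] by linarith
  finally show False using assms(2) by simp
qed

text \<open>Index \<open>i\<close> stands for the coarse labelling and \<open>j\<close> for the fine one; the uniformity \<open>\<kappa>1 i\<close> of the
  fine labelling has to beat the number of cells, which depends on \<open>i\<close>.\<close>
lemma metastable:
  fixes \<kappa>0 :: real and \<kappa>1 :: "nat \<Rightarrow> real"
  assumes "\<kappa>0 > 0" "\<And>i. \<kappa>1 i > 0"
  shows "\<exists>T. \<forall>a. mono a \<longrightarrow> (\<forall>n. 0 \<le> a n \<and> a n \<le> 3) \<longrightarrow>
    (\<exists>i j. i + j + 1 \<le> T \<and> a (i + j) - a i \<le> \<kappa>0 \<and> a (i + j + 1) - a j \<le> \<kappa>1 i)"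
proof -
  define N1 where "N1 i = nat \<lceil>3 / \<kappa>1 i\<rceil> + 1" for i
  define N0 where "N0 = nat \<lceil>3 / \<kappa>0\<rceil> + 1"
  have big: "3 < real (nat \<lceil>3 / x\<rceil> + 1) * x" if "x > 0" for x :: real
  proof -
    have "3 / x < real (nat \<lceil>3 / x\<rceil> + 1)" by linarith
    then show ?thesis using that by (simp add: field_simps)
  qed
  \<comment> \<open>Bounds \<open>i + j + 1\<close> for given \<open>i\<close>: \<open>j\<close>
    runs through multiples of \<open>i + 1\<close> until the increment is small. Indices are
    exponents of 2, so \<open>i + j\<close> belongs to the join of the two labellings and the extra
    1 to the doubling in \<open>energy_increment\<close>. The coarse increment is tested along the
    iterates of \<open>g\<close>.\<close>
  define g where "g i = N1 i * (i + 1)" for i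
  define b where "b t = (g ^^ t) 0" for t
  have "\<exists>i j. i + j + 1 \<le> (\<Sum>t\<le>N0. b t) \<and> a (i + j) - a i \<le> \<kappa>0 \<and> a (i + j + 1) - a j \<le> \<kappa>1 i"
    if a: "mono a" "\<And>n. 0 \<le> a n \<and> a n \<le> 3" for a :: "nat \<Rightarrow> real"
  proof -
    obtain t where t: "t < N0" "a (b (Suc t)) - a (b t) \<le> \<kappa>0"
      using small_increment[of a N0 \<kappa>0 b] a(2) big[OF assms(1)] unfolding N0_def by blast
    define i where "i = b t"
    obtain n where n: "n < N1 i" "a (Suc n * (i + 1)) - a (n * (i + 1)) \<le> \<kappa>1 i"
      using small_increment[of a "N1 i" "\<kappa>1 i" "\<lambda>n. n * (i + 1)"] a(2) big[OF assms(2)] unfolding N1_def by blast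
    define j where "j = n * (i + 1)"
    have ij: "i + j + 1 = Suc n * (i + 1)" by (simp add: j_def)
    also have "\<dots> \<le> g i" unfolding g_def using n(1) by (intro mult_le_mono1) simp
    finally have le: "i + j + 1 \<le> b (Suc t)" by (simp add: b_def i_def)
    moreover have "b (Suc t) \<le> (\<Sum>t\<le>N0. b t)" using t(1) by (intro member_le_sum) auto
    moreover have "a (i + j) \<le> a (b (Suc t))" using a(1) le by (simp add: mono_def)
    ultimately show ?thesis
      using t(2) n(2) unfolding ij[symmetric] j_def[symmetric] i_def[symmetric] by (intro exI[of _ i] exI[of _ j]) auto
  qed
  then show ?thesis by blast
qed

text \<open>From some side on, \<open>\<Phi>\<close> exceeds its limit superior by less than
  \<open>\<kappa> / 2\<close>, and at arbitrarily large sides it comes within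
  \<open>\<kappa> / 2\<close> from below. As \<open>l\<close> is fixed before \<open>L\<close>, the
  square may be large in terms of data constructed from \<open>l\<close>.\<close>

lemma near_maximal:
  fixes \<Phi> :: "'a \<Rightarrow> int \<Rightarrow> real"
  assumes bd: "\<And>P H. 0 \<le> \<Phi> P H" "\<And>P H. \<Phi> P H \<le> B" and "\<kappa> > 0"
  shows "\<exists>l\<ge>1. \<forall>L. \<exists>H\<ge>L. \<exists>P. \<forall>H'\<ge>l. \<forall>P'. \<Phi> P' H' \<le> \<Phi> P H + \<kappa>"
proof -
  define A where "A L = {\<Phi> P H | P H. H \<ge> L}" for L
  have ne: "A L \<noteq> {}" for L by (auto simp: A_def)
  have bdA: "bdd_above (A L)" for L by (rule bdd_aboveI[of _ B]) (use bd in \<open>auto simp: A_def\<close>)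
  have bdS: "bdd_below (range (\<lambda>L. Sup (A L)))"
  proof (rule bdd_belowI[of _ 0], clarify)
    fix L
    obtain x where x: "x \<in> A L" using ne by blast
    then have "0 \<le> x" using bd by (auto simp: A_def)
    also have "x \<le> Sup (A L)" by (rule cSup_upper[OF x bdA])
    finally show "0 \<le> Sup (A L)" .
  qed
  define I where "I = (INF L. Sup (A L))"
  have "\<exists>x\<in>range (\<lambda>L. Sup (A L)). x < I + \<kappa> / 2"
    by (rule cInf_lessD) (use assms(3) in \<open>auto simp: I_def\<close>)
  then obtain l0 where l0: "Sup (A l0) < I + \<kappa> / 2" by auto
  have up: "\<Phi> P' H' < I + \<kappa> / 2" if "H' \<ge> max 1 l0" for P' H'
  proof -
    have "\<Phi> P' H' \<in> A l0" using that by (auto simp: A_def)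
    then have "\<Phi> P' H' \<le> Sup (A l0)" by (rule cSup_upper) (rule bdA)
    then show ?thesis using l0 by linarith
  qed
  have "\<exists>H\<ge>L. \<exists>P. \<forall>H'\<ge>max 1 l0. \<forall>P'. \<Phi> P' H' \<le> \<Phi> P H + \<kappa>" for L
  proof -
    have "I \<le> Sup (A L)" unfolding I_def by (rule cINF_lower[OF bdS]) simp
    then have "\<exists>x\<in>A L. I - \<kappa> / 2 < x"
      by (intro less_cSupD ne) (use assms(3) in linarith)
    then obtain P H where PH: "H \<ge> L" "I - \<kappa> / 2 < \<Phi> P H" by (auto simp: A_def)
    have "\<Phi> P' H' \<le> \<Phi> P H + \<kappa>" if "H' \<ge> max 1 l0" for P' H'
      using up[OF that, of P'] PH(2) by linarith
    then show ?thesis using PH(1) by blast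
  qed
  then show ?thesis by (intro exI[of _ "max 1 l0"]) auto
qed

text \<open>The complement of a set that is not syndetic contains arbitrarily long intervals. The
  new block is placed so that its differences with all earlier blocks, which fit into fewer than
  \<open>2 * K + 2 * l\<close> consecutive integers, fall into one such interval.\<close>

lemma thick_blocks:
  assumes "\<not> syndetic F" and l: "1 \<le> l"
  shows "\<exists>s :: nat \<Rightarrow> int. \<forall>j<r. \<forall>i<j. \<forall>u\<in>{s i..<s i + l}. \<forall>v\<in>{s j..<s j + l}. v - u \<notin> F"
proof (induction r)
  case (Suc r)
  then obtain s where s: "\<And>i j u v. j < r \<Longrightarrow> i < j \<Longrightarrow> u \<in> {s i..<s i + l} \<Longrightarrow> v \<in> {s j..<s j + l} \<Longrightarrow> v - u \<notin> F"
    by blast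
  define K where "K = (\<Sum>i<r. \<bar>s i\<bar>)"
  have K: "\<bar>s i\<bar> \<le> K" if "i < r" for i
    unfolding K_def using that by (intro member_le_sum) auto
  have "0 \<le> K" by (simp add: K_def sum_nonneg)
  then have "2 * K + 2 * l + 1 > 0" using l by linarith
  then obtain c where c: "F \<inter> {c..<c + (2 * K + 2 * l + 1)} = {}"
    using assms(1) unfolding syndetic_def by blast
  define s' where "s' = s(r := c + K + l)"
  have "v - u \<notin> F" if ij: "j < Suc r" "i < j" and uv: "u \<in> {s' i..<s' i + l}" "v \<in> {s' j..<s' j + l}" for i j u v
  proof (cases "j < r")
    case True
    then show ?thesis using s[of j i u v] ij uv by (simp add: s'_def)
  next
    case False
    then have "j = r" "i < r" using ij by auto
    then have "v - u \<in> {c..<c + (2 * K + 2 * l + 1)}" using uv K[of i] by (auto simp: s'_def)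
    then show ?thesis using c by blast
  qed
  then show ?case by blast
qed simp

subsection \<open>Densities of squares\<close>

lemma box_density_square:
  assumes "1 \<le> H"
  shows "box_density E (fst P, fst P + H, snd P, snd P + H) = mean (square P H) (indicator E)"
proof -
  have "real (card (E \<inter> square P H)) = (\<Sum>p\<in>square P H. indicator E p)"
    by (simp add: indicator_def sum.If_cases Int_def conj_commute)
  then show ?thesis
    using assms card_square[of H P] by (simp add: box_density_def mean_def square_def power2_eq_square)
qed

lemma mean_square_less:
  assumes "upper_Banach_density E < c"
  shows "\<exists>L. \<forall>H\<ge>L. \<forall>P. mean (square P H) (indicator E) < c"
proof -
  have "Limsup large_boxes (\<lambda>b. ereal (box_density E b)) < ereal c"
    using assms unfolding ereal_upper_Banach_density[symmetric] by simp
  then have "eventually (\<lambda>b. ereal (box_density E b) < ereal c) large_boxes" by (rule Limsup_lessD)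
  then obtain L where L: "\<And>M1 N1 M2 N2. N1 - M1 \<ge> L \<Longrightarrow> N2 - M2 \<ge> L \<Longrightarrow> box_density E (M1, N1, M2, N2) < c"
    unfolding eventually_large_boxes less_ereal.simps by blast
  have "mean (square P H) (indicator E) < c" if "H \<ge> max 1 L" for H P
    using L[where ?M1.0 = "fst P" and ?N1.0 = "fst P + H" and ?M2.0 = "snd P" and ?N2.0 = "snd P + H"] that
      box_density_square[of H E P] by auto
  then show ?thesis by blast
qed

text \<open>The density is defined by rectangles of any shape. If all squares of one side had
  density at most \<alpha> - \<eta>, averaging over windows would bound the density of every box
  with long sides by \<alpha> - \<eta>/2, against the limit superior.\<close>

lemma dense_square:
  assumes \<eta>: "\<eta> > 0"
  shows "\<exists>H\<ge>L. \<exists>P. upper_Banach_density E - \<eta> < mean (square P H) (indicator E)"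
proof -
  define \<alpha> where "\<alpha> = upper_Banach_density E"
  define l where "l = max 1 L"
  have l: "1 \<le> l" "L \<le> l" by (auto simp: l_def)
  have "\<exists>P. \<alpha> - \<eta> < mean (square P l) (indicator E)"
  proof (rule ccontr)
    assume "\<not> ?thesis"
    then have neg: "mean (square P l) (indicator E) \<le> \<alpha> - \<eta>" for P by (metis not_less)
    have "0 \<le> mean (square 0 l) (indicator E)" by (rule mean_nonneg) simp
    then have nn: "0 \<le> \<alpha> - \<eta>" using neg[of 0] by linarith
    have win: "(\<Sum>p\<in>square P l. indicat_real E p) \<le> l\<^sup>2 * (\<alpha> - \<eta>)" for P
    proof -
      have "real (card (square P l)) = l\<^sup>2" using l card_square[of l P] by simp
      then show ?thesis using neg[of P] l by (simp add: mean_def field_simps)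
    qed
    \<comment> \<open>Each of the two directions then contributes a boundary share of at most
      \<eta>/8.\<close>
    define K where "K = max (l + 1) \<lceil>8 * real_of_int l / \<eta>\<rceil>"
    have "box_density E (M1, N1, M2, N2) \<le> \<alpha> - \<eta> / 2" if "N1 - M1 \<ge> K" "N2 - M2 \<ge> K" for M1 N1 M2 N2
    proof -
      define A B where "A = N1 - M1" and "B = N2 - M2"
      define Q where "Q = {M1..<M1 + A} \<times> {M2..<M2 + B}"
      define V where "V = {M1..<M1 + (A - l + 1)} \<times> {M2..<M2 + (B - l + 1)}"
      define a b :: real where "a = A" and "b = B"
      have AB: "l < A" "l < B" using that by (auto simp: A_def B_def K_def)
      have "8 * real_of_int l / \<eta> \<le> a" "8 * real_of_int l / \<eta> \<le> b"
        using that unfolding A_def B_def K_def a_def b_def by linarith+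
      then have lab: "8 * l \<le> a * \<eta>" "8 * l \<le> b * \<eta>" using \<eta> by (auto simp: field_simps)
      have pos: "a > 0" "b > 0" using AB l by (auto simp: a_def b_def)
      have "\<bar>(\<Sum>P\<in>V. \<Sum>p\<in>square P l. indicat_real E p) - l\<^sup>2 * (\<Sum>p\<in>Q. indicat_real E p)\<bar>
        \<le> l\<^sup>2 * ((1::real) * (A * B - (A - l + 1) * (B - l + 1)))"
        unfolding V_def Q_def by (rule sum_windows[where g = "indicat_real E"]) (use l AB in \<open>auto simp: indicator_def\<close>)
      then have "l\<^sup>2 * (\<Sum>p\<in>Q. indicat_real E p) \<le> (\<Sum>P\<in>V. \<Sum>p\<in>square P l. indicat_real E p)
          + l\<^sup>2 * (A * B - (A - l + 1) * (B - l + 1))" by (simp add: abs_le_iff)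
      also have "(\<Sum>P\<in>V. \<Sum>p\<in>square P l. indicat_real E p) \<le> (\<Sum>P\<in>V. l\<^sup>2 * (\<alpha> - \<eta>))"
        by (rule sum_mono) (rule win)
      also have "\<dots> = l\<^sup>2 * (((A - l + 1) * (B - l + 1)) * (\<alpha> - \<eta>))"
        using AB by (simp add: V_def card_cartesian_product)
      also have "\<dots> \<le> l\<^sup>2 * ((a * b) * (\<alpha> - \<eta>))"
      proof (intro mult_left_mono mult_right_mono nn)
        have "(A - l + 1) * (B - l + 1) \<le> A * B" using AB l by (intro mult_mono) auto
        then show "real_of_int ((A - l + 1) * (B - l + 1)) \<le> a * b"
          unfolding a_def b_def of_int_mult[symmetric] of_int_le_iff .
      qed simp
      finally have "l\<^sup>2 * (\<Sum>p\<in>Q. indicat_real E p)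
        \<le> l\<^sup>2 * ((a * b) * (\<alpha> - \<eta>) + (A * B - (A - l + 1) * (B - l + 1)))"
        by (simp add: algebra_simps)
      then have "(\<Sum>p\<in>Q. indicat_real E p) \<le> (a * b) * (\<alpha> - \<eta>) + (A * B - (A - l + 1) * (B - l + 1))"
        using l by (simp only: mult_le_cancel_left_pos of_int_0_less_iff zero_less_power2)
      also have "real_of_int (A * B - (A - l + 1) * (B - l + 1)) \<le> l * a + l * b"
      proof -
        have "A * B - (A - l + 1) * (B - l + 1) = (l - 1) * A + (l - 1) * B - (l - 1) * (l - 1)"
          by (simp add: algebra_simps)
        also have "\<dots> \<le> l * A + l * B - 0" using l AB by (intro diff_mono add_mono mult_right_mono) auto
        finally have "real_of_int (A * B - (A - l + 1) * (B - l + 1)) \<le> real_of_int (l * A + l * B)"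
          unfolding of_int_le_iff by simp
        then show ?thesis by (simp add: a_def b_def)
      qed
      also have "l * a + l * b \<le> (a * b) * (\<eta> / 4)"
      proof -
        have "8 * (l * b) \<le> a * b * \<eta>" "8 * (l * a) \<le> a * b * \<eta>"
          using mult_right_mono[OF lab(1), of b] mult_right_mono[OF lab(2), of a] pos by (simp_all add: mult_ac)
        then show ?thesis by simp
      qed
      finally have "(\<Sum>p\<in>Q. indicat_real E p) \<le> (a * b) * (\<alpha> - \<eta> / 2)"
        using mult_pos_pos[OF mult_pos_pos[OF pos] \<eta>] by (simp add: algebra_simps)
      moreover have "(\<Sum>p\<in>Q. indicat_real E p) = real (card (E \<inter> Q))"
        by (simp add: indicator_def sum.If_cases Int_def conj_commute Q_def)
      ultimately show ?thesis
        using pos by (simp add: box_density_def Q_def A_def B_def a_def b_def divide_le_eq mult.commute)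
    qed
    then have "eventually (\<lambda>b. box_density E b \<le> \<alpha> - \<eta> / 2) large_boxes"
      unfolding eventually_large_boxes by blast
    then have "eventually (\<lambda>b. ereal (box_density E b) \<le> ereal (\<alpha> - \<eta> / 2)) large_boxes" by simp
    then have "Limsup large_boxes (\<lambda>b. ereal (box_density E b)) \<le> ereal (\<alpha> - \<eta> / 2)"
      by (rule Limsup_bounded)
    then have "\<alpha> \<le> \<alpha> - \<eta> / 2"
      unfolding ereal_upper_Banach_density[symmetric] \<alpha>_def by simp
    then show False using \<eta> by simp
  qed
  then show ?thesis using l unfolding \<alpha>_def by blast
qed

subsection \<open>Estimates on a single square\<close>

text \<open>For each labelling the averages over the large square are competitors in
  \<open>sum_variational_le\<close> on every window, with the same labelling; the supremum is taken
  at the end.\<close>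

lemma window_energy_lower:
  fixes H l :: int
  assumes f01: "\<And>p. 0 \<le> f p" "\<And>p. f p \<le> 1" and l: "1 \<le> l" "l \<le> H" and k: "1 \<le> k"
  shows "(H - l + 1)\<^sup>2 * energy f k (square P0 H)
    \<le> (\<Sum>P\<in>square P0 (H - l + 1). energy f k (square P l)) + 3 * (H\<^sup>2 - (H - l + 1)\<^sup>2)"
proof -
  define n where "n = H - l + 1"
  have n: "real_of_int (n\<^sup>2) > 0" using l by (simp add: n_def)
  define r where "r = (\<Sum>P\<in>square P0 n. energy f k (square P l)) + 3 * (H\<^sup>2 - n\<^sup>2)"
  have "energy f k (square P0 H) \<le> r / n\<^sup>2"
    unfolding energy_def[of f k "square P0 H"]
  proof (rule cSup_least)
    show "label_energy f (square P0 H) ` Collect (labelling k) \<noteq> {}" using labelling_0[OF k] by blast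
    fix e assume "e \<in> label_energy f (square P0 H) ` Collect (labelling k)"
    then obtain \<Lambda> where \<Lambda>: "labelling k \<Lambda>" and e: "e = label_energy f (square P0 H) \<Lambda>" by auto
    define h where "h c p = cell_mean f (square P0 H) (key \<Lambda> c) p" for c p
    have "mean (square P l) (\<lambda>p. \<Sum>c<3. 2 * f p * h c p - (h c p)\<^sup>2) \<le> energy f k (square P l)" for P
    proof -
      have "mean (square P l) (\<lambda>p. \<Sum>c<3. 2 * f p * h c p - (h c p)\<^sup>2) \<le> label_energy f (square P l) \<Lambda>"
        unfolding mean_sum label_energy_def mean_def
        by (intro sum_mono divide_right_mono sum_variational_le) (auto simp: h_def intro: cell_mean_cong_key)
      also have "\<dots> \<le> energy f k (square P l)" by (rule energy_ge[OF f01 \<Lambda>])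
      finally show ?thesis .
    qed
    then have "n\<^sup>2 * e \<le> r"
      using label_energy_le_windows[of f l H P0 \<Lambda>, OF f01 l] unfolding e r_def n_def h_def[symmetric]
      by (smt (verit, best) sum_mono)
    then show "e \<le> r / n\<^sup>2" using n by (simp add: field_simps)
  qed
  then show ?thesis using n unfolding r_def n_def by (simp add: field_simps)
qed

text \<open>Summing the maximality assumption over the windows bounds density and energies together.
  Density and each energy average to at least their values on the large square, up to boundary
  terms; subtracting these lower bounds for the density and every \<open>t \<noteq> t0\<close>
  isolates \<open>t0\<close>.\<close>

lemma window_energy_le:
  fixes H l :: int and f :: "int \<times> int \<Rightarrow> real" and \<nu> \<kappa> \<rho> :: real
  assumes f01: "\<And>p. 0 \<le> f p" "\<And>p. f p \<le> 1" and l: "1 \<le> l" "l \<le> H" and \<nu>: "0 \<le> \<nu>"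
    and max: "\<And>P. \<nu> * mean (square P l) f + (\<Sum>t\<le>T. energy f (2 ^ t) (square P l))
      \<le> \<nu> * mean (square P0 H) f + (\<Sum>t\<le>T. energy f (2 ^ t) (square P0 H)) + \<kappa>"
    and \<rho>: "H\<^sup>2 - (H - l + 1)\<^sup>2 \<le> \<rho> * (H - l + 1)\<^sup>2" and t0: "t0 \<le> T"
  shows "(\<Sum>P\<in>square P0 (H - l + 1). energy f (2 ^ t0) (square P l))
    \<le> (H - l + 1)\<^sup>2 * (energy f (2 ^ t0) (square P0 H) + (\<kappa> + (\<nu> + 3 * (real T + 1)) * \<rho>))"
proof -
  define V where "V = square P0 (H - l + 1)"
  define m where "m = real_of_int ((H - l + 1)\<^sup>2)"
  define \<mu> where "\<mu> = mean (square P0 H) f"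
  define e where "e t = energy f (2 ^ t) (square P0 H)" for t
  define s where "s t = (\<Sum>P\<in>V. energy f (2 ^ t) (square P l))" for t
  have cV: "real (card V) = m" using l card_square[of "H - l + 1" P0] by (simp add: V_def m_def)
  have m: "m > 0" using l by (simp add: m_def)
  have \<rho>0: "0 \<le> \<rho>"
  proof -
    have "(H - l + 1)\<^sup>2 \<le> H\<^sup>2" using l by (intro power_mono) auto
    then have "0 \<le> real_of_int (H\<^sup>2 - (H - l + 1)\<^sup>2)"
      by (simp only: of_int_0_le_iff diff_ge_0_iff_ge)
    then have "0 \<le> \<rho> * m" using \<rho> unfolding m_def by linarith
    then show ?thesis using m by (simp add: zero_le_mult_iff)
  qed
  have \<rho>': "H\<^sup>2 - m \<le> \<rho> * m" using \<rho> by (simp add: m_def)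
  have dens: "m * \<mu> - \<rho> * m \<le> (\<Sum>P\<in>V. mean (square P l) f)"
  proof -
    have "(\<Sum>p\<in>square P0 H. f p) = H\<^sup>2 * \<mu>" using l card_square[of H P0] by (simp add: \<mu>_def mean_def)
    moreover have "\<bar>f p\<bar> \<le> 1" for p using f01[of p] by simp
    note sum_mean_windows[of l H f 1 P0, OF l this]
    moreover have "m * \<mu> \<le> H\<^sup>2 * \<mu>"
    proof (rule mult_right_mono)
      have "(H - l + 1)\<^sup>2 \<le> H\<^sup>2" using l by (intro power_mono) auto
      then show "m \<le> real_of_int (H\<^sup>2)" unfolding m_def by (simp only: of_int_le_iff)
    qed (use f01 in \<open>auto simp: \<mu>_def intro: mean_nonneg\<close>)
    ultimately show ?thesis using \<rho>' unfolding V_def m_def by (simp add: abs_le_iff)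
  qed
  have low: "m * e t - 3 * (\<rho> * m) \<le> s t" for t
    using window_energy_lower[of f l H "2 ^ t" P0, OF f01 l] \<rho>' unfolding s_def e_def V_def m_def by simp
  have "\<nu> * (\<Sum>P\<in>V. mean (square P l) f) + (\<Sum>t\<le>T. s t)
    = (\<Sum>P\<in>V. \<nu> * mean (square P l) f + (\<Sum>t\<le>T. energy f (2 ^ t) (square P l)))"
    unfolding s_def sum.distrib sum_distrib_left by (simp add: sum.swap[of _ V])
  also have "\<dots> \<le> (\<Sum>P\<in>V. \<nu> * \<mu> + (\<Sum>t\<le>T. e t) + \<kappa>)"
    unfolding \<mu>_def e_def by (intro sum_mono max)
  also have "\<dots> = m * (\<nu> * \<mu> + (\<Sum>t\<le>T. e t) + \<kappa>)" by (simp add: cV)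
  finally have up: "\<nu> * (\<Sum>P\<in>V. mean (square P l) f) + (\<Sum>t\<le>T. s t) \<le> m * (\<nu> * \<mu> + (\<Sum>t\<le>T. e t) + \<kappa>)" .
  have split: "(\<Sum>t\<le>T. g t) = g t0 + (\<Sum>t\<in>{..T} - {t0}. g t)" for g :: "nat \<Rightarrow> real"
    using t0 by (intro sum.remove) auto
  have rest: "m * (\<Sum>t\<in>{..T} - {t0}. e t) - (3 * (\<rho> * m)) * T \<le> (\<Sum>t\<in>{..T} - {t0}. s t)"
  proof -
    have "(\<Sum>t\<in>{..T} - {t0}. m * e t - 3 * (\<rho> * m)) \<le> (\<Sum>t\<in>{..T} - {t0}. s t)"
      by (intro sum_mono low)
    moreover have "card ({..T} - {t0}) = T" using t0 by (simp add: card_Diff_singleton)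
    ultimately show ?thesis by (simp add: sum_subtractf sum_distrib_left mult_ac)
  qed
  have "\<nu> * (m * \<mu> - \<rho> * m) \<le> \<nu> * (\<Sum>P\<in>V. mean (square P l) f)"
    using dens \<nu> by (intro mult_left_mono) auto
  then have "s t0 \<le> m * (\<nu> * \<mu> + (\<Sum>t\<le>T. e t) + \<kappa>) - \<nu> * (m * \<mu> - \<rho> * m)
      - (m * (\<Sum>t\<in>{..T} - {t0}. e t) - (3 * (\<rho> * m)) * T)"
    using up rest unfolding split[of s] by linarith
  also have "\<dots> = m * (e t0 + (\<kappa> + (\<nu> + 3 * T) * \<rho>))"
    unfolding split[of e] by (simp add: algebra_simps)
  also have "\<dots> \<le> m * (e t0 + (\<kappa> + (\<nu> + 3 * (real T + 1)) * \<rho>))"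
    using m \<rho>0 by (intro mult_left_mono add_mono order_refl mult_right_mono) auto
  finally show ?thesis unfolding s_def V_def m_def e_def by (simp add: add_ac)
qed

lemma card_shifted_out:
  fixes H d :: int
  assumes "0 \<le> H"
  shows "real (card {p\<in>square P H. p - (d, 0) \<notin> square P H}) \<le> \<bar>d\<bar> * H"
    and "real (card {p\<in>square P H. p - (0, d) \<notin> square P H}) \<le> \<bar>d\<bar> * H"
proof -
  obtain x y where P: "P = (x, y)" by (cases P)
  define I where "I z = {z..<z + d} \<union> {z + H + d..<z + H}" for z :: int
  have I: "card (I z) \<le> nat \<bar>d\<bar>" for z
  proof (cases "d \<ge> 0")
    case True
    then have "I z = {z..<z + d}" by (auto simp: I_def)
    then show ?thesis by simp
  next
    case False
    then have "I z = {z + H + d..<z + H}" by (auto simp: I_def)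
    then show ?thesis using False by simp
  qed
  have prod: "real (card (I z) * nat H) \<le> \<bar>d\<bar> * H" for z
  proof -
    have "card (I z) * nat H \<le> nat \<bar>d\<bar> * nat H" using I by (rule mult_le_mono1)
    then have "real (card (I z) * nat H) \<le> real (nat \<bar>d\<bar> * nat H)" unfolding of_nat_le_iff .
    then show ?thesis using assms by simp
  qed
  have "card {p\<in>square P H. p - (d, 0) \<notin> square P H} \<le> card (I x \<times> {y..<y + H})"
    by (intro card_mono) (auto simp: I_def mem_square P)
  also have "\<dots> = card (I x) * nat H" by (simp add: card_cartesian_product)
  finally show "real (card {p\<in>square P H. p - (d, 0) \<notin> square P H}) \<le> \<bar>d\<bar> * H"
    using prod[of x] by linarith
  have "card {p\<in>square P H. p - (0, d) \<notin> square P H} \<le> card ({x..<x + H} \<times> I y)"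
    by (intro card_mono) (auto simp: I_def mem_square P)
  also have "\<dots> = card (I y) * nat H" by (simp add: card_cartesian_product)
  finally show "real (card {p\<in>square P H. p - (0, d) \<notin> square P H}) \<le> \<bar>d\<bar> * H"
    using prod[of y] by linarith
qed

text \<open>The corner sum of the structured parts at distance \<open>d\<close> is, up to boundary terms, the function
  \<open>G\<close> to which \<open>return_cells\<close> applies.\<close>
lemma structured_corner_sum:
  fixes P0 :: "int \<times> int" and H R :: int and f :: "int \<times> int \<Rightarrow> real"
  assumes f01: "\<And>p. 0 \<le> f p" "\<And>p. f p \<le> 1" and \<Lambda>: "labelling k \<Lambda>"
    and R: "0 \<le> R" "R \<le> H" "1 \<le> H" and \<delta>: "0 < \<delta>" "\<delta> \<le> 1"
  defines "Q \<equiv> square P0 H"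
  defines "h \<equiv> \<lambda>c. cut Q (cell_mean f Q (key \<Lambda> c))"
  shows "\<exists>cell :: int \<Rightarrow> nat \<times> nat \<times> nat \<Rightarrow> int. card (cell ` {-R..R}) \<le> cell_number k \<delta> \<and>
    (\<forall>u\<in>{-R..R}. \<forall>v\<in>{-R..R}. cell u = cell v \<longrightarrow>
      H\<^sup>2 * (mean Q f ^ 4 - 48 * (real k)\<^sup>2 * \<delta>) - 4 * R * H \<le> corner_sum Q (h 0) (h 1) (h 2) (v - u))"
proof -
  define F where "F c v = mean {q\<in>Q. key \<Lambda> c q = v} f" for c v
  have F01: "0 \<le> F c v" "F c v \<le> 1" for c v
    unfolding F_def using f01 by (auto intro: mean_nonneg mean_le)
  \<comment> \<open>The vertices (x, y), (x - d, y), (x, y - d) share y, x and x + y - d in pairs,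
    so the product of the three averages depends only on the labels \<open>i\<close> of y,
    \<open>j\<close> of x and that of n = x + y - d.\<close>
  define C where "C i j n = F 0 (i, j) * F 1 (i, \<Lambda> 2 n) * F 2 (j, \<Lambda> 2 n)" for i j n
  have C01: "0 \<le> C i j n" "C i j n \<le> 1" for i j n
    unfolding C_def using F01 by (auto intro!: unit_mult)
  have cell_mean: "cell_mean f Q (key \<Lambda> c) p = F c (key \<Lambda> c p)" for c p by (simp add: cell_mean_def F_def)
  define G where "G d = (\<Sum>p\<in>Q. C (\<Lambda> 0 (snd p)) (\<Lambda> 1 (fst p)) (fst p + snd p - d))" for d
  have G0: "H\<^sup>2 * mean Q f ^ 4 \<le> G 0"
  proof -
    \<comment> \<open>The factor \<open>f\<close> is inserted for \<open>mean_power4_le\<close> and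
      then bounded by 1; this is the source of the exponent 4.\<close>
    have "mean Q f ^ 4 \<le> mean Q (\<lambda>p. f p * cell_mean f Q (key \<Lambda> 0) p * cell_mean f Q (key \<Lambda> 1) p * cell_mean f Q (key \<Lambda> 2) p)"
      by (rule mean_power4_le) (use f01 in \<open>auto simp: Q_def\<close>)
    also have "\<dots> \<le> mean Q (\<lambda>p. C (\<Lambda> 0 (snd p)) (\<Lambda> 1 (fst p)) (fst p + snd p - 0))"
    proof (rule mean_mono)
      fix p :: "int \<times> int"
      obtain x y where p: "p = (x, y)" by (cases p)
      have "f p * C (\<Lambda> 0 y) (\<Lambda> 1 x) (x + y) \<le> 1 * C (\<Lambda> 0 y) (\<Lambda> 1 x) (x + y)"
        by (intro mult_right_mono f01 C01)
      then show "f p * cell_mean f Q (key \<Lambda> 0) p * cell_mean f Q (key \<Lambda> 1) p * cell_mean f Q (key \<Lambda> 2) p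
        \<le> C (\<Lambda> 0 (snd p)) (\<Lambda> 1 (fst p)) (fst p + snd p - 0)"
        unfolding cell_mean by (simp add: p key_def C_def mult.assoc)
    qed
    also have "\<dots> = G 0 / H\<^sup>2" using R card_square[of H P0] by (simp add: mean_def G_def Q_def)
    finally show ?thesis using R by (simp add: field_simps)
  qed
  have main: "G d - 2 * \<bar>d\<bar> * H \<le> corner_sum Q (h 0) (h 1) (h 2) d" for d
  proof -
    define b where "b p = (of_bool (p - (d, 0) \<notin> Q) + of_bool (p - (0, d) \<notin> Q) :: real)" for p
    have "C (\<Lambda> 0 (snd p)) (\<Lambda> 1 (fst p)) (fst p + snd p - d) - b p
      \<le> h 0 p * h 1 (p - (d, 0)) * h 2 (p - (0, d))" if "p \<in> Q" for p
    proof -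
      obtain x y where p: "p = (x, y)" by (cases p)
      have eq: "C (\<Lambda> 0 (snd p)) (\<Lambda> 1 (fst p)) (fst p + snd p - d) =
        cell_mean f Q (key \<Lambda> 0) p * cell_mean f Q (key \<Lambda> 1) (p - (d, 0)) * cell_mean f Q (key \<Lambda> 2) (p - (0, d))"
        unfolding cell_mean by (simp add: p key_def C_def algebra_simps)
      show ?thesis
      proof (cases "p - (d, 0) \<in> Q \<and> p - (0, d) \<in> Q")
        case True
        then show ?thesis using that unfolding eq by (simp add: h_def cut_def b_def)
      next
        case False
        then have "1 \<le> b p" by (auto simp: b_def)
        then have "C (\<Lambda> 0 (snd p)) (\<Lambda> 1 (fst p)) (fst p + snd p - d) - b p \<le> 0"
          using C01(2)[of "\<Lambda> 0 (snd p)" "\<Lambda> 1 (fst p)" "fst p + snd p - d"] by linarith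
        also have "0 \<le> h 0 p * h 1 (p - (d, 0)) * h 2 (p - (0, d))"
          unfolding h_def cut_def cell_mean using F01 by simp
        finally show ?thesis .
      qed
    qed
    then have "(\<Sum>p\<in>Q. C (\<Lambda> 0 (snd p)) (\<Lambda> 1 (fst p)) (fst p + snd p - d) - b p) \<le> corner_sum Q (h 0) (h 1) (h 2) d"
      unfolding corner_sum_def by (intro sum_mono)
    moreover have "(\<Sum>p\<in>Q. b p) \<le> 2 * \<bar>d\<bar> * H"
    proof -
      have "(\<Sum>p\<in>Q. b p) = real (card {p\<in>Q. p - (d, 0) \<notin> Q}) + real (card {p\<in>Q. p - (0, d) \<notin> Q})"
        unfolding b_def sum.distrib by (simp add: of_bool_def sum.If_cases Q_def Int_def)
      also have "\<dots> \<le> real_of_int (\<bar>d\<bar> * H) + real_of_int (\<bar>d\<bar> * H)"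
        unfolding Q_def by (intro add_mono card_shifted_out) (use R in auto)
      finally show ?thesis by (simp add: mult_ac)
    qed
    ultimately show ?thesis unfolding G_def sum_subtractf by linarith
  qed
  obtain cell :: "int \<Rightarrow> nat \<times> nat \<times> nat \<Rightarrow> int" where card: "card (cell ` {-R..R}) \<le> cell_number k \<delta>"
    and cell: "\<And>u v. u \<in> {-R..R} \<Longrightarrow> v \<in> {-R..R} \<Longrightarrow> cell u = cell v \<Longrightarrow>
      \<bar>G (v - u) - G 0\<bar> \<le> 48 * (real k)\<^sup>2 * \<delta> * H\<^sup>2"
    using return_cells[of R H \<delta> "\<Lambda> 0" k "\<Lambda> 1" C P0] R \<delta> \<Lambda> C01
    unfolding G_def Q_def labelling_def by blast
  have "H\<^sup>2 * (mean Q f ^ 4 - 48 * (real k)\<^sup>2 * \<delta>) - 4 * R * H \<le> corner_sum Q (h 0) (h 1) (h 2) (v - u)"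
    if u: "u \<in> {-R..R}" and v: "v \<in> {-R..R}" and eq: "cell u = cell v" for u v
  proof -
    have "\<bar>v - u\<bar> \<le> 2 * R" using u v by auto
    then have "2 * \<bar>v - u\<bar> * H \<le> 2 * (2 * R) * H" using R by (intro mult_right_mono) auto
    then have "real_of_int (2 * \<bar>v - u\<bar> * H) \<le> real_of_int (4 * R * H)" unfolding of_int_le_iff by simp
    then show ?thesis
      using cell[OF u v eq] main[of "v - u"] G0 by (simp add: abs_le_iff algebra_simps)
  qed
  then show ?thesis using card by (intro exI[of _ cell]) auto
qed

text \<open>For nested labellings Pythagoras turns the energy gap into squared L^2 distances of the
  averages; Cauchy-Schwarz passes to L^1.\<close>

lemma sum_abs_cell_mean_diff_le:
  fixes H :: int
  assumes H: "1 \<le> H" and ref: "\<And>c p q. key \<Lambda> c p = key \<Lambda> c q \<Longrightarrow> key \<Lambda>1 c p = key \<Lambda>1 c q"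
    and diff: "label_energy f (square P0 H) \<Lambda> - label_energy f (square P0 H) \<Lambda>1 \<le> \<kappa>"
  shows "(\<Sum>c<3. \<Sum>p\<in>square P0 H. \<bar>cell_mean f (square P0 H) (key \<Lambda> c) p - cell_mean f (square P0 H) (key \<Lambda>1 c) p\<bar>) \<le> 3 * H\<^sup>2 * sqrt \<kappa>"
proof -
  define Q where "Q = square P0 H"
  define m where "m = real_of_int (H\<^sup>2)"
  have cQ: "real (card Q) = m" using H card_square[of H P0] by (simp add: Q_def m_def)
  have m: "m > 0" using H by (simp add: m_def)
  define g where "g c p = cell_mean f Q (key \<Lambda> c) p - cell_mean f Q (key \<Lambda>1 c) p" for c p
  have square: "(\<Sum>p\<in>Q. (g c p)\<^sup>2) = (\<Sum>p\<in>Q. (cell_mean f Q (key \<Lambda> c) p)\<^sup>2) - (\<Sum>p\<in>Q. (cell_mean f Q (key \<Lambda>1 c) p)\<^sup>2)" for c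
    unfolding g_def by (rule sum_cell_mean_diff_sq) (auto simp: Q_def dest: ref)
  have "(\<Sum>c<3. mean Q (\<lambda>p. (g c p)\<^sup>2)) = label_energy f Q \<Lambda> - label_energy f Q \<Lambda>1"
    unfolding label_energy_def mean_def square by (simp add: diff_divide_distrib sum_subtractf)
  then have tot: "(\<Sum>c<3. mean Q (\<lambda>p. (g c p)\<^sup>2)) \<le> \<kappa>" using diff by (simp add: Q_def)
  have "(\<Sum>p\<in>Q. \<bar>g c p\<bar>) \<le> m * sqrt \<kappa>" if "c < 3" for c
  proof -
    have "mean Q (\<lambda>p. (g c p)\<^sup>2) \<le> (\<Sum>c<3. mean Q (\<lambda>p. (g c p)\<^sup>2))"
      using that by (intro member_le_sum mean_nonneg) auto
    then have "mean Q (\<lambda>p. (g c p)\<^sup>2) \<le> \<kappa>" using tot by linarith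
    then have "(\<Sum>p\<in>Q. (g c p)\<^sup>2) \<le> m * \<kappa>"
      using m by (simp add: mean_def cQ divide_le_eq mult.commute)
    then have "(\<Sum>p\<in>Q. (g c p)\<^sup>2) * m \<le> m * \<kappa> * m" using m by (intro mult_right_mono) auto
    moreover have "(\<Sum>p\<in>Q. \<bar>g c p\<bar>)\<^sup>2 \<le> (\<Sum>p\<in>Q. \<bar>g c p\<bar>\<^sup>2) * real (card Q)"
      by (rule sum_squared_le_sum_of_squares)
    ultimately have "(\<Sum>p\<in>Q. \<bar>g c p\<bar>)\<^sup>2 \<le> m * \<kappa> * m" unfolding cQ power2_abs by linarith
    also have "\<dots> = m\<^sup>2 * \<kappa>" by (simp add: power2_eq_square)
    finally have "(\<Sum>p\<in>Q. \<bar>g c p\<bar>)\<^sup>2 \<le> m\<^sup>2 * \<kappa>" .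
    then have "(\<Sum>p\<in>Q. \<bar>g c p\<bar>) \<le> sqrt (m\<^sup>2 * \<kappa>)" by (rule real_le_rsqrt)
    then show ?thesis using m by (simp add: real_sqrt_mult)
  qed
  then have "(\<Sum>c<3. \<Sum>p\<in>Q. \<bar>g c p\<bar>) \<le> (\<Sum>c<(3::nat). m * sqrt \<kappa>)" by (intro sum_mono) auto
  then show ?thesis by (simp add: g_def Q_def m_def)
qed

text \<open>For each class, the pairs from two blocks that lie in it are weighted by a product of
  indicators, to which \<open>corner_control\<close> applies at a cost of \<open>24 * Z\<close>.
  With M = \<open>cell_number k1 \<delta>\<close> there are at most M classes and at least
  \<open>l\<^sup>2 / (2 * M)\<close> pairs, whence the loss
  \<open>48 * M\<^sup>2 * (\<xi> + \<rho>)\<close>.\<close>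

lemma tile_estimate:
  fixes P0 :: "int \<times> int" and H l R :: int and f :: "int \<times> int \<Rightarrow> real" and s :: "nat \<Rightarrow> int" and r :: nat
    and \<rho> \<xi> \<tau> \<kappa> E' :: real
  assumes f01: "\<And>p. 0 \<le> f p" "\<And>p. f p \<le> 1"
    and \<Lambda>1: "labelling k1 \<Lambda>1" and \<Lambda>: "labelling k \<Lambda>"
    and ref: "\<And>c p q. key \<Lambda> c p = key \<Lambda> c q \<Longrightarrow> key \<Lambda>1 c p = key \<Lambda>1 c q"
    and l: "1 \<le> l" "l \<le> H" and R: "0 \<le> R" "R \<le> H" and \<delta>: "0 < \<delta>" "\<delta> \<le> 1"
    and diff: "label_energy f (square P0 H) \<Lambda> - label_energy f (square P0 H) \<Lambda>1 \<le> \<kappa>"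
    and win: "(\<Sum>P\<in>square P0 (H - l + 1). energy f (2 * k) (square P l)) \<le> (H - l + 1)\<^sup>2 * E'"
    and \<xi>: "E' - label_energy f (square P0 H) \<Lambda> + 3 * \<rho> \<le> \<xi>\<^sup>2" "0 \<le> \<xi>"
    and \<rho>: "H\<^sup>2 - (H - l + 1)\<^sup>2 \<le> \<rho> * (H - l + 1)\<^sup>2" "(H + l - 1)\<^sup>2 - (H - l + 1)\<^sup>2 \<le> \<rho> * H\<^sup>2" "0 \<le> \<rho>"
    and r: "4 * cell_number k1 \<delta> \<le> r"
    and S: "\<And>i. i < r \<Longrightarrow> {s i..<s i + l} \<subseteq> {-R..R}"
    and upper: "\<And>i j u v. i < j \<Longrightarrow> j < r \<Longrightarrow> u \<in> {s i..<s i + l} \<Longrightarrow> v \<in> {s j..<s j + l} \<Longrightarrow>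
      corner_sum (square P0 H) (cut (square P0 H) f) (cut (square P0 H) f) (cut (square P0 H) f) (v - u) \<le> H\<^sup>2 * \<tau>"
  shows "mean (square P0 H) f ^ 4 - 48 * (real k1)\<^sup>2 * \<delta> - 4 * R / H - 3 * sqrt \<kappa>
    - 48 * (real (cell_number k1 \<delta>))\<^sup>2 * (\<xi> + \<rho>) \<le> \<tau>"
proof -
  define Q where "Q = square P0 H"
  define M where "M = cell_number k1 \<delta>"
  define m where "m = real_of_int (H\<^sup>2)"
  define n where "n = real_of_int ((H - l + 1)\<^sup>2)"
  define f' where "f' = cut Q f"
  define h where "h c = cut Q (cell_mean f Q (key \<Lambda> c))" for c
  define g where "g c = cut Q (cell_mean f Q (key \<Lambda>1 c))" for c
  have H: "1 \<le> H" using l by simp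
  have m: "m > 0" using H by (simp add: m_def)
  have n: "n > 0" using l by (simp add: n_def)
  have nm: "n \<le> m" unfolding n_def m_def of_int_le_iff using l by (intro power_mono) auto
  have M: "1 \<le> M" by (simp add: M_def cell_number_def)
  have cell_mean01: "0 \<le> cell_mean f Q K p" "cell_mean f Q K p \<le> 1" for K :: "_ \<Rightarrow> nat \<times> nat" and p
    using f01 by (auto intro: cell_mean_nonneg cell_mean_le_1)
  obtain cell :: "int \<Rightarrow> nat \<times> nat \<times> nat \<Rightarrow> int" where card: "card (cell ` {-R..R}) \<le> M"
    and cell: "\<And>u v. u \<in> {-R..R} \<Longrightarrow> v \<in> {-R..R} \<Longrightarrow> cell u = cell v \<Longrightarrow>
      m * (mean Q f ^ 4 - 48 * (real k1)\<^sup>2 * \<delta>) - 4 * R * H \<le> corner_sum Q (g 0) (g 1) (g 2) (v - u)"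
    using structured_corner_sum[of f k1 \<Lambda>1 R H \<delta> P0, OF f01 \<Lambda>1 R H \<delta>]
    unfolding Q_def M_def m_def g_def by blast
  define B where "B = m * (mean Q f ^ 4 - 48 * (real k1)\<^sup>2 * \<delta>) - 4 * R * H - 3 * m * sqrt \<kappa>"
  have lower: "B \<le> corner_sum Q (h 0) (h 1) (h 2) (v - u)"
    if "u \<in> {-R..R}" "v \<in> {-R..R}" "cell u = cell v" for u v
  proof -
    have "corner_sum Q (g 0) (g 1) (g 2) (v - u) - (\<Sum>c<3. \<Sum>p\<in>Q. \<bar>h c p - g c p\<bar>)
      \<le> corner_sum Q (h 0) (h 1) (h 2) (v - u)"
      by (rule corner_sum_perturb) (auto simp: Q_def h_def g_def cut_def cell_mean01[unfolded Q_def])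
    moreover have "(\<Sum>c<3. \<Sum>p\<in>Q. \<bar>h c p - g c p\<bar>) \<le> 3 * m * sqrt \<kappa>"
      using sum_abs_cell_mean_diff_le[OF H ref diff] by (simp add: h_def g_def cut_def Q_def m_def)
    ultimately show ?thesis using cell[OF that] unfolding B_def by linarith
  qed
  define W where "W i j = (\<Sum>m\<in>cell ` {-R..R}. \<Sum>u\<in>{s i..<s i + l}. \<Sum>v\<in>{s j..<s j + l}.
    of_bool (cell u = m) * of_bool (cell v = m) :: real)" for i j
  have "\<exists>i j. i < j \<and> j < r \<and> l\<^sup>2 / (2 * M) \<le> W i j"
    unfolding W_def by (rule close_pairs) (use l M r card S in \<open>simp_all add: M_def\<close>)
  then obtain i j where ij: "i < j" "j < r" and Wij: "l\<^sup>2 / (2 * M) \<le> W i j" by blast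
  have S_ij: "{s i..<s i + l} \<subseteq> {-R..R}" "{s j..<s j + l} \<subseteq> {-R..R}" using S ij by auto
  \<comment> \<open>The part with \<open>\<xi>\<close> comes from windows inside the square, the
    part with \<open>\<rho>\<close> from those crossing its boundary.\<close>
  define Z where "Z = l\<^sup>2 * (m * (\<xi> + \<rho>))"
  have unif: "uniform P0 H l c (\<lambda>p. f' p - h c p) Z" if c: "c < 3" for c
    unfolding uniform_def
  proof (intro allI impI)
    fix a b :: "int \<times> int \<Rightarrow> int \<Rightarrow> real"
    assume ab: "\<forall>P n. 0 \<le> a P n \<and> a P n \<le> 1 \<and> 0 \<le> b P n \<and> b P n \<le> 1"
    have eq: "f' p - h c p = cut (square P0 H) (\<lambda>p. f p - cell_mean f (square P0 H) (key \<Lambda> c) p) p" for p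
      by (simp add: f'_def h_def cut_def Q_def)
    have "(\<Sum>P\<in>square (P0 - (l - 1, l - 1)) (H + l - 1). \<bar>\<Sum>p\<in>square P l. (f' p - h c p) * (a P (crd (lft c) p) * b P (crd (rgt c) p))\<bar>)
      \<le> l\<^sup>2 * (n * sqrt (E' - label_energy f (square P0 H) \<Lambda> + 3 * ((H\<^sup>2 - (H - l + 1)\<^sup>2) / (H - l + 1)\<^sup>2))
        + ((H + l - 1)\<^sup>2 - (H - l + 1)\<^sup>2))"
      unfolding eq n_def
      by (rule uniformity_cut[of f k \<Lambda> c l H P0 E' a b, OF f01 \<Lambda> c l win]) (use ab in auto)
    also have "\<dots> \<le> l\<^sup>2 * (m * \<xi> + m * \<rho>)"
    proof (intro mult_left_mono add_mono)
      have "(H\<^sup>2 - (H - l + 1)\<^sup>2) / (H - l + 1)\<^sup>2 \<le> \<rho>"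
        using \<rho>(1) n unfolding n_def by (simp add: divide_le_eq)
      then have "sqrt (E' - label_energy f (square P0 H) \<Lambda> + 3 * ((H\<^sup>2 - (H - l + 1)\<^sup>2) / (H - l + 1)\<^sup>2)) \<le> \<xi>"
        using \<xi> by (intro real_le_lsqrt; linarith)
      then have "n * sqrt (E' - label_energy f (square P0 H) \<Lambda> + 3 * ((H\<^sup>2 - (H - l + 1)\<^sup>2) / (H - l + 1)\<^sup>2)) \<le> n * \<xi>"
        using n by (intro mult_left_mono) auto
      also have "\<dots> \<le> m * \<xi>" using nm \<xi>(2) by (rule mult_right_mono)
      finally show "n * sqrt (E' - label_energy f (square P0 H) \<Lambda> + 3 * ((H\<^sup>2 - (H - l + 1)\<^sup>2) / (H - l + 1)\<^sup>2)) \<le> m * \<xi>" .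
    qed (use \<rho>(2) in \<open>auto simp: m_def mult.commute\<close>)
    finally show "(\<Sum>P\<in>square (P0 - (l - 1, l - 1)) (H + l - 1).
        \<bar>\<Sum>p\<in>square P l. (f' p - h c p) * (a P (crd (lft c) p) * b P (crd (rgt c) p))\<bar>) \<le> Z"
      by (simp add: Z_def distrib_left)
  qed
  have one: "(\<Sum>u\<in>{s i..<s i + l}. \<Sum>v\<in>{s j..<s j + l}. of_bool (cell u = w) * of_bool (cell v = w)) * B
    - 24 * Z \<le> (\<Sum>u\<in>{s i..<s i + l}. \<Sum>v\<in>{s j..<s j + l}. of_bool (cell u = w) * of_bool (cell v = w)) * (m * \<tau>)" for w
  proof -
    define \<phi> where "\<phi> u = (of_bool (u \<in> {s i..<s i + l} \<and> cell u = w) :: real)" for u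
    define \<psi> where "\<psi> v = (of_bool (v \<in> {s j..<s j + l} \<and> cell v = w) :: real)" for v
    have eq: "(\<Sum>u\<in>{s i..<s i + l}. \<Sum>v\<in>{s j..<s j + l}. of_bool (cell u = w) * of_bool (cell v = w)) * t
      = (\<Sum>u\<in>{s i..<s i + l}. \<Sum>v\<in>{s j..<s j + l}. \<phi> u * \<psi> v * t)" for t :: real
      unfolding sum_distrib_right by (intro sum.cong refl) (auto simp: \<phi>_def \<psi>_def)
    have "\<bar>(\<Sum>u\<in>{s i..<s i + l}. \<Sum>v\<in>{s j..<s j + l}. \<phi> u * \<psi> v * corner_sum Q f' f' f' (v - u))
      - (\<Sum>u\<in>{s i..<s i + l}. \<Sum>v\<in>{s j..<s j + l}. \<phi> u * \<psi> v * corner_sum Q (h 0) (h 1) (h 2) (v - u))\<bar> \<le> 24 * Z"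
      by (rule corner_control[OF l(1) Q_def]) (auto simp: \<phi>_def \<psi>_def f'_def h_def cut_def f01 cell_mean01 intro!: unif[unfolded f'_def h_def cut_def])
    moreover have "(\<Sum>u\<in>{s i..<s i + l}. \<Sum>v\<in>{s j..<s j + l}. \<phi> u * \<psi> v * corner_sum Q f' f' f' (v - u))
      \<le> (\<Sum>u\<in>{s i..<s i + l}. \<Sum>v\<in>{s j..<s j + l}. \<phi> u * \<psi> v * (m * \<tau>))"
      by (intro sum_mono mult_left_mono) (use upper[OF ij] in \<open>auto simp: \<phi>_def \<psi>_def f'_def Q_def m_def\<close>)
    moreover have "(\<Sum>u\<in>{s i..<s i + l}. \<Sum>v\<in>{s j..<s j + l}. \<phi> u * \<psi> v * B)
      \<le> (\<Sum>u\<in>{s i..<s i + l}. \<Sum>v\<in>{s j..<s j + l}. \<phi> u * \<psi> v * corner_sum Q (h 0) (h 1) (h 2) (v - u))"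
    proof (intro sum_mono)
      fix u v assume uv: "u \<in> {s i..<s i + l}" "v \<in> {s j..<s j + l}"
      show "\<phi> u * \<psi> v * B \<le> \<phi> u * \<psi> v * corner_sum Q (h 0) (h 1) (h 2) (v - u)"
      proof (cases "cell u = w \<and> cell v = w")
        case True
        moreover have "u \<in> {-R..R}" "v \<in> {-R..R}" using uv S_ij by blast+
        ultimately show ?thesis using lower[of u v] by (intro mult_left_mono) (auto simp: \<phi>_def \<psi>_def)
      qed (auto simp: \<phi>_def \<psi>_def)
    qed
    ultimately show ?thesis unfolding eq by linarith
  qed
  have "W i j * B - real (card (cell ` {-R..R})) * (24 * Z) \<le> W i j * (m * \<tau>)"
    using sum_mono[of "cell ` {-R..R}", OF one] unfolding W_def
    by (simp add: sum_subtractf sum_distrib_right)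
  moreover have "0 \<le> Z" using \<xi>(2) \<rho>(3) m by (simp add: Z_def)
  then have "real (card (cell ` {-R..R})) * (24 * Z) \<le> real M * (24 * Z)"
    using card by (intro mult_right_mono) auto
  ultimately have bound: "W i j * (B - m * \<tau>) \<le> real M * (24 * Z)"
    by (simp add: algebra_simps)
  have "B - m * \<tau> \<le> m * (48 * (real M)\<^sup>2 * (\<xi> + \<rho>))"
  \<comment> \<open>The lower bound on \<open>W i j\<close> may be multiplied by this factor only
    when the factor is positive.\<close>
  proof (cases "B - m * \<tau> \<le> 0")
    case True
    also have "0 \<le> m * (48 * (real M)\<^sup>2 * (\<xi> + \<rho>))" using m \<xi>(2) \<rho>(3) by simp
    finally show ?thesis .
  next
    case False
    then have "l\<^sup>2 / (2 * M) * (B - m * \<tau>) \<le> W i j * (B - m * \<tau>)"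
      using Wij by (intro mult_right_mono) auto
    also note bound
    also have "real M * (24 * Z) = l\<^sup>2 / (2 * M) * (m * (48 * (real M)\<^sup>2 * (\<xi> + \<rho>)))"
      using M by (simp add: Z_def field_simps power2_eq_square)
    finally have "l\<^sup>2 / (2 * M) * (B - m * \<tau>) \<le> l\<^sup>2 / (2 * M) * (m * (48 * (real M)\<^sup>2 * (\<xi> + \<rho>)))" .
    moreover have "0 < real_of_int (l\<^sup>2) / real (2 * M)" using M l by simp
    ultimately show ?thesis by (simp only: mult_le_cancel_left_pos)
  qed
  moreover define q where "q = 4 * R / H"
  moreover have "m * q = 4 * R * H" using H by (simp add: q_def m_def power2_eq_square)
  ultimately have "m * (mean Q f ^ 4 - 48 * (real k1)\<^sup>2 * \<delta> - q - 3 * sqrt \<kappa>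
    - 48 * (real M)\<^sup>2 * (\<xi> + \<rho>)) \<le> m * \<tau>"
    unfolding B_def right_diff_distrib by linarith
  then show ?thesis using m by (simp add: Q_def M_def q_def)
qed

subsection \<open>Conclusion\<close>

text \<open>The differences are at most \<open>2 * l * H\<close> and \<open>4 * l * H\<close>. In
  the first bound \<open>H - l + 1 \<ge> H / 2\<close> costs a factor 4, hence the constant
  8.\<close>

lemma small_boundary:
  fixes H l :: int and \<rho> :: real
  assumes l: "1 \<le> l" "2 * l \<le> H" and \<rho>: "8 * l \<le> \<rho> * H"
  shows "H\<^sup>2 - (H - l + 1)\<^sup>2 \<le> \<rho> * (H - l + 1)\<^sup>2"
    and "(H + l - 1)\<^sup>2 - (H - l + 1)\<^sup>2 \<le> \<rho> * H\<^sup>2"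
proof -
  define h w :: real where "h = H" and "w = l"
  have hw: "1 \<le> w" "2 * w \<le> h" "8 * w \<le> \<rho> * h"
    using l \<rho> by (auto simp: h_def w_def)
  have "8 * w * h \<le> \<rho> * h * h" using hw by (intro mult_right_mono) auto
  then have hh: "8 * (w * h) \<le> \<rho> * (h * h)" by (simp add: mult.assoc)
  have \<rho>0: "0 \<le> \<rho>"
  proof (rule ccontr)
    assume "\<not> ?thesis"
    then have "\<rho> * h \<le> 0" using hw by (intro mult_nonpos_nonneg) auto
    then show False using hw by linarith
  qed
  have "h\<^sup>2 - (h - w + 1)\<^sup>2 = 2 * (w * h) - w * w - 2 * h + 2 * w - 1"
    "(h + w - 1)\<^sup>2 - (h - w + 1)\<^sup>2 = 4 * (w * h) - 4 * h"
    by (simp_all add: power2_eq_square algebra_simps)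
  moreover have "w * h \<ge> 0" "w * w \<ge> 0" using hw by simp_all
  ultimately have up: "h\<^sup>2 - (h - w + 1)\<^sup>2 \<le> 2 * (w * h)" "(h + w - 1)\<^sup>2 - (h - w + 1)\<^sup>2 \<le> 4 * (w * h)"
    using hw by linarith+
  have "(h / 2) * (h / 2) \<le> (h - w + 1) * (h - w + 1)" using hw by (intro mult_mono) auto
  then have "\<rho> * (h * h / 4) \<le> \<rho> * (h - w + 1)\<^sup>2"
    using \<rho>0 by (intro mult_left_mono) (auto simp: power2_eq_square)
  then have "h\<^sup>2 - (h - w + 1)\<^sup>2 \<le> \<rho> * (h - w + 1)\<^sup>2" using up(1) hh by linarith
  then show "H\<^sup>2 - (H - l + 1)\<^sup>2 \<le> \<rho> * (H - l + 1)\<^sup>2" by (simp add: h_def w_def)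
  have "(h + w - 1)\<^sup>2 - (h - w + 1)\<^sup>2 \<le> \<rho> * h\<^sup>2"
    using up(2) hh \<open>w * h \<ge> 0\<close> unfolding power2_eq_square by linarith
  then show "(H + l - 1)\<^sup>2 - (H - l + 1)\<^sup>2 \<le> \<rho> * H\<^sup>2" by (simp add: h_def w_def)
qed

lemma power4_diff_le:
  fixes a b :: real
  assumes "0 \<le> a" "a \<le> 1" "0 \<le> b" "b \<le> 1" "a - \<eta> \<le> b" "0 \<le> \<eta>"
  shows "a ^ 4 \<le> b ^ 4 + 4 * \<eta>"
proof (cases "a \<le> b")
  case True
  then have "a ^ 4 \<le> b ^ 4" using assms by (intro power_mono) auto
  then show ?thesis using assms by linarith
next
  case False
  have "a\<^sup>2 \<le> 1" "b\<^sup>2 \<le> 1" using assms by (auto simp: abs_square_le_1)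
  then have "(a + b) * (a\<^sup>2 + b\<^sup>2) \<le> 2 * 2" using assms by (intro mult_mono) auto
  then have "(a - b) * ((a + b) * (a\<^sup>2 + b\<^sup>2)) \<le> (a - b) * 4" using False by (intro mult_left_mono) auto
  moreover have "a ^ 4 - b ^ 4 = (a - b) * ((a + b) * (a\<^sup>2 + b\<^sup>2))"
    by (simp add: power4_eq_xxxx power2_eq_square algebra_simps)
  ultimately have "a ^ 4 - b ^ 4 \<le> (a - b) * 4" by simp
  also have "\<dots> \<le> 4 * \<eta>" using assms by simp
  finally show ?thesis by (simp add: algebra_simps)
qed

lemma corner_sum_le_mean:
  fixes H :: int and P :: "int \<times> int" and E :: "(int \<times> int) set"
  assumes "1 \<le> H"
  defines "f' \<equiv> cut (square P H) (indicator E)"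
  shows "corner_sum (square P H) f' f' f' n
    \<le> H\<^sup>2 * mean (square P H) (indicator (E \<inter> (\<lambda>x. x + (n, 0)) ` E \<inter> (\<lambda>x. x + (0, n)) ` E))"
proof -
  define E' where "E' = E \<inter> (\<lambda>x. x + (n, 0)) ` E \<inter> (\<lambda>x. x + (0, n)) ` E"
  have "f' p * f' (p - (n, 0)) * f' (p - (0, n)) \<le> indicator E' p" for p
  proof (cases "p \<in> E \<and> p - (n, 0) \<in> E \<and> p - (0, n) \<in> E")
    case True
    then have "p \<in> (\<lambda>x. x + (n, 0)) ` E" "p \<in> (\<lambda>x. x + (0, n)) ` E"
      by (auto intro: image_eqI[of _ _ "p - (n, 0)"] image_eqI[of _ _ "p - (0, n)"])
    then have "p \<in> E'" using True by (simp add: E'_def)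
    then show ?thesis by (simp add: f'_def cut_def indicator_def)
  qed (auto simp: f'_def cut_def indicator_def)
  then have "corner_sum (square P H) f' f' f' n \<le> (\<Sum>p\<in>square P H. indicator E' p)"
    unfolding corner_sum_def by (intro sum_mono)
  also have "\<dots> = H\<^sup>2 * mean (square P H) (indicator E')"
    using assms card_square[of H P] by (simp add: mean_def)
  finally show ?thesis by (simp add: E'_def)
qed

theorem corollary1p5:
  fixes E :: "(int \<times> int) set" and \<epsilon> :: real
  assumes "upper_Banach_density E > 0" and "\<epsilon> > 0"
  shows "syndetic {n :: int.
           upper_Banach_density (E \<inter> (\<lambda>x. x + (n, 0)) ` E \<inter> (\<lambda>x. x + (0, n)) ` E)
             > upper_Banach_density E ^ 4 - \<epsilon>}"
proof (rule ccontr)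
  define \<alpha> where "\<alpha> = upper_Banach_density E"
  define En where "En n = E \<inter> (\<lambda>x. x + (n, 0)) ` E \<inter> (\<lambda>x. x + (0, n)) ` E" for n
  define F where "F = {n. upper_Banach_density (En n) > \<alpha> ^ 4 - \<epsilon>}"
  assume "\<not> ?thesis"
  then have nsyn: "\<not> syndetic F" by (simp add: F_def En_def \<alpha>_def)
  have \<alpha>: "0 \<le> \<alpha>" "\<alpha> \<le> 1" using upper_Banach_density_bounds[of E] by (auto simp: \<alpha>_def)
  have \<epsilon>: "\<epsilon> > 0" by fact
  define f where "f = (indicator E :: int \<times> int \<Rightarrow> real)"
  have f01: "0 \<le> f p" "f p \<le> 1" for p by (auto simp: f_def indicator_def)

  \<comment> \<open>Five errors are kept within \<epsilon>/12 each, in total less than the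
    \<epsilon>/2 in \<open>\<tau>\<close>: \<open>4 * \<eta>\<close> from the density of the square,
    the cut-norm error with \<open>\<delta> i\<close>, the boundary term \<open>4 * R / H\<close>,
    \<open>3 * sqrt \<kappa>0\<close> from coarsening, and the uniformity error with
    \<open>\<xi> i + \<rho>\<close>.\<close>
  define \<eta> where "\<eta> = \<epsilon> / 48"
  define \<delta> where "\<delta> i = min 1 (\<epsilon> / (576 * (2 ^ i)\<^sup>2))" for i :: nat
  define M where "M i = cell_number (2 ^ i) (\<delta> i)" for i
  define \<xi> where "\<xi> i = \<epsilon> / (1152 * (real (M i))\<^sup>2)" for i
  define \<kappa>0 where "\<kappa>0 = (\<epsilon> / 36)\<^sup>2"
  have \<eta>: "\<eta> > 0" using \<epsilon> by (simp add: \<eta>_def)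
  have \<delta>: "0 < \<delta> i" "\<delta> i \<le> 1" "48 * (real (2 ^ i))\<^sup>2 * \<delta> i \<le> \<epsilon> / 12" for i
  proof -
    show "0 < \<delta> i" "\<delta> i \<le> 1" using \<epsilon> by (auto simp: \<delta>_def)
    have "48 * (real (2 ^ i))\<^sup>2 * \<delta> i \<le> 48 * (real (2 ^ i))\<^sup>2 * (\<epsilon> / (576 * (2 ^ i)\<^sup>2))"
      by (intro mult_left_mono) (auto simp: \<delta>_def)
    then show "48 * (real (2 ^ i))\<^sup>2 * \<delta> i \<le> \<epsilon> / 12" by simp
  qed
  have M: "M i \<ge> 1" for i by (simp add: M_def cell_number_def)
  have M0: "M i \<noteq> 0" for i using M[of i] by simp
  have \<xi>: "\<xi> i > 0" for i using \<epsilon> M0 by (simp add: \<xi>_def)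
  have \<kappa>0: "\<kappa>0 > 0" using \<epsilon> by (simp add: \<kappa>0_def)
  \<comment> \<open>Only part of \<open>\<kappa>0\<close> and \<open>(\<xi> i)\<^sup>2\<close> is
    spent here; the rest absorbs the choice of nearly optimal labellings, near-maximality and the
    boundary.\<close>
  obtain T where T: "\<And>a. mono a \<Longrightarrow> (\<And>n. 0 \<le> a n \<and> a n \<le> 3) \<Longrightarrow>
    \<exists>i j. i + j + 1 \<le> T \<and> a (i + j) - a i \<le> \<kappa>0 / 2 \<and> a (i + j + 1) - a j \<le> (\<xi> i)\<^sup>2 / 4"
    using metastable[of "\<kappa>0 / 2" "\<lambda>i. (\<xi> i)\<^sup>2 / 4"] \<kappa>0 \<xi> by (auto simp: less_imp_neq[symmetric])
  \<comment> \<open>The index \<open>i\<close> is known only after the square, so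
    \<open>\<kappa>\<close> and \<open>\<rho>\<close> must suit every
    \<open>i \<le> T\<close>.\<close>
  define \<xi>m where "\<xi>m = Min (\<xi> ` {..T})"
  have \<xi>m: "\<xi>m > 0" using \<xi> by (simp add: \<xi>m_def)
  have \<xi>m_le: "\<xi>m \<le> \<xi> i" if "i \<le> T" for i using that by (simp add: \<xi>m_def)
  define \<kappa> where "\<kappa> = min (\<kappa>0 / 2) (\<xi>m\<^sup>2 / 8)"
  have \<kappa>: "\<kappa> > 0" "\<kappa> \<le> \<kappa>0 / 2" "\<kappa> \<le> \<xi>m\<^sup>2 / 8" using \<kappa>0 \<xi>m by (auto simp: \<kappa>_def)
  define b where "b = 3 * (real T + 1)"
  have b: "b > 0" by (simp add: b_def)
  \<comment> \<open>The energies total at most \<open>b\<close>, so giving up density \<eta>/2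
    outweighs any gain in energy together with the slack \<open>\<kappa>\<close>.\<close>
  define \<nu> where "\<nu> = 2 * (b + \<kappa>) / \<eta>"
  have \<nu>: "\<nu> > 0" using b \<kappa> \<eta> by (simp add: \<nu>_def)
  define e where "e P H t = energy f (2 ^ t) (square P H)" for P H t
  have e03: "0 \<le> e P H t" "e P H t \<le> 3" for P H t
    unfolding e_def using energy_nonneg[OF f01] energy_le_3[OF f01] by auto
  define \<Phi> where "\<Phi> P H = \<nu> * mean (square P H) f + (\<Sum>t\<le>T. e P H t)" for P H
  have mean01: "0 \<le> mean W f" "mean W f \<le> 1" for W
    using f01 by (auto intro: mean_nonneg mean_le)
  have sum_e: "0 \<le> (\<Sum>t\<le>T. e P H t)" "(\<Sum>t\<le>T. e P H t) \<le> b" for P H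
  proof -
    show "0 \<le> (\<Sum>t\<le>T. e P H t)" by (intro sum_nonneg e03)
    have "(\<Sum>t\<le>T. e P H t) \<le> (\<Sum>t\<le>T. 3)" by (intro sum_mono e03)
    then show "(\<Sum>t\<le>T. e P H t) \<le> b" by (simp add: b_def algebra_simps)
  qed
  have \<Phi>: "0 \<le> \<Phi> P H" "\<Phi> P H \<le> \<nu> + b" for P H
  proof -
    show "0 \<le> \<Phi> P H" unfolding \<Phi>_def using \<nu> mean01 sum_e by (intro add_nonneg_nonneg mult_nonneg_nonneg) auto
    have "\<nu> * mean (square P H) f \<le> \<nu> * 1" using \<nu> mean01 by (intro mult_left_mono) auto
    then show "\<Phi> P H \<le> \<nu> + b" unfolding \<Phi>_def using sum_e(2)[of P H] by linarith
  qed
  obtain l where l: "1 \<le> l" and near_max: "\<And>L. \<exists>H\<ge>L. \<exists>P. \<forall>H'\<ge>l. \<forall>P'. \<Phi> P' H' \<le> \<Phi> P H + \<kappa>"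
    using near_maximal[of \<Phi> "\<nu> + b" \<kappa>, OF \<Phi> \<kappa>(1)] by blast

  \<comment> \<open>Enough blocks for \<open>close_pairs\<close> whichever \<open>i \<le> T\<close>
    comes up later.\<close>
  define r where "r = 4 * (\<Sum>i\<le>T. M i)"
  obtain s where s: "\<And>i j u v. j < r \<Longrightarrow> i < j \<Longrightarrow> u \<in> {s i..<s i + l} \<Longrightarrow> v \<in> {s j..<s j + l} \<Longrightarrow> v - u \<notin> F"
    using thick_blocks[OF nsyn l, of r] by blast
  define R where "R = (\<Sum>i<r. \<bar>s i\<bar> + l)"
  have R0: "0 \<le> R" unfolding R_def using l by (intro sum_nonneg) auto
  have S: "{s i..<s i + l} \<subseteq> {-R..R}" if "i < r" for i
  proof -
    have "\<bar>s i\<bar> + l \<le> R" unfolding R_def using that l by (intro member_le_sum) auto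
    then show ?thesis by auto
  qed
  define \<tau> where "\<tau> = \<alpha> ^ 4 - \<epsilon> / 2"
  \<comment> \<open>The threshold depends on \<open>d\<close>, but only the finitely many
    \<open>d\<close> between \<open>- 2 * R\<close> and \<open>2 * R\<close> occur, and these are
    known before the square.\<close>
  have "\<exists>L. \<forall>H\<ge>L. \<forall>P. d \<notin> F \<longrightarrow> mean (square P H) (indicator (En d)) < \<tau>" for d
  proof (cases "d \<in> F")
    case False
    then have "upper_Banach_density (En d) < \<tau>" using \<epsilon> by (simp add: F_def \<tau>_def)
    then show ?thesis using mean_square_less by blast
  qed auto
  then obtain L where L: "\<And>d H P. H \<ge> L d \<Longrightarrow> d \<notin> F \<Longrightarrow> mean (square P H) (indicator (En d)) < \<tau>" by metis
  define c0 where "c0 = \<nu> + b"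
  \<comment> \<open>In the uniformity estimate \<open>\<rho>\<close> enters with the factor
    \<open>c0\<close> from \<open>window_energy_le\<close> and 3 from
    \<open>uniformity\<close>.\<close>
  define \<rho> where "\<rho> = min \<xi>m (\<xi>m\<^sup>2 / (4 * (c0 + 3)))"
  have c0: "c0 > 0" using \<nu> b by (simp add: c0_def)
  have \<rho>: "0 < \<rho>" "\<rho> \<le> \<xi>m" "(c0 + 3) * \<rho> \<le> \<xi>m\<^sup>2 / 4"
  proof -
    show "0 < \<rho>" "\<rho> \<le> \<xi>m" using \<xi>m c0 by (auto simp: \<rho>_def)
    have "(c0 + 3) * \<rho> \<le> (c0 + 3) * (\<xi>m\<^sup>2 / (4 * (c0 + 3)))"
      using c0 by (intro mult_left_mono) (auto simp: \<rho>_def)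
    also have "\<dots> = \<xi>m\<^sup>2 / 4" using c0 by (simp add: field_simps)
    finally show "(c0 + 3) * \<rho> \<le> \<xi>m\<^sup>2 / 4" .
  qed
  define L0 where "L0 = 2 * l + R + \<lceil>48 * R / \<epsilon>\<rceil> + \<lceil>8 * l / \<rho>\<rceil> + (\<Sum>d\<in>{- 2 * R..2 * R}. \<bar>L d\<bar>)"
  obtain H P0 where H: "H \<ge> L0" and max: "\<And>H' P'. H' \<ge> l \<Longrightarrow> \<Phi> P' H' \<le> \<Phi> P0 H + \<kappa>"
    using near_max[of L0] by blast
  have parts: "0 \<le> \<lceil>48 * R / \<epsilon>\<rceil>" "0 \<le> \<lceil>8 * l / \<rho>\<rceil>" "0 \<le> (\<Sum>d\<in>{- 2 * R..2 * R}. \<bar>L d\<bar>)"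
    using R0 \<epsilon> l \<rho>(1) by (auto intro!: sum_nonneg simp: zero_le_divide_iff le_ceiling_iff less_le_trans[OF _ divide_nonneg_pos])
  have H_l: "2 * l \<le> H" "l \<le> H" "1 \<le> H" and H_R: "R \<le> H" using H parts R0 l unfolding L0_def by linarith+
  have H\<epsilon>: "4 * R / H \<le> \<epsilon> / 12"
  proof -
    have "\<lceil>48 * R / \<epsilon>\<rceil> \<le> H" using H parts R0 l unfolding L0_def by linarith
    then have "48 * R / \<epsilon> \<le> H" by (simp add: ceiling_le_iff)
    then show ?thesis using \<epsilon> H_l by (simp add: field_simps)
  qed
  have H\<rho>: "8 * l \<le> \<rho> * H"
  proof -
    have "\<lceil>8 * l / \<rho>\<rceil> \<le> H" using H parts R0 l unfolding L0_def by linarith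
    then have "8 * l / \<rho> \<le> H" by (simp add: ceiling_le_iff)
    then show ?thesis using \<rho>(1) by (simp add: field_simps)
  qed
  have HL: "L d \<le> H" if "d \<in> {- 2 * R..2 * R}" for d
  proof -
    have "\<bar>L d\<bar> \<le> (\<Sum>d\<in>{- 2 * R..2 * R}. \<bar>L d\<bar>)" using that by (intro member_le_sum) auto
    then show ?thesis using H parts R0 l unfolding L0_def by linarith
  qed
  define Q where "Q = square P0 H"
  define \<mu> where "\<mu> = mean Q f"
  have dens: "\<alpha> - \<eta> \<le> \<mu>"
  proof -
    obtain H' P' where H': "H' \<ge> l" "\<alpha> - \<eta> / 2 < mean (square P' H') f"
      using dense_square[of "\<eta> / 2" l E] \<eta> unfolding \<alpha>_def f_def by auto
    have "\<nu> * (\<alpha> - \<eta> / 2) \<le> \<nu> * mean (square P' H') f" using H' \<nu> by (intro mult_left_mono) auto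
    also have "\<dots> \<le> \<Phi> P' H'" unfolding \<Phi>_def using sum_e by simp
    also have "\<dots> \<le> \<Phi> P0 H + \<kappa>" by (rule max[OF H'(1)])
    also have "\<dots> \<le> \<nu> * \<mu> + (b + \<kappa>)" unfolding \<Phi>_def \<mu>_def Q_def using sum_e by simp
    also have "b + \<kappa> = \<nu> * (\<eta> / 2)" using \<eta> by (simp add: \<nu>_def)
    finally have "\<nu> * (\<alpha> - \<eta> / 2) \<le> \<nu> * (\<mu> + \<eta> / 2)" by (simp add: algebra_simps)
    then have "\<alpha> - \<eta> / 2 \<le> \<mu> + \<eta> / 2" using \<nu> by (simp only: mult_le_cancel_left_pos)
    then show ?thesis by simp
  qed

  define a where "a t = energy f (2 ^ t) Q" for t
  have "mono a"
    unfolding a_def by (intro monoI energy_mono[OF f01]) (auto intro: power_increasing)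
  moreover have "0 \<le> a n \<and> a n \<le> 3" for n using e03[of P0 H n] by (simp add: a_def e_def Q_def)
  ultimately obtain i j where ij: "i + j + 1 \<le> T" "a (i + j) - a i \<le> \<kappa>0 / 2" "a (i + j + 1) - a j \<le> (\<xi> i)\<^sup>2 / 4"
    using T by blast
  obtain \<Lambda>1 where \<Lambda>1: "labelling (2 ^ i) \<Lambda>1" "a i - \<kappa> < label_energy f Q \<Lambda>1"
    using energy_approx[of f "2 ^ i" \<kappa> Q, OF f01 _ \<kappa>(1)] unfolding a_def by auto
  obtain \<Lambda>2 where \<Lambda>2: "labelling (2 ^ j) \<Lambda>2" "a j - \<kappa> < label_energy f Q \<Lambda>2"
    using energy_approx[of f "2 ^ j" \<kappa> Q, OF f01 _ \<kappa>(1)] unfolding a_def by auto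
  \<comment> \<open>The join refines \<open>\<Lambda>1\<close>, so the small increment from
    \<open>a i\<close> to \<open>a (i + j)\<close> bounds the cost of coarsening; it also refines
    \<open>\<Lambda>2\<close>, so its energy is almost \<open>a j\<close>, and the small increment
    up to \<open>a (i + j + 1)\<close> gives uniformity.\<close>
  define \<Lambda> where "\<Lambda> = join (2 ^ i) \<Lambda>1 \<Lambda>2"
  have \<Lambda>: "labelling (2 ^ (i + j)) \<Lambda>"
    using labelling_join[OF \<Lambda>1(1) \<Lambda>2(1)] by (simp add: \<Lambda>_def power_add)
  have ref1: "key \<Lambda>1 c p = key \<Lambda>1 c q" and ref2: "key \<Lambda>2 c p = key \<Lambda>2 c q"
    if "key \<Lambda> c p = key \<Lambda> c q" for c p q
    using key_join_eqD[OF \<Lambda>1(1) that[unfolded \<Lambda>_def]] by auto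
  have en_\<Lambda>: "label_energy f Q \<Lambda> \<le> a (i + j)" unfolding a_def by (rule energy_ge[OF f01 \<Lambda>])
  have "label_energy f Q \<Lambda>2 \<le> label_energy f Q \<Lambda>" by (rule label_energy_refine[OF f01]) (auto simp: Q_def intro: ref2)
  then have en_\<Lambda>': "a j - \<kappa> \<le> label_energy f Q \<Lambda>" using \<Lambda>2 by simp
  have diff: "label_energy f Q \<Lambda> - label_energy f Q \<Lambda>1 \<le> \<kappa>0" using en_\<Lambda> ij(2) \<Lambda>1(2) \<kappa>(2) by linarith
  define E' where "E' = a (i + j + 1) + (\<kappa> + (\<nu> + 3 * (real T + 1)) * \<rho>)"
  have bdry: "H\<^sup>2 - (H - l + 1)\<^sup>2 \<le> \<rho> * (H - l + 1)\<^sup>2" "(H + l - 1)\<^sup>2 - (H - l + 1)\<^sup>2 \<le> \<rho> * H\<^sup>2"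
    using small_boundary[OF l H_l(1) H\<rho>] by auto
  have "(\<Sum>P\<in>square P0 (H - l + 1). energy f (2 ^ (i + j + 1)) (square P l)) \<le> (H - l + 1)\<^sup>2 * E'"
    unfolding E'_def a_def Q_def
    by (rule window_energy_le[where f = f and \<nu> = \<nu> and T = T, OF f01 l H_l(2) less_imp_le[OF \<nu>] _ bdry(1) ij(1)])
      (use max[of l] in \<open>simp add: \<Phi>_def e_def\<close>)
  then have win: "(\<Sum>P\<in>square P0 (H - l + 1). energy f (2 * 2 ^ (i + j)) (square P l)) \<le> (H - l + 1)\<^sup>2 * E'"
    by simp
  have i: "i \<le> T" using ij(1) by simp
  have \<xi>m_sq: "\<xi>m\<^sup>2 \<le> (\<xi> i)\<^sup>2" using \<xi>m_le[OF i] \<xi>m by (intro power_mono) auto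
  have \<xi>i: "E' - label_energy f Q \<Lambda> + 3 * \<rho> \<le> (\<xi> i)\<^sup>2"
  proof -
    have "E' - label_energy f Q \<Lambda> + 3 * \<rho> = (a (i + j + 1) - label_energy f Q \<Lambda>) + \<kappa> + (c0 + 3) * \<rho>"
      by (simp add: E'_def c0_def b_def algebra_simps)
    also have "\<dots> \<le> ((\<xi> i)\<^sup>2 / 4 + \<kappa>) + \<kappa> + \<xi>m\<^sup>2 / 4"
      using ij(3) en_\<Lambda>' \<rho>(3) by linarith
    also have "\<dots> \<le> (\<xi> i)\<^sup>2" using \<kappa>(3) \<xi>m_sq zero_le_power2[of "\<xi> i"] by linarith
    finally show ?thesis .
  qed
  have r: "4 * cell_number (2 ^ i) (\<delta> i) \<le> r"
    unfolding r_def M_def[symmetric] using i by (intro mult_le_mono2 member_le_sum) auto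
  have upper: "corner_sum (square P0 H) (cut (square P0 H) f) (cut (square P0 H) f) (cut (square P0 H) f) (v - u) \<le> H\<^sup>2 * \<tau>"
    if "i < j" "j < r" "u \<in> {s i..<s i + l}" "v \<in> {s j..<s j + l}" for i j u v
  proof -
    have "u \<in> {-R..R}" "v \<in> {-R..R}" using S[of i] S[of j] that by (meson less_trans subsetD)+
    then have "v - u \<in> {- 2 * R..2 * R}" by auto
    then have "mean (square P0 H) (indicator (En (v - u))) < \<tau>" using L HL s that by blast
    then have "H\<^sup>2 * mean (square P0 H) (indicator (En (v - u))) \<le> H\<^sup>2 * \<tau>" by (intro mult_left_mono) auto
    then show ?thesis
      using corner_sum_le_mean[OF H_l(3), of P0 E "v - u"] unfolding f_def En_def by linarith
  qed
  have "\<mu> ^ 4 - 48 * (real (2 ^ i))\<^sup>2 * \<delta> i - 4 * R / H - 3 * sqrt \<kappa>0 - 48 * (real (M i))\<^sup>2 * (\<xi> i + \<rho>) \<le> \<tau>"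
    unfolding \<mu>_def Q_def M_def
    by (rule tile_estimate[of f "2 ^ i" \<Lambda>1 "2 ^ (i + j)" \<Lambda> l H R "\<delta> i" P0 \<kappa>0 E' \<rho> "\<xi> i" r s \<tau>,
          OF f01 \<Lambda>1(1) \<Lambda> ref1 l H_l(2) R0 H_R \<delta>(1,2) diff[unfolded Q_def] win \<xi>i[unfolded Q_def]
            less_imp_le[OF \<xi>] bdry less_imp_le[OF \<rho>(1)] r S upper])
  moreover have "3 * sqrt \<kappa>0 = \<epsilon> / 12" using \<epsilon> by (simp add: \<kappa>0_def)
  moreover have "48 * (real (M i))\<^sup>2 * (\<xi> i + \<rho>) \<le> \<epsilon> / 12"
  proof -
    have "48 * (real (M i))\<^sup>2 * (\<xi> i + \<rho>) \<le> 48 * (real (M i))\<^sup>2 * (2 * \<xi> i)"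
      using \<rho>(2) \<xi>m_le[OF i] by (intro mult_left_mono) auto
    also have "\<dots> = \<epsilon> / 12" using M0[of i] by (simp add: \<xi>_def)
    finally show ?thesis .
  qed
  moreover have "\<alpha> ^ 4 \<le> \<mu> ^ 4 + \<epsilon> / 12"
    using power4_diff_le[OF \<alpha> mean01 dens[unfolded \<mu>_def]] \<eta> by (simp add: \<mu>_def \<eta>_def)
  ultimately show False using \<delta>(3)[of i] H\<epsilon> \<epsilon> unfolding \<tau>_def by linarith
qed

end
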